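(* Suppose that $\max_{a,b\in[k]}\Delta_{ab}\le C_q\Delta$ for some universal constant $C_q>0$. Under the Sub-Gaussian Mixture Model, there exist universal constants $C_s,C_m,C_e>0$ such that if $s^2\ge C_s\left(\sqrt{\frac{kd}{n}\log n}+\frac{kd}{n}+k\right)$, then the center estimates $\widehat{\boldsymbol\mu}_a=\frac kn\sum_{i:\widehat\sigma_i=a}\mathbf h_i$ satisfy \[ \max_{a\in[k]}\min_{\pi\in S_k}\|\widehat{\boldsymbol\mu}_a-\boldsymbol\mu_{\pi(a)}\|_2\le C_m\tau\left(\sqrt{\frac{k(d+\log n)}{n}}+\sqrt{d+\log n}\cdot\exp\left[-\frac{s^2}{C_e}\right]\right) \] with probability at least $1-4n^{-1}$.
   Context: Sub-Gaussian norm: $\|X\|_{\psi_2}=\inf\{t>0:\mathbb E\exp(X^2/t^2)\le 2\}$ for real $X$; $\|\mathbf x\|_{\psi_2}=\sup_{\|\mathbf u\|_2=1}\|\langle\mathbf x,\mathbf u\rangle\|_{\psi_2}$ for random vectors. Model: integers $n\ge 4$, $k\ge 2$ with $k\mid n$; centers $\boldsymbol\mu_1,\dots,\boldsymbol\mu_k\in\mathbb R^d$; labels $\sigma^*_i\in[k]$ with each cluster of size $n/k$. Observations $\mathbf h_i=\boldsymbol\mu_{\sigma^*_i}+\mathbf g_i$ with $\mathbf g_i$ independent sub-Gaussian random vectors, $\|\mathbf g_i\|_{\psi_2}\le\tau$. $\Delta_{ab}=\|\boldsymbol\mu_a-\boldsymbol\mu_b\|_2$, $\Delta=\min_{a\ne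 b}\Delta_{ab}$, $s=\Delta/\tau$. $S_k$ is the set of permutations of $[k]$. SDP: $A_{ij}=\|\mathbf h_i-\mathbf h_j\|_2^2$; $\widehat{\mathbf Y}$ minimizes $\langle\mathbf Y,\mathbf A\rangle$ over $\mathbf Y\in\mathbb R^{n\times n}$ subject to $\mathbf Y\mathbf 1_n=\frac nk\mathbf 1_n$, $\mathbf Y\succeq0$, $\mathrm{diag}(\mathbf Y)=\mathbf 1_n$, $\mathbf Y\ge0$. Labels $\widehat{\boldsymbol\sigma}$ are obtained from $\widehat{\mathbf Y}$ by the rounding procedure: Step 1: set $V=[n]$, $t=0$; while $V\setminus\bigcup_{i\le t}B_i\neq\emptyset$: increase $t$, let $V_t=V\setminus\bigcup_{i<t}B_i$, for $u\in V_t$ let $B(u)=\{w\in V_t:\|\widehat{\mathbf Y}_{u\bullet}-\widehat{\mathbf Y}_{w\bullet}\|_1\le\frac{n}{4k}\}$ (rows, entrywise $\ell_1$ norm), let $B_t$ be a largest such $B(u)$, truncated arbitrarily to size $n/k$ if larger. Step 2: take the $k$ largest sets $U_1,\dots,U_k$ among the $B_t$'s, distribute the elements of the other sets arbitrarily among them so each has exactly $n/k$ elements, and set $\widehat\sigma_i=t$ iff $i\in U_t$.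
   Formalization: The noise vectors g_i are additionally assumed to have mean zero (constant noise of size about τ refutes the bound otherwise), τ>0 is assumed, and the constants are stated for probability spaces over one arbitrary fixed underlying type. *)

theory Defs
  imports "HOL-Probability.Probability" "HOL-Combinatorics.Permutations"
begin

(* Vectors in R^d are represented as functions nat => real; only coordinates j < d matter.
   n x n matrices are functions nat => nat => real; only entries i, j < n matter.
   Cluster labels are 0-based: [k] is rendered as {..<k}. *)

definition vnorm :: "nat \<Rightarrow> (nat \<Rightarrow> real) \<Rightarrow> real" where
  "vnorm d x = sqrt (\<Sum>j<d. (x j)\<^sup>2)"

definition vdiff :: "(nat \<Rightarrow> real) \<Rightarrow> (nat \<Rightarrow> real) \<Rightarrow> (nat \<Rightarrow> real)" where
  "vdiff x y = (\<lambda>j. x j - y j)"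

(* sub-Gaussian (psi_2) norm of a real random variable, as an extended real (Inf {} = \<infinity>) *)
definition psi2 :: "'a measure \<Rightarrow> ('a \<Rightarrow> real) \<Rightarrow> ereal" where
  "psi2 M X = Inf {ereal t | t. t > 0 \<and>
      (\<integral>\<^sup>+ \<omega>. ennreal (exp ((X \<omega>)\<^sup>2 / t\<^sup>2)) \<partial>M) \<le> 2}"

definition psi2_vec :: "'a measure \<Rightarrow> nat \<Rightarrow> ('a \<Rightarrow> nat \<Rightarrow> real) \<Rightarrow> ereal" where
  "psi2_vec M d g = Sup {psi2 M (\<lambda>\<omega>. \<Sum>j<d. g \<omega> j * u j) | u. (\<Sum>j<d. (u j)\<^sup>2) = 1}"

definition Delta_ab :: "nat \<Rightarrow> (nat \<Rightarrow> nat \<Rightarrow> real) \<Rightarrow> nat \<Rightarrow> nat \<Rightarrow> real" where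
  "Delta_ab d \<mu> a b = vnorm d (vdiff (\<mu> a) (\<mu> b))"

definition Delta_min :: "nat \<Rightarrow> nat \<Rightarrow> (nat \<Rightarrow> nat \<Rightarrow> real) \<Rightarrow> real" where
  "Delta_min k d \<mu> = Min {Delta_ab d \<mu> a b | a b. a < k \<and> b < k \<and> a \<noteq> b}"

definition frob :: "nat \<Rightarrow> (nat \<Rightarrow> nat \<Rightarrow> real) \<Rightarrow> (nat \<Rightarrow> nat \<Rightarrow> real) \<Rightarrow> real" where
  "frob n Y A = (\<Sum>i<n. \<Sum>j<n. Y i j * A i j)"

definition psd :: "nat \<Rightarrow> (nat \<Rightarrow> nat \<Rightarrow> real) \<Rightarrow> bool" where
  "psd n Y \<longleftrightarrow> (\<forall>i<n. \<forall>j<n. Y i j = Y j i) \<and>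
      (\<forall>x :: nat \<Rightarrow> real. (\<Sum>i<n. \<Sum>j<n. x i * Y i j * x j) \<ge> 0)"

definition sdp_feasible :: "nat \<Rightarrow> nat \<Rightarrow> (nat \<Rightarrow> nat \<Rightarrow> real) \<Rightarrow> bool" where
  "sdp_feasible n k Y \<longleftrightarrow>
      (\<forall>i<n. (\<Sum>j<n. Y i j) = real n / real k) \<and> psd n Y \<and>
      (\<forall>i<n. Y i i = 1) \<and> (\<forall>i<n. \<forall>j<n. Y i j \<ge> 0)"

definition sdp_minimizer :: "nat \<Rightarrow> nat \<Rightarrow> (nat \<Rightarrow> nat \<Rightarrow> real) \<Rightarrow> (nat \<Rightarrow> nat \<Rightarrow> real) \<Rightarrow> bool" where
  "sdp_minimizer n k A Y \<longleftrightarrow> sdp_feasible n k Y \<and>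
      (\<forall>Y'. sdp_feasible n k Y' \<longrightarrow> frob n Y A \<le> frob n Y' A)"

definition dist_matrix :: "nat \<Rightarrow> (nat \<Rightarrow> nat \<Rightarrow> real) \<Rightarrow> (nat \<Rightarrow> nat \<Rightarrow> real)" where
  "dist_matrix d h = (\<lambda>i j. (vnorm d (vdiff (h i) (h j)))\<^sup>2)"

definition row_l1 :: "nat \<Rightarrow> (nat \<Rightarrow> nat \<Rightarrow> real) \<Rightarrow> nat \<Rightarrow> nat \<Rightarrow> real" where
  "row_l1 n Y u w = (\<Sum>j<n. \<bar>Y u j - Y w j\<bar>)"

definition rball :: "nat \<Rightarrow> nat \<Rightarrow> (nat \<Rightarrow> nat \<Rightarrow> real) \<Rightarrow> nat set \<Rightarrow> nat \<Rightarrow> nat set" where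
  "rball n k Y V u = {w \<in> V. row_l1 n Y u w \<le> real n / (4 * real k)}"

(* Bs = [B_1, ..., B_T] is a possible run of Step 1 *)
definition rounding_step1 :: "nat \<Rightarrow> nat \<Rightarrow> (nat \<Rightarrow> nat \<Rightarrow> real) \<Rightarrow> nat set list \<Rightarrow> bool" where
  "rounding_step1 n k Y Bs \<longleftrightarrow>
     \<Union>(set Bs) = {..<n} \<and>
     (\<forall>t<length Bs. let V = {..<n} - \<Union>(set (take t Bs)) in
        V \<noteq> {} \<and>
        (\<exists>u\<in>V. (\<forall>w\<in>V. card (rball n k Y V w) \<le> card (rball n k Y V u)) \<and>
           (if card (rball n k Y V u) \<le> n div k then Bs ! t = rball n k Y V u
            else Bs ! t \<subseteq> rball n k Y V u \<and> card (Bs ! t) = n div k)))"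

(* sigma is a possible output of the full rounding procedure (Steps 1 and 2) applied to Y;
   U_a = B_{t a}, enlarged to exactly n/k elements *)
definition rounding_output :: "nat \<Rightarrow> nat \<Rightarrow> (nat \<Rightarrow> nat \<Rightarrow> real) \<Rightarrow> (nat \<Rightarrow> nat) \<Rightarrow> bool" where
  "rounding_output n k Y \<sigma> \<longleftrightarrow>
     (\<exists>Bs t. rounding_step1 n k Y Bs \<and>
        inj_on t {..<k} \<and> t ` {..<k} \<subseteq> {..<length Bs} \<and>
        (\<forall>s<length Bs. s \<notin> t ` {..<k} \<longrightarrow> (\<forall>a<k. card (Bs ! s) \<le> card (Bs ! t a))) \<and>
        (\<forall>a<k. Bs ! t a \<subseteq> {i. \<sigma> i = a}) \<and>
        (\<forall>i<n. \<sigma> i < k) \<and>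
        (\<forall>a<k. card {i. i < n \<and> \<sigma> i = a} = n div k))"

definition center_est :: "nat \<Rightarrow> nat \<Rightarrow> (nat \<Rightarrow> nat \<Rightarrow> real) \<Rightarrow> (nat \<Rightarrow> nat) \<Rightarrow> nat \<Rightarrow> (nat \<Rightarrow> real)" where
  "center_est n k h \<sigma> a = (\<lambda>j. real k / real n * (\<Sum>i\<in>{i. i < n \<and> \<sigma> i = a}. h i j))"

end

theory Submission
  imports Defs
begin

text \<open>Optimality of \<open>Y\<close> against the true membership matrix \<open>Ystar\<close> bounds \<open>\<Delta>\<^sup>2\<close> times the error
  \<open>\<gamma> = \<parallel>Y - Ystar\<parallel>\<^sub>1\<close> by two noise terms. In the quadratic one, the component of \<open>Y - Ystar\<close> orthogonal
  to the cluster indicators is positive semidefinite with trace \<open>\<gamma> k / (2 n)\<close>, so it only sees the operator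
  norm of the noise, and the remaining components only see inner products of noise vectors with cluster
  sums of the noise; under the signal-to-noise condition both are absorbed into a small multiple of
  \<open>\<Delta>\<^sup>2 \<gamma>\<close>. In the linear term every point whose projections onto the center differences stay below
  \<open>\<Delta>\<^sup>2 / 32\<close> is absorbed as well, and the total excess of the others has exponentially small second moment, so
  Chebyshev's inequality leaves \<open>\<gamma> \<le> n\<^sup>2 exp (- s\<^sup>2 / C)\<close> up to a constant. Rounding therefore misplaces an
  exponentially small fraction of each cluster, which enters the center estimates only through the norms of
  single noise vectors; the rest of the error is the average noise of a true cluster.\<close>

section \<open>Vectors and positive semidefinite matrices\<close>

text \<open>The labels \<open>\<sigma>hat\<close> are an arbitrary function of the sample point.
  Therefore the good event is defined by the noise alone, and on it the bound is deterministic for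
  every minimizer and every run of the rounding. The squared norms of single noise vectors enter the
  distances with full weight and may be of order \<open>d\<close>, which the signal-to-noise
  condition does not control; they cancel because the rows of \<open>Y\<close> and
  \<open>Ystar\<close> have equal sums. Of the available \<open>D\<^sup>2 / 2\<close>, the
  threshold, the operator norm and the cross terms each take at most \<open>D\<^sup>2 / 16\<close>;
  this is behind the constants 1/32 and 20000. Chebyshev's inequality, rather than an exponential
  bound, is enough since the excess may fail with probability \<open>1 / (4 * n)\<close>; its price
  is a square root, which halves the exponent.\<close>

definition dot :: "nat \<Rightarrow> (nat \<Rightarrow> real) \<Rightarrow> (nat \<Rightarrow> real) \<Rightarrow> real" where
  "dot d x y = (\<Sum>l<d. x l * y l)"

lemma dot_commute: "dot d x y = dot d y x"
  by (simp add: dot_def mult.commute)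

lemma dot_self_nonneg: "0 \<le> dot d x x"
  by (simp add: dot_def sum_nonneg)

lemma dot_add_left: "dot d (\<lambda>l. x l + y l) z = dot d x z + dot d y z"
  by (simp add: dot_def algebra_simps sum.distrib)

lemma dot_diff_left: "dot d (\<lambda>l. x l - y l) z = dot d x z - dot d y z"
  by (simp add: dot_def algebra_simps sum_subtractf)

lemma dot_scale_left: "dot d (\<lambda>l. c * x l) z = c * dot d x z"
  by (simp add: dot_def algebra_simps sum_distrib_left)

lemma dot_add_right: "dot d z (\<lambda>l. x l + y l) = dot d z x + dot d z y"
  by (simp add: dot_commute[of d z] dot_add_left)

lemma dot_diff_right: "dot d z (\<lambda>l. x l - y l) = dot d z x - dot d z y"
  by (simp add: dot_commute[of d z] dot_diff_left)

lemma dot_scale_right: "dot d z (\<lambda>l. c * x l) = c * dot d z x"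
  by (simp add: dot_commute[of d z] dot_scale_left)

lemma dot_sum_left: "dot d (\<lambda>l. \<Sum>i\<in>R. x i l) z = (\<Sum>i\<in>R. dot d (x i) z)"
  by (simp add: dot_def sum_distrib_right sum.swap[of _ R])

lemma dot_sum_right: "dot d z (\<lambda>l. \<Sum>i\<in>R. x i l) = (\<Sum>i\<in>R. dot d z (x i))"
  by (simp add: dot_commute[of d z] dot_sum_left)

lemma vnorm_eq_L2_set: "vnorm d x = L2_set x {..<d}"
  by (simp add: vnorm_def L2_set_def)

lemma vnorm_nonneg [simp]: "0 \<le> vnorm d x"
  by (simp add: vnorm_def sum_nonneg)

lemma vnorm_eq_sqrt_dot: "vnorm d x = sqrt (dot d x x)"
  by (simp add: vnorm_def dot_def power2_eq_square)

lemma vnorm_power2: "(vnorm d x)\<^sup>2 = dot d x x"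
  by (simp add: vnorm_eq_sqrt_dot dot_self_nonneg)

lemma dot_power2_le: "(dot d x y)\<^sup>2 \<le> dot d x x * dot d y y"
  using Cauchy_Schwarz_ineq_sum[of x y "{..<d}"]
  by (simp add: dot_def power2_eq_square)

lemma abs_dot_le: "\<bar>dot d x y\<bar> \<le> vnorm d x * vnorm d y"
  using real_sqrt_le_mono[OF dot_power2_le[of d x y]]
  by (simp add: vnorm_eq_sqrt_dot real_sqrt_mult)

lemma vnorm_add_le: "vnorm d (\<lambda>l. x l + y l) \<le> vnorm d x + vnorm d y"
  by (simp add: vnorm_eq_L2_set L2_set_triangle_ineq)

lemma vnorm_scale: "vnorm d (\<lambda>l. c * x l) = \<bar>c\<bar> * vnorm d x"
  by (simp add: vnorm_def power_mult_distrib sum_distrib_left[symmetric] real_sqrt_mult)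

lemma vnorm_diff_le: "vnorm d (\<lambda>l. x l - y l) \<le> vnorm d x + vnorm d y"
  using vnorm_add_le[of d x "\<lambda>l. -1 * y l"] vnorm_scale[of d "-1" y] by simp

lemma vnorm_sum_le: "vnorm d (\<lambda>l. \<Sum>i\<in>R. x i l) \<le> (\<Sum>i\<in>R. vnorm d (x i))"
proof (induction R rule: infinite_finite_induct)
  case (insert a F)
  then show ?case
    using vnorm_add_le[of d "x a" "\<lambda>l. \<Sum>i\<in>F. x i l"] by simp
qed (simp_all add: vnorm_def)

lemma dot_cong: "(\<And>l. l < d \<Longrightarrow> x l = x' l) \<Longrightarrow> (\<And>l. l < d \<Longrightarrow> y l = y' l) \<Longrightarrow> dot d x y = dot d x' y'"
  by (simp add: dot_def)

lemma sum_swap3: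
  "(\<Sum>i\<in>A. \<Sum>j\<in>B. \<Sum>p\<in>C. f i j p) = (\<Sum>p\<in>C. \<Sum>i\<in>A. \<Sum>j\<in>B. f i j p)"
proof -
  have "(\<Sum>i\<in>A. \<Sum>j\<in>B. \<Sum>p\<in>C. f i j p) = (\<Sum>i\<in>A. \<Sum>p\<in>C. \<Sum>j\<in>B. f i j p)"
    by (intro sum.cong refl sum.swap)
  also have "\<dots> = (\<Sum>p\<in>C. \<Sum>i\<in>A. \<Sum>j\<in>B. f i j p)"
    by (rule sum.swap)
  finally show ?thesis .
qed

lemma sum_swap4:
  "(\<Sum>i\<in>A. \<Sum>j\<in>B. \<Sum>a\<in>C. \<Sum>b\<in>D. f i j a b) = (\<Sum>a\<in>C. \<Sum>b\<in>D. \<Sum>i\<in>A. \<Sum>j\<in>B. f i j a b)"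
  by (subst sum_swap3) (intro sum.cong refl sum_swap3)

section \<open>Positive semidefinite matrices\<close>

lemma psd_quadratic_form_nonneg: "psd n Y \<Longrightarrow> 0 \<le> (\<Sum>i<n. \<Sum>j<n. x i * Y i j * x j)"
  by (simp add: psd_def)

text \<open>The form at \<open>x\<close> is the form of \<open>Y\<close> at the transpose of
  \<open>F\<close> applied to \<open>x\<close>.\<close>

lemma psd_congruence:
  assumes "psd n Y"
  shows "psd n (\<lambda>i j. \<Sum>a<n. \<Sum>b<n. F i a * Y a b * F j b)"
  unfolding psd_def
proof (intro conjI allI impI)
  have sym: "Y a b = Y b a" if "a < n" "b < n" for a b
    using assms that by (simp add: psd_def)
  fix i j
  have "(\<Sum>a<n. \<Sum>b<n. F i a * Y a b * F j b) = (\<Sum>b<n. \<Sum>a<n. F i a * Y a b * F j b)"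
    by (rule sum.swap)
  also have "\<dots> = (\<Sum>b<n. \<Sum>a<n. F j b * Y b a * F i a)"
    by (intro sum.cong refl) (simp add: sym)
  finally show "(\<Sum>a<n. \<Sum>b<n. F i a * Y a b * F j b) = (\<Sum>b<n. \<Sum>a<n. F j b * Y b a * F i a)" .
next
  fix x :: "nat \<Rightarrow> real"
  let ?y = "\<lambda>a. \<Sum>i<n. x i * F i a"
  have "(\<Sum>i<n. \<Sum>j<n. x i * (\<Sum>a<n. \<Sum>b<n. F i a * Y a b * F j b) * x j)
      = (\<Sum>i<n. \<Sum>j<n. \<Sum>a<n. \<Sum>b<n. (x i * F i a) * Y a b * (x j * F j b))"
    by (simp add: sum_distrib_left sum_distrib_right mult_ac)
  also have "\<dots> = (\<Sum>a<n. \<Sum>b<n. \<Sum>i<n. \<Sum>j<n. (x i * F i a) * Y a b * (x j * F j b))"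
    by (rule sum_swap4)
  also have "\<dots> = (\<Sum>a<n. \<Sum>b<n. ?y a * Y a b * ?y b)"
    by (simp add: sum_distrib_left sum_distrib_right mult_ac)
  also have "\<dots> \<ge> 0"
    by (rule psd_quadratic_form_nonneg[OF assms])
  finally show "0 \<le> (\<Sum>i<n. \<Sum>j<n. x i * (\<Sum>a<n. \<Sum>b<n. F i a * Y a b * F j b) * x j)" .
qed

text \<open>The test vector is supported on two indices. Weights 1 and -1 bound the entries of a
  matrix with unit diagonal; letting one weight run freely forces the entries beside a zero diagonal
  entry to vanish.\<close>

lemma psd_quadratic_form_two:
  assumes "psd n Q" "i < n" "j < n" "i \<noteq> j"
  shows "0 \<le> s\<^sup>2 * Q i i + 2 * s * t * Q i j + t\<^sup>2 * Q j j"
proof -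
  let ?x = "\<lambda>a. (if a = i then s else 0) + (if a = j then t else (0::real))"
  have sym: "Q j i = Q i j" using assms by (auto simp: psd_def)
  have 1: "(\<Sum>a<n. ?x a * f a) = s * f i + t * f j" for f :: "nat \<Rightarrow> real"
  proof -
    have "(\<Sum>a<n. ?x a * f a) = (\<Sum>a<n. if a = i then s * f i else 0) + (\<Sum>a<n. if a = j then t * f j else 0)"
      unfolding sum.distrib[symmetric] by (intro sum.cong) (auto simp: algebra_simps)
    then show ?thesis using assms by simp
  qed
  have "0 \<le> (\<Sum>a<n. \<Sum>b<n. ?x a * Q a b * ?x b)"
    by (rule psd_quadratic_form_nonneg[OF assms(1)])
  also have "\<dots> = (\<Sum>a<n. ?x a * (\<Sum>b<n. ?x b * Q a b))"
    unfolding sum_distrib_left by (intro sum.cong refl) (simp only: mult_ac)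
  also have "\<dots> = s * (s * Q i i + t * Q i j) + t * (s * Q j i + t * Q j j)"
    unfolding 1 ..
  finally show ?thesis
    by (simp add: sym algebra_simps power2_eq_square)
qed

lemma psd_diag_nonneg:
  assumes "psd n Q" "i < n"
  shows "0 \<le> Q i i"
proof -
  let ?x = "\<lambda>a. if a = i then 1 else (0::real)"
  have "0 \<le> (\<Sum>a<n. \<Sum>b<n. ?x a * Q a b * ?x b)"
    by (rule psd_quadratic_form_nonneg[OF assms(1)])
  also have "\<dots> = (\<Sum>a<n. if a = i then (\<Sum>b<n. if b = i then Q a b else 0) else 0)"
    by (intro sum.cong refl) (auto simp: if_distrib[of "times _"] cong: if_cong)
  also have "\<dots> = Q i i"
    using assms(2) by simp
  finally show ?thesis .
qed

lemma psd_zero_diag: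
  assumes "psd n Q" "i < n" "j < n" "Q j j = 0"
  shows "Q i j = 0"
proof (cases "i = j")
  case False
  have nn: "0 \<le> Q i i + 2 * t * Q i j" for t
    using psd_quadratic_form_two[OF assms(1-3) False, of 1 t] assms(4) by simp
  show ?thesis
  proof (rule ccontr)
    assume "Q i j \<noteq> 0"
    \<comment> \<open>This \<open>t\<close> makes the nonnegative affine function equal to
      -1.\<close>
    then show False
      using nn[of "- (Q i i + 1) / (2 * Q i j)"] by (simp add: field_simps)
  qed
qed (use assms in simp)

lemma sum_lessThan_Suc_square:
  fixes f :: "nat \<Rightarrow> nat \<Rightarrow> real"
  shows "(\<Sum>i<Suc n. \<Sum>j<Suc n. f i j)
    = (\<Sum>i<n. \<Sum>j<n. f i j) + (\<Sum>i<n. f i n) + (\<Sum>j<n. f n j) + f n n"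
  by (simp add: sum.distrib)

text \<open>Cholesky factorisation, peeling off the last index by a Schur complement.\<close>

lemma psd_gram:
  assumes "psd n Q"
  shows "\<exists>V. \<forall>i<n. \<forall>j<n. Q i j = (\<Sum>p<n. V p i * V p j)"
  using assms
proof (induction n arbitrary: Q)
  case (Suc n)
  have sym: "Q i j = Q j i" if "i < Suc n" "j < Suc n" for i j
    using Suc.prems that unfolding psd_def by blast
  define q where "q = Q n n"
  \<comment> \<open>If the last diagonal entry is 0, its whole column vanishes by
    \<open>psd_zero_diag\<close>, so the rank-one part is 0.\<close>
  define r where "r = (\<lambda>i. if q = 0 then 0 else Q i n / sqrt q)"
  define Q' where "Q' = (\<lambda>i j. Q i j - r i * r j)"
  have q0: "0 \<le> q"
    using psd_diag_nonneg[OF Suc.prems] by (simp add: q_def)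
  have rn: "Q i n = r i * r n" if "i < Suc n" for i
    using psd_zero_diag[OF Suc.prems that, of n] q0
    by (auto simp: r_def q_def)
  have "psd n Q'"
    unfolding psd_def
  proof (intro conjI allI impI)
    fix i j assume "i < n" "j < n"
    then show "Q' i j = Q' j i"
      using sym[of i j] by (simp add: Q'_def)
  next
    fix x :: "nat \<Rightarrow> real"
    define S where "S = (\<Sum>i<n. x i * r i)"
    \<comment> \<open>This last coordinate minimizes the enlarged form and cancels its rank-one
      part, leaving the form of \<open>Q'\<close> at \<open>x\<close>.\<close>
    define t where "t = (if q = 0 then 0 else - S / sqrt q)"
    define y where "y = (\<lambda>i. if i < n then x i else t)"
    have tr: "(S + t * r n)\<^sup>2 = 0"
      using q0 by (auto simp: t_def r_def q_def S_def real_div_sqrt)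
    have "0 \<le> (\<Sum>i<Suc n. \<Sum>j<Suc n. y i * Q i j * y j)"
      using Suc.prems unfolding psd_def by blast
    also have "\<dots> = (\<Sum>i<n. \<Sum>j<n. x i * Q i j * x j) + (\<Sum>i<n. x i * Q i n * t)
        + (\<Sum>j<n. t * Q n j * x j) + t * Q n n * t"
      unfolding sum_lessThan_Suc_square by (simp add: y_def)
    also have "(\<Sum>j<n. t * Q n j * x j) = (\<Sum>i<n. x i * Q i n * t)"
      by (intro sum.cong refl) (simp add: sym[of n])
    also have "(\<Sum>i<n. x i * Q i n * t) = t * r n * S"
      unfolding S_def sum_distrib_left by (intro sum.cong refl) (simp add: rn)
    also have "Q n n = r n * r n" using rn[of n] by simp
    also have "(\<Sum>i<n. \<Sum>j<n. x i * Q i j * x j) = (\<Sum>i<n. \<Sum>j<n. x i * Q' i j * x j) + S * S"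
      by (simp add: Q'_def S_def sum_product algebra_simps sum_subtractf)
    finally have "0 \<le> (\<Sum>i<n. \<Sum>j<n. x i * Q' i j * x j) + (S + t * r n)\<^sup>2"
      by (simp add: algebra_simps power2_eq_square)
    then show "0 \<le> (\<Sum>i<n. \<Sum>j<n. x i * Q' i j * x j)"
      by (simp add: tr)
  qed
  from Suc.IH[OF this] obtain V where
    V: "\<And>i j. i < n \<Longrightarrow> j < n \<Longrightarrow> Q' i j = (\<Sum>p<n. V p i * V p j)" by blast
  define V' where "V' = (\<lambda>p i. if p < n then (if i < n then V p i else 0) else r i)"
  show ?case
  proof (intro exI[of _ V'] allI impI)
    fix i j assume ij: "i < Suc n" "j < Suc n"
    show "Q i j = (\<Sum>p<Suc n. V' p i * V' p j)"
    proof (cases "i < n \<and> j < n")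
      case True
      then show ?thesis
        using V[of i j] by (simp add: V'_def Q'_def)
    next
      case False
      then have "i = n \<or> j = n" using ij by auto
      then show ?thesis
        using rn[OF ij(1)] rn[OF ij(2)] sym[OF ij] by (auto simp: V'_def)
    qed
  qed
qed simp

text \<open>A matrix and its transpose have the same operator norm. For \<open>v\<close> the
  combination of the \<open>g i\<close> with weights \<open>x i\<close>, Cauchy-Schwarz bounds the
  square of \<open>dot d v v\<close> by a multiple of \<open>dot d v v\<close> itself, and one
  factor cancels.\<close>

lemma operator_norm_transpose:
  assumes op: "\<And>u. (\<Sum>i<n. (dot d (g i) u)\<^sup>2) \<le> lam * dot d u u" and "0 \<le> lam"
  shows "dot d (\<lambda>l. \<Sum>i<n. x i * g i l) (\<lambda>l. \<Sum>i<n. x i * g i l) \<le> lam * (\<Sum>i<n. (x i)\<^sup>2)"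
proof -
  define v where "v = (\<lambda>l. \<Sum>i<n. x i * g i l)"
  have "dot d v v = (\<Sum>i<n. x i * dot d (g i) v)"
    by (subst v_def) (simp add: dot_sum_left dot_scale_left)
  then have "(dot d v v)\<^sup>2 \<le> (\<Sum>i<n. (x i)\<^sup>2) * (\<Sum>i<n. (dot d (g i) v)\<^sup>2)"
    by (simp add: Cauchy_Schwarz_ineq_sum)
  also have "\<dots> \<le> (\<Sum>i<n. (x i)\<^sup>2) * (lam * dot d v v)"
    by (intro mult_left_mono op sum_nonneg) auto
  finally have *: "dot d v v * dot d v v \<le> (lam * (\<Sum>i<n. (x i)\<^sup>2)) * dot d v v"
    by (simp add: power2_eq_square mult_ac)
  show ?thesis
  proof (cases "dot d v v = 0")
    case True
    then show ?thesis using assms(2) by (simp add: v_def sum_nonneg)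
  next
    case False
    then have "dot d v v > 0" using dot_self_nonneg[of d v] by simp
    with * have "dot d v v \<le> lam * (\<Sum>i<n. (x i)\<^sup>2)"
      by (simp add: mult_le_cancel_right)
    then show ?thesis by (simp add: v_def)
  qed
qed

text \<open>Trace duality: a Gram factorization splits \<open>Q\<close> into rank-one terms, each of
  which sees at most \<open>lam\<close> times its squared length, and these squared lengths add up
  to the trace.\<close>

lemma psd_frob_gram_le:
  assumes psd: "psd n Q"
    and op: "\<And>u. (\<Sum>i<n. (dot d (g i) u)\<^sup>2) \<le> lam * dot d u u" and "0 \<le> lam"
  shows "(\<Sum>i<n. \<Sum>j<n. Q i j * dot d (g i) (g j)) \<le> lam * (\<Sum>i<n. Q i i)"
proof -
  obtain V where V: "\<And>i j. i < n \<Longrightarrow> j < n \<Longrightarrow> Q i j = (\<Sum>p<n. V p i * V p j)"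
    using psd_gram[OF psd] by blast
  have "(\<Sum>i<n. \<Sum>j<n. Q i j * dot d (g i) (g j))
      = (\<Sum>i<n. \<Sum>j<n. \<Sum>p<n. V p i * V p j * dot d (g i) (g j))"
    by (intro sum.cong refl) (simp add: V sum_distrib_right)
  also have "\<dots> = (\<Sum>p<n. \<Sum>i<n. \<Sum>j<n. V p i * V p j * dot d (g i) (g j))"
    by (rule sum_swap3)
  also have "\<dots> = (\<Sum>p<n. dot d (\<lambda>l. \<Sum>i<n. V p i * g i l) (\<lambda>l. \<Sum>i<n. V p i * g i l))"
    by (simp add: dot_sum_left dot_scale_left dot_sum_right dot_scale_right sum_distrib_left mult_ac)
  also have "\<dots> \<le> (\<Sum>p<n. lam * (\<Sum>i<n. (V p i)\<^sup>2))"
    by (intro sum_mono operator_norm_transpose op assms)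
  also have "\<dots> = lam * (\<Sum>i<n. \<Sum>p<n. (V p i)\<^sup>2)"
    by (subst sum.swap) (simp add: sum_distrib_left)
  also have "(\<Sum>i<n. \<Sum>p<n. (V p i)\<^sup>2) = (\<Sum>i<n. Q i i)"
    by (intro sum.cong refl) (simp add: V power2_eq_square)
  finally show ?thesis .
qed

section \<open>Error of the semidefinite program\<close>

locale balanced_clustering =
  fixes n k m :: nat and \<sigma> :: "nat \<Rightarrow> nat"
  assumes n_eq: "n = m * k" and m_pos: "0 < m" and k_pos: "0 < k"
    and label: "\<And>i. i < n \<Longrightarrow> \<sigma> i < k"
    and card_cluster: "\<And>a. a < k \<Longrightarrow> card {i. i < n \<and> \<sigma> i = a} = m"
begin

definition cluster :: "nat \<Rightarrow> nat set" where
  "cluster a = {i. i < n \<and> \<sigma> i = a}"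

definition Ystar :: "nat \<Rightarrow> nat \<Rightarrow> real" where
  "Ystar i j = (if \<sigma> i = \<sigma> j then 1 else 0)"

text \<open>The orthogonal projection onto the span of the cluster indicators, that is, averaging
  over clusters.\<close>

definition proj :: "nat \<Rightarrow> nat \<Rightarrow> real" where
  "proj i j = Ystar i j / m"

definition sdp_err :: "(nat \<Rightarrow> nat \<Rightarrow> real) \<Rightarrow> real" where
  "sdp_err Y = (\<Sum>i<n. \<Sum>j<n. \<bar>Y i j - Ystar i j\<bar>)"

lemma finite_cluster [simp]: "finite (cluster a)"
  by (simp add: cluster_def)

lemma sdp_err_nonneg: "0 \<le> sdp_err Y"
  by (simp add: sdp_err_def sum_nonneg)

lemma sum_Ystar_mult: "(\<Sum>j<n. Ystar i j * f j) = sum f (cluster (\<sigma> i))"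
proof -
  have "(\<Sum>j<n. Ystar i j * f j) = (\<Sum>j\<in>{..<n}. if \<sigma> j = \<sigma> i then f j else 0)"
    by (intro sum.cong refl) (auto simp: Ystar_def)
  also have "\<dots> = sum f ({..<n} \<inter> {j. \<sigma> j = \<sigma> i})"
    by (simp add: sum.inter_restrict)
  also have "{..<n} \<inter> {j. \<sigma> j = \<sigma> i} = cluster (\<sigma> i)"
    by (auto simp: cluster_def)
  finally show ?thesis .
qed

lemma sum_Ystar: "i < n \<Longrightarrow> (\<Sum>j<n. Ystar i j) = m"
  using sum_Ystar_mult[of i "\<lambda>_. 1"] card_cluster[OF label, of i] by (simp add: cluster_def)

lemma Ystar_sym: "Ystar i j = Ystar j i"
  by (simp add: Ystar_def)

lemma proj_sym: "proj i j = proj j i"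
  by (simp add: proj_def Ystar_sym)

lemma proj_nonneg: "0 \<le> proj i j"
  by (simp add: proj_def Ystar_def)

lemma sum_proj: "i < n \<Longrightarrow> (\<Sum>j<n. proj i j) = 1"
  using m_pos by (simp add: proj_def sum_divide_distrib[symmetric] sum_Ystar)

lemma proj_idem: "i < n \<Longrightarrow> (\<Sum>b<n. proj i b * proj j b) = proj i j"
proof -
  assume i: "i < n"
  have "(\<Sum>b<n. proj i b * proj j b) = (\<Sum>b<n. proj i b * proj i j)"
    by (intro sum.cong refl) (auto simp: proj_def Ystar_def)
  then show ?thesis
    using i by (simp add: sum_distrib_right[symmetric] sum_proj)
qed

lemma n_div_k: "n div k = m" "real n / real k = m"
  using n_eq k_pos by simp_all

text \<open>Feasibility makes the truth a competitor of the minimizer. Its quadratic form is the sum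
  over the clusters of the squared cluster sums of \<open>x\<close>.\<close>

lemma Ystar_feasible: "sdp_feasible n k Ystar"
  unfolding sdp_feasible_def psd_def
proof (intro conjI allI impI)
  fix x :: "nat \<Rightarrow> real"
  have "(\<Sum>i<n. \<Sum>j<n. x i * Ystar i j * x j)
      = (\<Sum>i<n. \<Sum>j<n. \<Sum>a<k. (if \<sigma> i = a then x i else 0) * (if \<sigma> j = a then x j else 0))"
  proof (intro sum.cong refl)
    fix i j assume ij: "i \<in> {..<n}" "j \<in> {..<n}"
    have "(\<Sum>a<k. (if \<sigma> i = a then x i else 0) * (if \<sigma> j = a then x j else 0))
        = (\<Sum>a<k. if \<sigma> i = a then (if \<sigma> j = \<sigma> i then x i * x j else 0) else 0)"
      by (intro sum.cong refl) auto
    then show "x i * Ystar i j * x j = (\<Sum>a<k. (if \<sigma> i = a then x i else 0) * (if \<sigma> j = a then x j else 0))"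
      using ij label[of i] by (auto simp: Ystar_def)
  qed
  also have "\<dots> = (\<Sum>a<k. (\<Sum>i<n. if \<sigma> i = a then x i else 0) * (\<Sum>j<n. if \<sigma> j = a then x j else 0))"
    by (subst sum_swap3) (simp only: sum_product)
  also have "\<dots> \<ge> 0"
    by (intro sum_nonneg) auto
  finally show "0 \<le> (\<Sum>i<n. \<Sum>j<n. x i * Ystar i j * x j)" .
qed (auto simp: sum_Ystar n_div_k Ystar_sym, auto simp: Ystar_def)

lemma feasible_le_1:
  assumes "sdp_feasible n k Y" "i < n" "j < n"
  shows "Y i j \<le> 1"
proof (cases "i = j")
  case False
  then show ?thesis
    using psd_quadratic_form_two[of n Y i j 1 "-1"] assms by (auto simp: sdp_feasible_def)
qed (use assms in \<open>auto simp: sdp_feasible_def\<close>)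

text \<open>Both matrices have row sums \<open>m\<close>, so the mass that \<open>Y\<close> puts
  outside the blocks equals the mass it loses inside them. The outside form matches the center
  separation, the inside form the trace of \<open>compress Y\<close>.\<close>

lemma sdp_err_split:
  assumes Y: "sdp_feasible n k Y"
  shows "sdp_err Y = 2 * (\<Sum>i<n. \<Sum>j<n. (1 - Ystar i j) * Y i j)"
    and "sdp_err Y = 2 * (\<Sum>i<n. \<Sum>j<n. Ystar i j * (1 - Y i j))"
proof -
  have abs: "\<bar>Y i j - Ystar i j\<bar> = (1 - Ystar i j) * Y i j + Ystar i j * (1 - Y i j)" if "i < n" "j < n" for i j
    using that feasible_le_1[OF Y that] Y by (auto simp: Ystar_def sdp_feasible_def)
  have "(\<Sum>j<n. Y i j) = (\<Sum>j<n. Ystar i j)" if "i < n" for i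
    using that Y by (simp add: sdp_feasible_def sum_Ystar n_div_k)
  then have "(\<Sum>i<n. \<Sum>j<n. (1 - Ystar i j) * Y i j) - (\<Sum>i<n. \<Sum>j<n. Ystar i j * (1 - Y i j)) = 0"
    by (simp add: sum_subtractf[symmetric] algebra_simps) (simp add: sum_subtractf)
  moreover have "sdp_err Y = (\<Sum>i<n. \<Sum>j<n. (1 - Ystar i j) * Y i j) + (\<Sum>i<n. \<Sum>j<n. Ystar i j * (1 - Y i j))"
    unfolding sdp_err_def sum.distrib[symmetric] by (intro sum.cong refl) (simp add: abs)
  ultimately show "sdp_err Y = 2 * (\<Sum>i<n. \<Sum>j<n. (1 - Ystar i j) * Y i j)"
    and "sdp_err Y = 2 * (\<Sum>i<n. \<Sum>j<n. Ystar i j * (1 - Y i j))" by linarith+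
qed

section \<open>Compression to the orthogonal complement of the cluster indicators\<close>

definition coproj :: "nat \<Rightarrow> nat \<Rightarrow> real" where
  "coproj i j = (if i = j then 1 else 0) - proj i j"

text \<open>The product \<open>(1 - p) Y (1 - p)\<close>, with the symmetric right factor transposed
  so that it has the form of \<open>psd_congruence\<close>.\<close>

definition compress :: "(nat \<Rightarrow> nat \<Rightarrow> real) \<Rightarrow> nat \<Rightarrow> nat \<Rightarrow> real" where
  "compress Y i j = (\<Sum>a<n. \<Sum>b<n. coproj i a * Y a b * coproj j b)"

lemma coproj_sym: "coproj i j = coproj j i"
  by (simp add: coproj_def proj_sym)

lemma sum_coproj_mult: "i < n \<Longrightarrow> (\<Sum>a<n. coproj i a * f a) = f i - (\<Sum>a<n. proj i a * f a)"
proof -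
  assume "i < n"
  have "(\<Sum>a<n. coproj i a * f a) = (\<Sum>a<n. (if i = a then f a else 0) - proj i a * f a)"
    by (intro sum.cong refl) (simp add: coproj_def algebra_simps)
  then show ?thesis using \<open>i < n\<close> by (simp add: sum_subtractf)
qed

lemma coproj_kills_Ystar: "j < n \<Longrightarrow> (\<Sum>b<n. coproj j b * Ystar a b) = 0"
proof -
  assume j: "j < n"
  have Y: "Ystar a b = m * proj a b" for a b
    using m_pos by (simp add: proj_def)
  have "(\<Sum>b<n. proj j b * (real m * proj a b)) = real m * (\<Sum>b<n. proj j b * proj a b)"
    by (simp add: sum_distrib_left mult_ac)
  then show ?thesis
    using j by (simp add: sum_coproj_mult Y proj_idem) (simp add: proj_sym)
qed

text \<open>\<open>Ystar\<close> is \<open>m\<close> times the projection, so the compression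
  annihilates it. Thus the compression of \<open>Y - Ystar\<close>, a matrix that need not be
  semidefinite, inherits positive semidefiniteness from \<open>Y\<close>.\<close>

lemma compress_diff_Ystar:
  assumes "j < n"
  shows "compress Y i j = compress (\<lambda>a b. Y a b - Ystar a b) i j"
proof -
  have "(\<Sum>b<n. coproj i a * Ystar a b * coproj j b) = coproj i a * (\<Sum>b<n. coproj j b * Ystar a b)" for a
    by (simp add: sum_distrib_left mult_ac)
  then have "(\<Sum>b<n. coproj i a * Ystar a b * coproj j b) = 0" for a
    by (simp add: coproj_kills_Ystar[OF assms])
  then show ?thesis
    by (simp add: compress_def algebra_simps sum_subtractf)
qed

lemma compress_expand:
  assumes "i < n" "j < n"
  shows "compress B i j = B i j - (\<Sum>a<n. proj i a * B a j) - (\<Sum>b<n. B i b * proj j b)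
    + (\<Sum>a<n. \<Sum>b<n. proj i a * B a b * proj j b)"
proof -
  have "compress B i j = (\<Sum>a<n. coproj i a * (\<Sum>b<n. coproj j b * B a b))"
    by (simp add: compress_def sum_distrib_left mult_ac)
  also have "\<dots> = (\<Sum>a<n. coproj i a * (B a j - (\<Sum>b<n. proj j b * B a b)))"
    using assms by (simp add: sum_coproj_mult)
  also have "\<dots> = (B i j - (\<Sum>b<n. proj j b * B i b)) - (\<Sum>a<n. proj i a * (B a j - (\<Sum>b<n. proj j b * B a b)))"
    using assms by (simp add: sum_coproj_mult)
  finally show ?thesis
    by (simp add: right_diff_distrib sum_subtractf sum_distrib_left mult_ac)
qed

text \<open>Cyclicity and idempotence reduce the trace to that of \<open>(1 - p) Y\<close>; with
  unit diagonal this is the mass lost inside the blocks divided by \<open>m\<close>.\<close>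

lemma trace_compress:
  assumes Y: "sdp_feasible n k Y"
  shows "(\<Sum>i<n. compress Y i i) = sdp_err Y / (2 * m)"
proof -
  have idem: "(\<Sum>i<n. coproj i a * coproj i b) = coproj a b" if "a < n" "b < n" for a b
  proof -
    have "(\<Sum>i<n. coproj i a * coproj i b) = (\<Sum>i<n. coproj a i * coproj b i)"
      by (simp add: coproj_sym)
    also have "\<dots> = coproj b a - (\<Sum>i<n. proj a i * coproj b i)"
      using that by (simp add: sum_coproj_mult)
    also have "(\<Sum>i<n. proj a i * coproj b i) = proj a b - (\<Sum>i<n. proj b i * proj a i)"
      using that sum_coproj_mult[of b "proj a"] by (simp add: mult.commute)
    also have "\<dots> = 0"
      using proj_idem[OF that(2), of a] proj_sym[of a b] by simp
    finally show ?thesis by (simp add: coproj_sym)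
  qed
  have "(\<Sum>i<n. compress Y i i) = (\<Sum>a<n. \<Sum>b<n. \<Sum>i<n. coproj i a * Y a b * coproj i b)"
    unfolding compress_def by (rule sum_swap3[symmetric])
  also have "\<dots> = (\<Sum>a<n. \<Sum>b<n. Y a b * (\<Sum>i<n. coproj i a * coproj i b))"
    by (simp add: sum_distrib_left mult_ac)
  also have "\<dots> = (\<Sum>a<n. \<Sum>b<n. coproj a b * Y a b)"
    by (intro sum.cong refl) (simp add: idem)
  also have "\<dots> = (\<Sum>a<n. (Y a a - (\<Sum>b<n. proj a b * Y a b)))"
    by (intro sum.cong refl sum_coproj_mult) simp
  also have "\<dots> = (\<Sum>a<n. \<Sum>b<n. proj a b * (1 - Y a b))"
    using Y by (intro sum.cong refl) (simp add: sdp_feasible_def right_diff_distrib sum_subtractf sum_proj)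
  also have "\<dots> = (\<Sum>a<n. \<Sum>b<n. Ystar a b * (1 - Y a b)) / m"
    by (simp add: proj_def sum_divide_distrib)
  also have "\<dots> = sdp_err Y / (2 * m)"
    by (simp add: sdp_err_split(2)[OF Y])
  finally show ?thesis .
qed

lemma weighted_sum_le_sdp_err:
  assumes "\<And>i j. i < n \<Longrightarrow> j < n \<Longrightarrow> \<bar>F i j\<bar> \<le> c"
  shows "\<bar>\<Sum>i<n. \<Sum>j<n. (Y i j - Ystar i j) * F i j\<bar> \<le> sdp_err Y * c"
proof -
  have "\<bar>\<Sum>i<n. \<Sum>j<n. (Y i j - Ystar i j) * F i j\<bar> \<le> (\<Sum>i<n. \<Sum>j<n. \<bar>(Y i j - Ystar i j) * F i j\<bar>)"
    by (rule order.trans[OF sum_abs sum_mono]) (rule sum_abs)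
  also have "\<dots> \<le> (\<Sum>i<n. \<Sum>j<n. \<bar>Y i j - Ystar i j\<bar> * c)"
    using assms by (intro sum_mono) (auto simp: abs_mult intro!: mult_left_mono)
  finally show ?thesis
    by (simp add: sdp_err_def sum_distrib_right)
qed

text \<open>With \<open>p\<close> the projection onto the cluster indicators and \<open>B = Y - Ystar\<close>, split
  \<open>B = (1 - p) B (1 - p) + p B + B p - p B p\<close>. The first summand equals \<open>(1 - p) Y (1 - p)\<close>, which is
  positive semidefinite with trace proportional to \<open>sdp_err Y\<close>, and the others only see
  cluster averages of the noise Gram matrix.\<close>

lemma noise_gram_le:
  assumes Y: "sdp_feasible n k Y"
    and op: "\<And>u. (\<Sum>i<n. (dot d (g i) u)\<^sup>2) \<le> lam * dot d u u" and lam: "0 \<le> lam"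
    and cross: "\<And>j a. j < n \<Longrightarrow> a < k \<Longrightarrow> \<bar>\<Sum>i\<in>cluster a - {j}. dot d (g i) (g j)\<bar> \<le> t"
  shows "(\<Sum>i<n. \<Sum>j<n. (Y i j - Ystar i j) * dot d (g i) (g j))
    \<le> lam * sdp_err Y / (2 * m) + 3 * t * sdp_err Y / m"
proof -
  \<comment> \<open>The diagonal is removed so that the cluster averages of column \<open>j\<close>
    leave out \<open>g j\<close> itself and match \<open>cross\<close>, whose sums will later pair
    independent vectors.\<close>
  define W where "W = (\<lambda>i j. if i = j then 0 else dot d (g i) (g j))"
  define B where "B = (\<lambda>i j. Y i j - Ystar i j)"
  define D where "D = (\<lambda>a j. \<Sum>i<n. proj a i * W i j)"
  have W_sym: "W i j = W j i" for i j by (simp add: W_def dot_commute)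
  have D_le: "\<bar>D a j\<bar> \<le> t / m" if "a < n" "j < n" for a j
  proof -
    have "D a j = (\<Sum>i<n. Ystar a i * W i j) / m"
      by (simp add: D_def proj_def sum_divide_distrib)
    also have "\<dots> = (\<Sum>i\<in>cluster (\<sigma> a). W i j) / m"
      by (simp add: sum_Ystar_mult)
    also have "(\<Sum>i\<in>cluster (\<sigma> a). W i j) = (\<Sum>i\<in>cluster (\<sigma> a) - {j}. W i j)"
      by (intro sum.mono_neutral_right) (auto simp: W_def)
    also have "\<dots> = (\<Sum>i\<in>cluster (\<sigma> a) - {j}. dot d (g i) (g j))"
      by (intro sum.cong refl) (auto simp: W_def)
    finally show ?thesis
      using cross[OF that(2) label[OF that(1)]] m_pos by (simp add: divide_right_mono)
  qed
  let ?Q = "compress Y"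
  have Qpsd: "psd n ?Q"
    unfolding compress_def using Y by (intro psd_congruence) (simp add: sdp_feasible_def)
  have Bdiag: "B i i = 0" if "i < n" for i
    using that Y by (simp add: B_def Ystar_def sdp_feasible_def)
  have B_eq: "B i j = ?Q i j + (\<Sum>a<n. proj i a * B a j) + (\<Sum>b<n. B i b * proj j b)
      - (\<Sum>a<n. \<Sum>b<n. proj i a * B a b * proj j b)" if "i < n" "j < n" for i j
    using compress_diff_Ystar[OF that(2), of Y i] compress_expand[OF that, of B]
    by (simp add: B_def)
  \<comment> \<open>The projection is self-adjoint and is moved from \<open>B\<close> onto the
    noise, where it produces the cluster averages \<open>D\<close>; the same happens in
    \<open>T2\<close> and \<open>T3\<close>.\<close>
  have T1: "(\<Sum>i<n. \<Sum>j<n. (\<Sum>a<n. proj i a * B a j) * W i j) = (\<Sum>a<n. \<Sum>j<n. B a j * D a j)"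
  proof -
    have "(\<Sum>i<n. \<Sum>j<n. (\<Sum>a<n. proj i a * B a j) * W i j) = (\<Sum>i<n. \<Sum>j<n. \<Sum>a<n. B a j * (proj a i * W i j))"
      by (simp add: sum_distrib_left sum_distrib_right mult_ac proj_sym)
    also have "\<dots> = (\<Sum>a<n. \<Sum>i<n. \<Sum>j<n. B a j * (proj a i * W i j))"
      by (rule sum_swap3)
    also have "\<dots> = (\<Sum>a<n. \<Sum>j<n. \<Sum>i<n. B a j * (proj a i * W i j))"
      by (intro sum.cong refl sum.swap)
    finally show ?thesis by (simp add: D_def sum_distrib_left)
  qed
  have T2: "(\<Sum>i<n. \<Sum>j<n. (\<Sum>b<n. B i b * proj j b) * W i j) = (\<Sum>i<n. \<Sum>b<n. B i b * D b i)"
  proof -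
    have "(\<Sum>i<n. \<Sum>j<n. (\<Sum>b<n. B i b * proj j b) * W i j) = (\<Sum>i<n. \<Sum>j<n. \<Sum>b<n. B i b * (proj b j * W j i))"
      by (simp add: sum_distrib_left sum_distrib_right mult_ac proj_sym W_sym)
    also have "\<dots> = (\<Sum>i<n. \<Sum>b<n. \<Sum>j<n. B i b * (proj b j * W j i))"
      by (intro sum.cong refl sum.swap)
    finally show ?thesis by (simp add: D_def sum_distrib_left)
  qed
  have T3: "(\<Sum>i<n. \<Sum>j<n. (\<Sum>a<n. \<Sum>b<n. proj i a * B a b * proj j b) * W i j)
      = (\<Sum>a<n. \<Sum>b<n. B a b * (\<Sum>j<n. proj b j * D a j))"
  proof -
    have "(\<Sum>i<n. \<Sum>j<n. (\<Sum>a<n. \<Sum>b<n. proj i a * B a b * proj j b) * W i j)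
        = (\<Sum>i<n. \<Sum>j<n. \<Sum>a<n. \<Sum>b<n. B a b * (proj b j * (proj a i * W i j)))"
      by (simp add: sum_distrib_left sum_distrib_right mult_ac proj_sym)
    also have "\<dots> = (\<Sum>a<n. \<Sum>b<n. \<Sum>i<n. \<Sum>j<n. B a b * (proj b j * (proj a i * W i j)))"
      by (rule sum_swap4)
    also have "\<dots> = (\<Sum>a<n. \<Sum>b<n. \<Sum>j<n. \<Sum>i<n. B a b * (proj b j * (proj a i * W i j)))"
      by (intro sum.cong refl sum.swap)
    finally show ?thesis by (simp add: D_def sum_distrib_left)
  qed
  have pD_le: "\<bar>\<Sum>j<n. proj b j * D a j\<bar> \<le> t / m" if "a < n" "b < n" for a b
  proof -
    have "\<bar>\<Sum>j<n. proj b j * D a j\<bar> \<le> (\<Sum>j<n. \<bar>proj b j * D a j\<bar>)" by (rule sum_abs)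
    also have "\<dots> \<le> (\<Sum>j<n. proj b j * (t / m))"
    proof (rule sum_mono)
      fix j assume "j \<in> {..<n}"
      then show "\<bar>proj b j * D a j\<bar> \<le> proj b j * (t / m)"
        using mult_left_mono[OF D_le[OF that(1), of j] proj_nonneg[of b j]] by (simp add: abs_mult proj_nonneg)
    qed
    also have "\<dots> = (\<Sum>j<n. proj b j) * (t / m)" by (rule sum_distrib_right[symmetric])
    also have "\<dots> = t / m" by (simp add: sum_proj[OF that(2)])
    finally show ?thesis .
  qed
  have U1: "(\<Sum>a<n. \<Sum>j<n. B a j * D a j) \<le> sdp_err Y * (t / m)"
    using weighted_sum_le_sdp_err[of D "t / m" Y, OF D_le] unfolding B_def by linarith
  have U2: "(\<Sum>i<n. \<Sum>b<n. B i b * D b i) \<le> sdp_err Y * (t / m)"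
    using weighted_sum_le_sdp_err[of "\<lambda>i b. D b i" "t / m" Y, OF D_le] unfolding B_def by linarith
  have U3: "- (\<Sum>a<n. \<Sum>b<n. B a b * (\<Sum>j<n. proj b j * D a j)) \<le> sdp_err Y * (t / m)"
    using weighted_sum_le_sdp_err[of "\<lambda>a b. \<Sum>j<n. proj b j * D a j" "t / m" Y, OF pD_le]
    unfolding B_def by linarith
  have "(\<Sum>i<n. \<Sum>j<n. B i j * dot d (g i) (g j)) = (\<Sum>i<n. \<Sum>j<n. B i j * W i j)"
    by (intro sum.cong refl) (auto simp: W_def Bdiag)
  also have "\<dots> = (\<Sum>i<n. \<Sum>j<n. ?Q i j * W i j + (\<Sum>a<n. proj i a * B a j) * W i j
      + (\<Sum>b<n. B i b * proj j b) * W i j - (\<Sum>a<n. \<Sum>b<n. proj i a * B a b * proj j b) * W i j)"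
    by (intro sum.cong refl) (subst B_eq, auto simp: algebra_simps)
  also have "\<dots> = (\<Sum>i<n. \<Sum>j<n. ?Q i j * W i j) + (\<Sum>a<n. \<Sum>j<n. B a j * D a j)
      + (\<Sum>i<n. \<Sum>b<n. B i b * D b i) - (\<Sum>a<n. \<Sum>b<n. B a b * (\<Sum>j<n. proj b j * D a j))"
    unfolding T1[symmetric] T2[symmetric] T3[symmetric] by (simp only: sum.distrib sum_subtractf)
  also have "\<dots> \<le> (\<Sum>i<n. \<Sum>j<n. ?Q i j * W i j) + sdp_err Y * (t / m) + sdp_err Y * (t / m) + sdp_err Y * (t / m)"
    using U1 U2 U3 by linarith
  \<comment> \<open>Restoring the diagonal can only increase the sum, because a positive
    semidefinite matrix has a nonnegative diagonal; \<open>lam\<close> controls the full Gram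
    matrix.\<close>
  also have "(\<Sum>i<n. \<Sum>j<n. ?Q i j * W i j) \<le> (\<Sum>i<n. \<Sum>j<n. ?Q i j * dot d (g i) (g j))"
    using psd_diag_nonneg[OF Qpsd] dot_self_nonneg by (intro sum_mono) (auto simp: W_def)
  also have "\<dots> \<le> lam * (\<Sum>i<n. ?Q i i)"
    by (rule psd_frob_gram_le[OF Qpsd op lam])
  also have "\<dots> = lam * sdp_err Y / (2 * m)"
    by (simp add: trace_compress[OF Y])
  finally show ?thesis
    by (simp add: B_def algebra_simps)
qed

section \<open>From optimality to an inequality for the error\<close>

lemma sum_symmetric_weight:
  fixes B :: "nat \<Rightarrow> nat \<Rightarrow> real"
  assumes "\<And>i j. i < n \<Longrightarrow> j < n \<Longrightarrow> B i j = B j i"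
  shows "(\<Sum>i<n. \<Sum>j<n. B i j * (f i j + f j i)) = 2 * (\<Sum>i<n. \<Sum>j<n. B i j * f i j)"
proof -
  have "(\<Sum>i<n. \<Sum>j<n. B i j * f j i) = (\<Sum>j<n. \<Sum>i<n. B i j * f j i)"
    by (rule sum.swap)
  also have "\<dots> = (\<Sum>j<n. \<Sum>i<n. B j i * f j i)"
    by (intro sum.cong refl) (simp add: assms)
  finally show ?thesis
    by (simp add: distrib_left sum.distrib)
qed

text \<open>Expanding the squared distances in the comparison of \<open>Y\<close> with
  \<open>Ystar\<close> leaves signal, linear noise and quadratic noise. The excess
  \<open>Z i\<close> does not depend on the center, so it can be summed against the whole row of
  \<open>Y\<close>, of mass \<open>m\<close>, whereas \<open>c\<close> is paid only for the mass
  outside the blocks, which is half of \<open>sdp_err Y\<close>.\<close>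

lemma sdp_error_inequality:
  fixes \<mu> g :: "nat \<Rightarrow> nat \<Rightarrow> real" and d :: nat and Z :: "nat \<Rightarrow> real"
  defines "h \<equiv> (\<lambda>i l. \<mu> (\<sigma> i) l + g i l)"
  assumes min: "sdp_minimizer n k (dist_matrix d h) Y"
    and sep: "\<And>a b. a < k \<Longrightarrow> b < k \<Longrightarrow> a \<noteq> b \<Longrightarrow> D \<le> Delta_ab d \<mu> a b" and D: "0 \<le> D"
    and Z: "\<And>i a. i < n \<Longrightarrow> a < k \<Longrightarrow> dot d (vdiff (\<mu> a) (\<mu> (\<sigma> i))) (g i) \<le> c + Z i"
    and Z0: "\<And>i. i < n \<Longrightarrow> 0 \<le> Z i"
    and op: "\<And>u. (\<Sum>i<n. (dot d (g i) u)\<^sup>2) \<le> lam * dot d u u" and lam: "0 \<le> lam"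
    and cross: "\<And>j a. j < n \<Longrightarrow> a < k \<Longrightarrow> \<bar>\<Sum>i\<in>cluster a - {j}. dot d (g i) (g j)\<bar> \<le> t"
  shows "D\<^sup>2 * sdp_err Y / 2 \<le> 2 * c * sdp_err Y + 4 * m * (\<Sum>i<n. Z i)
    + lam * sdp_err Y / m + 6 * t * sdp_err Y / m"
proof -
  have Y: "sdp_feasible n k Y"
    using min by (simp add: sdp_minimizer_def)
  define B where "B = (\<lambda>i j. Y i j - Ystar i j)"
  define M where "M = (\<lambda>i j. vdiff (\<mu> (\<sigma> j)) (\<mu> (\<sigma> i)))"
  have B_sym: "B i j = B j i" if "i < n" "j < n" for i j
    using Y that by (simp add: B_def Ystar_sym sdp_feasible_def psd_def)
  have B_row: "(\<Sum>j<n. B i j) = 0" if "i < n" for i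
    using Y that by (simp add: B_def sum_subtractf sum_Ystar sdp_feasible_def n_div_k)
  have A_eq: "dist_matrix d h i j = dot d (M i j) (M i j) - 2 * (dot d (M i j) (g i) + dot d (M j i) (g j))
      + (dot d (g i) (g i) - dot d (g i) (g j) + (dot d (g j) (g j) - dot d (g j) (g i)))" for i j
    unfolding dist_matrix_def vnorm_power2 M_def vdiff_def h_def
    by (simp add: dot_def sum.distrib[symmetric] sum_subtractf[symmetric] sum_distrib_left algebra_simps)
  have "(\<Sum>i<n. \<Sum>j<n. B i j * dist_matrix d h i j) \<le> 0"
    using min Ystar_feasible
    by (simp add: B_def sdp_minimizer_def frob_def left_diff_distrib sum_subtractf)
  moreover have "(\<Sum>i<n. \<Sum>j<n. B i j * dist_matrix d h i j)
      = (\<Sum>i<n. \<Sum>j<n. B i j * dot d (M i j) (M i j))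
        - 2 * (\<Sum>i<n. \<Sum>j<n. B i j * (dot d (M i j) (g i) + dot d (M j i) (g j)))
        + (\<Sum>i<n. \<Sum>j<n. B i j * (dot d (g i) (g i) - dot d (g i) (g j) + (dot d (g j) (g j) - dot d (g j) (g i))))"
    unfolding A_eq sum_distrib_left sum_subtractf[symmetric] sum.distrib[symmetric]
    by (intro sum.cong refl) (simp add: algebra_simps)
  moreover have "(\<Sum>i<n. \<Sum>j<n. B i j * (dot d (M i j) (g i) + dot d (M j i) (g j)))
      = 2 * (\<Sum>i<n. \<Sum>j<n. B i j * dot d (M i j) (g i))"
    by (rule sum_symmetric_weight[OF B_sym])
  moreover have "(\<Sum>i<n. \<Sum>j<n. B i j * (dot d (g i) (g i) - dot d (g i) (g j) + (dot d (g j) (g j) - dot d (g j) (g i))))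
      = 2 * (\<Sum>i<n. \<Sum>j<n. B i j * (dot d (g i) (g i) - dot d (g i) (g j)))"
    by (rule sum_symmetric_weight[OF B_sym])
  \<comment> \<open>The rows of \<open>B\<close> sum to zero, which removes the squared norms of the
    noise vectors.\<close>
  moreover have "(\<Sum>i<n. \<Sum>j<n. B i j * (dot d (g i) (g i) - dot d (g i) (g j)))
      = - (\<Sum>i<n. \<Sum>j<n. B i j * dot d (g i) (g j))"
    using B_row by (simp add: right_diff_distrib sum_subtractf sum_distrib_right[symmetric] sum_negf)
  moreover have "(\<Sum>i<n. \<Sum>j<n. B i j * dot d (g i) (g j)) \<le> lam * sdp_err Y / (2 * m) + 3 * t * sdp_err Y / m"
    unfolding B_def by (rule noise_gram_le[OF Y op lam cross])
  moreover have "lam * sdp_err Y / m + 6 * t * sdp_err Y / m = 2 * (lam * sdp_err Y / (2 * m) + 3 * t * sdp_err Y / m)"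
    by (simp add: field_simps)
  ultimately have main: "(\<Sum>i<n. \<Sum>j<n. B i j * dot d (M i j) (M i j))
      \<le> 4 * (\<Sum>i<n. \<Sum>j<n. B i j * dot d (M i j) (g i)) + lam * sdp_err Y / m + 6 * t * sdp_err Y / m"
    by linarith
  have M0: "M i j = (\<lambda>_. 0)" if "Ystar i j \<noteq> 0" for i j
    using that by (auto simp: M_def vdiff_def Ystar_def split: if_splits)
  have Ynn: "0 \<le> Y i j" if "i < n" "j < n" for i j
    using Y that by (simp add: sdp_feasible_def)
  have "D\<^sup>2 * sdp_err Y / 2 = (\<Sum>i<n. \<Sum>j<n. (1 - Ystar i j) * Y i j * D\<^sup>2)"
    by (simp add: sdp_err_split(1)[OF Y] sum_distrib_left sum_distrib_right mult_ac)
  also have "\<dots> \<le> (\<Sum>i<n. \<Sum>j<n. B i j * dot d (M i j) (M i j))"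
  proof (intro sum_mono)
    fix i j assume ij: "i \<in> {..<n}" "j \<in> {..<n}"
    show "(1 - Ystar i j) * Y i j * D\<^sup>2 \<le> B i j * dot d (M i j) (M i j)"
    proof (cases "\<sigma> i = \<sigma> j")
      case True
      then show ?thesis using M0[of i j] by (simp add: Ystar_def dot_def)
    next
      case False
      then have "D \<le> Delta_ab d \<mu> (\<sigma> j) (\<sigma> i)"
        using sep[of "\<sigma> j" "\<sigma> i"] label ij by auto
      then have "D\<^sup>2 \<le> dot d (M i j) (M i j)"
        using D unfolding M_def vnorm_power2[symmetric] Delta_ab_def by (rule power_mono)
      then show ?thesis
        using False Ynn ij by (auto simp: Ystar_def B_def intro!: mult_left_mono)
    qed
  qed
  also note main
  also have "(\<Sum>i<n. \<Sum>j<n. B i j * dot d (M i j) (g i)) \<le> (\<Sum>i<n. \<Sum>j<n. (1 - Ystar i j) * Y i j * c + Y i j * Z i)"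
  proof (intro sum_mono)
    fix i j assume ij: "i \<in> {..<n}" "j \<in> {..<n}"
    show "B i j * dot d (M i j) (g i) \<le> (1 - Ystar i j) * Y i j * c + Y i j * Z i"
    proof (cases "\<sigma> i = \<sigma> j")
      case True
      then show ?thesis using M0[of i j] Ynn[of i j] Z0[of i] ij by (simp add: Ystar_def dot_def)
    next
      case False
      have "dot d (M i j) (g i) \<le> c + Z i"
        using Z[of i "\<sigma> j"] ij label by (simp add: M_def)
      then have "Y i j * dot d (M i j) (g i) \<le> Y i j * (c + Z i)"
        using Ynn[of i j] ij by (intro mult_left_mono) auto
      then show ?thesis
        using False by (simp add: Ystar_def B_def algebra_simps)
    qed
  qed
  also have "(\<Sum>i<n. \<Sum>j<n. (1 - Ystar i j) * Y i j * c + Y i j * Z i) = c * sdp_err Y / 2 + m * (\<Sum>i<n. Z i)"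
  proof -
    have "(\<Sum>i<n. \<Sum>j<n. Y i j * Z i) = (\<Sum>i<n. m * Z i)"
      using Y by (intro sum.cong refl) (simp add: sum_distrib_right[symmetric] sdp_feasible_def n_div_k)
    then show ?thesis
      by (simp add: sum.distrib sdp_err_split(1)[OF Y] sum_distrib_left sum_distrib_right mult_ac)
  qed
  finally show ?thesis
    by (simp add: algebra_simps)
qed

section \<open>Rounding\<close>

definition row_err :: "(nat \<Rightarrow> nat \<Rightarrow> real) \<Rightarrow> nat \<Rightarrow> real" where
  "row_err Y i = (\<Sum>j<n. \<bar>Y i j - Ystar i j\<bar>)"

text \<open>The threshold is half the radius \<open>n / (4 * k)\<close> of the rounding balls: two
  rows of one cluster within \<open>m / 8\<close> of the truth are within \<open>m / 4\<close> of
  each other.\<close>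

definition bad :: "(nat \<Rightarrow> nat \<Rightarrow> real) \<Rightarrow> nat set" where
  "bad Y = {i. i < n \<and> row_err Y i > m / 8}"

lemma finite_bad [simp]: "finite (bad Y)"
  by (simp add: bad_def)

text \<open>Markov's inequality over the rows.\<close>

lemma card_bad_le: "real (card (bad Y)) \<le> 8 * sdp_err Y / m"
proof -
  have "card (bad Y) * (m / 8) = (\<Sum>i\<in>bad Y. m / 8)" by simp
  also have "\<dots> \<le> (\<Sum>i\<in>bad Y. row_err Y i)"
    by (intro sum_mono) (simp add: bad_def)
  also have "\<dots> \<le> (\<Sum>i<n. row_err Y i)"
    by (intro sum_mono2) (auto simp: bad_def row_err_def sum_nonneg)
  also have "\<dots> = sdp_err Y" by (simp add: sdp_err_def row_err_def)
  finally show ?thesis using m_pos by (simp add: field_simps)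
qed

lemma row_l1_triangle: "row_l1 n Y u w \<le> row_l1 n Y v u + row_l1 n Y v w"
  unfolding row_l1_def sum.distrib[symmetric] by (intro sum_mono) linarith

lemma row_l1_same_cluster:
  assumes "u < n" "w < n" "\<sigma> u = \<sigma> w" "u \<notin> bad Y" "w \<notin> bad Y"
  shows "row_l1 n Y u w \<le> m / 4"
proof -
  have "row_l1 n Y u w \<le> row_err Y u + row_err Y w"
    unfolding row_l1_def row_err_def sum.distrib[symmetric]
  proof (intro sum_mono)
    fix j
    have "Ystar u j = Ystar w j" using assms by (simp add: Ystar_def)
    then show "\<bar>Y u j - Y w j\<bar> \<le> \<bar>Y u j - Ystar u j\<bar> + \<bar>Y w j - Ystar w j\<bar>"
      by linarith
  qed
  also have "\<dots> \<le> m / 8 + m / 8"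
    using assms by (intro add_mono) (auto simp: bad_def)
  finally show ?thesis by simp
qed

text \<open>The true rows are at distance \<open>2 * m\<close> and the two errors cost at most
  \<open>m / 4\<close>. The stated bound \<open>m / 2\<close> is twice the radius of a rounding
  ball.\<close>

lemma row_l1_diff_cluster:
  assumes "u < n" "w < n" "\<sigma> u \<noteq> \<sigma> w" "u \<notin> bad Y" "w \<notin> bad Y"
  shows "m / 2 < row_l1 n Y u w"
proof -
  have "2 * m = (\<Sum>j<n. Ystar u j) + (\<Sum>j<n. Ystar w j)"
    using assms by (simp add: sum_Ystar)
  also have "\<dots> \<le> row_err Y u + row_err Y w + row_l1 n Y u w"
    unfolding row_l1_def row_err_def sum.distrib[symmetric]
  proof (intro sum_mono)
    fix j
    have "Ystar u j + Ystar w j = \<bar>Ystar u j - Ystar w j\<bar>"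
      using assms by (auto simp: Ystar_def)
    then show "Ystar u j + Ystar w j \<le> \<bar>Y u j - Ystar u j\<bar> + \<bar>Y w j - Ystar w j\<bar> + \<bar>Y u j - Y w j\<bar>"
      by linarith
  qed
  also have "\<dots> \<le> m / 8 + m / 8 + row_l1 n Y u w"
    using assms by (intro add_mono order.refl) (auto simp: bad_def)
  finally show ?thesis using m_pos by simp
qed

text \<open>The center \<open>u\<close> of the ball may itself be bad, so the two members are
  compared with each other, at distance at most twice the radius.\<close>

lemma rball_one_cluster:
  assumes "V \<subseteq> {..<n}" "w \<in> rball n k Y V u" "w' \<in> rball n k Y V u" "w \<notin> bad Y" "w' \<notin> bad Y"
  shows "\<sigma> w = \<sigma> w'"
proof (rule ccontr)
  assume "\<sigma> w \<noteq> \<sigma> w'"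
  then have "m / 2 < row_l1 n Y w w'"
    using assms by (intro row_l1_diff_cluster) (auto simp: rball_def)
  moreover have "real n / (4 * real k) = m / 4"
    using n_eq k_pos by simp
  ultimately show False
    using assms row_l1_triangle[of Y w w' u] by (auto simp: rball_def)
qed

lemma card_cluster_minus_bad_ge: "a < k \<Longrightarrow> m - card (bad Y) \<le> card (cluster a - bad Y)"
  using diff_card_le_card_Diff[of "bad Y" "cluster a"] card_cluster[of a] by (simp add: cluster_def)

text \<open>The first greedy ball that meets a good node of a cluster is formed while all good nodes of that
  cluster are still available, so it is large; hence at least \<open>k\<close> of the balls are large, and the
  selected ones must be.\<close>

lemma rounding_error:
  assumes "rounding_output n k Y \<sigma>h" and a: "a < k"
  shows "\<exists>b<k. real (card ({i. i < n \<and> \<sigma>h i = a} - cluster b)) \<le> 16 * sdp_err Y / m"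
proof -
  define \<beta> where "\<beta> = card (bad Y)"
  let ?C = "{i. i < n \<and> \<sigma>h i = a}"
  obtain Bs t where st1: "rounding_step1 n k Y Bs"
    and inj: "inj_on t {..<k}" and tl: "t ` {..<k} \<subseteq> {..<length Bs}"
    and unsel': "\<forall>s<length Bs. s \<notin> t ` {..<k} \<longrightarrow> (\<forall>a<k. card (Bs ! s) \<le> card (Bs ! t a))"
    and sub': "\<forall>a<k. Bs ! t a \<subseteq> {i. \<sigma>h i = a}"
    and cardC: "\<forall>a<k. card {i. i < n \<and> \<sigma>h i = a} = n div k"
    using assms(1) unfolding rounding_output_def by (elim exE conjE) (rule that)
  have unsel: "card (Bs ! s) \<le> card (Bs ! t b)" if "s < length Bs" "s \<notin> t ` {..<k}" "b < k" for s b
    using unsel' that by simp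
  have sub: "Bs ! t b \<subseteq> {i. \<sigma>h i = b}" if "b < k" for b
    using sub' that by simp
  have cC: "card ?C = m" using cardC a n_div_k by simp
  have "\<exists>b<k. card (?C - cluster b) \<le> 2 * \<beta>"
  \<comment> \<open>If at least half of a cluster's size may be bad, the bound is no smaller than
    the estimated cluster and any \<open>b\<close> will do.\<close>
  proof (cases "m \<le> 2 * \<beta>")
    case True
    then have "card (?C - cluster 0) \<le> 2 * \<beta>"
      using card_mono[of ?C "?C - cluster 0"] cC by auto
    then show ?thesis using k_pos by blast
  next
    case False
    define V where "V = (\<lambda>s. {..<n} - \<Union>(set (take s Bs)))"
    have cover: "\<Union>(set Bs) = {..<n}"
      using st1 by (simp add: rounding_step1_def)
    have step: "\<exists>u\<in>V s. (\<forall>w\<in>V s. card (rball n k Y (V s) w) \<le> card (rball n k Y (V s) u)) \<and>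
           (if card (rball n k Y (V s) u) \<le> m then Bs ! s = rball n k Y (V s) u
            else Bs ! s \<subseteq> rball n k Y (V s) u \<and> card (Bs ! s) = m)" if "s < length Bs" for s
    proof -
      have "\<forall>t<length Bs. V t \<noteq> {} \<and> (\<exists>u\<in>V t. (\<forall>w\<in>V t. card (rball n k Y (V t) w) \<le> card (rball n k Y (V t) u)) \<and>
           (if card (rball n k Y (V t) u) \<le> m then Bs ! t = rball n k Y (V t) u
            else Bs ! t \<subseteq> rball n k Y (V t) u \<and> card (Bs ! t) = m))"
        using st1 unfolding rounding_step1_def Let_def V_def n_div_k by (rule conjunct2)
      then show ?thesis
        using that by simp
    qed
    have Vn: "V s \<subseteq> {..<n}" for s by (auto simp: V_def)
    have in_ball: "\<exists>u. Bs ! s \<subseteq> rball n k Y (V s) u" if "s < length Bs" for s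
      using step[OF that] by (metis order.refl)
    have one: "\<sigma> w = \<sigma> w'" if "s < length Bs" "w \<in> Bs ! s - bad Y" "w' \<in> Bs ! s - bad Y" for s w w'
      using in_ball[OF that(1)] rball_one_cluster[OF Vn[of s]] that by blast
    have Bn: "Bs ! s \<subseteq> {..<n}" if "s < length Bs" for s
      using cover that by (metis Union_upper nth_mem)
    define f where "f = (\<lambda>b. LEAST s. s < length Bs \<and> Bs ! s \<inter> (cluster b - bad Y) \<noteq> {})"
    have f: "f b < length Bs" "Bs ! f b \<inter> (cluster b - bad Y) \<noteq> {}"
      "\<And>s. s < f b \<Longrightarrow> Bs ! s \<inter> (cluster b - bad Y) = {}" if b: "b < k" for b
    proof -
      have "card (cluster b - bad Y) > 0"
        using card_cluster_minus_bad_ge[OF b, of Y] False by (simp add: \<beta>_def)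
      then obtain w where w: "w \<in> cluster b - bad Y"
        by (metis card.empty ex_in_conv less_irrefl)
      then have "w \<in> \<Union>(set Bs)" unfolding cover by (simp add: cluster_def)
      then obtain s where "s < length Bs \<and> Bs ! s \<inter> (cluster b - bad Y) \<noteq> {}"
        using w by (metis Union_iff disjoint_iff in_set_conv_nth)
      then have *: "f b < length Bs \<and> Bs ! f b \<inter> (cluster b - bad Y) \<noteq> {}"
        unfolding f_def by (rule LeastI)
      then show "f b < length Bs" "Bs ! f b \<inter> (cluster b - bad Y) \<noteq> {}" by auto
      show "Bs ! s \<inter> (cluster b - bad Y) = {}" if "s < f b" for s
      proof -
        have "\<not> (s < length Bs \<and> Bs ! s \<inter> (cluster b - bad Y) \<noteq> {})"
          using that unfolding f_def by (rule not_less_Least)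
        then show ?thesis using that * by auto
      qed
    qed
    have large: "m - \<beta> \<le> card (Bs ! f b)" if b: "b < k" for b
    proof -
      have GV: "cluster b - bad Y \<subseteq> V (f b)"
      proof
        fix w assume w: "w \<in> cluster b - bad Y"
        have "w \<notin> \<Union>(set (take (f b) Bs))"
        proof
          assume "w \<in> \<Union>(set (take (f b) Bs))"
          then obtain s where "s < f b" "s < length Bs" "w \<in> Bs ! s"
            by (auto simp: in_set_conv_nth)
          then show False using f(3)[OF b] w by blast
        qed
        then show "w \<in> V (f b)" using w by (auto simp: V_def cluster_def)
      qed
      obtain w where w: "w \<in> cluster b - bad Y" using f(2)[OF b] by blast
      have "cluster b - bad Y \<subseteq> rball n k Y (V (f b)) w"
      proof
        fix w' assume w': "w' \<in> cluster b - bad Y"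
        then have "row_l1 n Y w w' \<le> m / 4"
          using w by (intro row_l1_same_cluster) (auto simp: cluster_def)
        moreover have "real n / (4 * real k) = m / 4"
          using n_eq k_pos by simp
        ultimately show "w' \<in> rball n k Y (V (f b)) w"
          using GV w' by (auto simp: rball_def)
      qed
      moreover have "finite (rball n k Y (V (f b)) w)"
        by (simp add: rball_def V_def)
      ultimately have "m - \<beta> \<le> card (rball n k Y (V (f b)) w)"
        using card_cluster_minus_bad_ge[OF b, of Y] card_mono unfolding \<beta>_def by (meson order.trans)
      moreover obtain u where "\<forall>w\<in>V (f b). card (rball n k Y (V (f b)) w) \<le> card (rball n k Y (V (f b)) u)"
          "if card (rball n k Y (V (f b)) u) \<le> m then Bs ! f b = rball n k Y (V (f b)) u
            else Bs ! f b \<subseteq> rball n k Y (V (f b)) u \<and> card (Bs ! f b) = m"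
        using step[OF f(1)[OF b]] by blast
      moreover have "w \<in> V (f b)" using w GV by blast
      ultimately show ?thesis
        by (cases "card (rball n k Y (V (f b)) u) \<le> m") (force, simp)
    qed
    \<comment> \<open>A ball contains good nodes of one cluster only, so different clusters have
      different first balls.\<close>
    have f_inj: "inj_on f {..<k}"
    proof (rule inj_onI)
      fix b b' assume b: "b \<in> {..<k}" "b' \<in> {..<k}" and eq: "f b = f b'"
      obtain w w' where "w \<in> Bs ! f b \<inter> (cluster b - bad Y)" "w' \<in> Bs ! f b' \<inter> (cluster b' - bad Y)"
        using f(2)[of b] f(2)[of b'] b by blast
      then show "b = b'"
        using one[of "f b" w w'] f(1)[of b] b eq by (auto simp: cluster_def)
    qed
    have big: "m - \<beta> \<le> card (Bs ! t a)"
    proof (rule ccontr)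
      assume small: "\<not> m - \<beta> \<le> card (Bs ! t a)"
      \<comment> \<open>Every large ball beats \<open>Bs ! t a\<close>, so it is selected and
        differs from it: \<open>k\<close> different balls would have to fit into
        \<open>k - 1\<close> places.\<close>
      have "f ` {..<k} \<subseteq> t ` {..<k} - {t a}"
      proof
        fix s assume "s \<in> f ` {..<k}"
        then obtain b where b: "b < k" "s = f b" by auto
        then show "s \<in> t ` {..<k} - {t a}"
          using large[of b] small unsel[of s a] a f(1)[of b] by force
      qed
      then have "card (f ` {..<k}) \<le> card (t ` {..<k} - {t a})"
        by (intro card_mono) auto
      also have "\<dots> = k - 1"
        using a inj by (simp add: card_image)
      also have "card (f ` {..<k}) = k"
        using f_inj by (simp add: card_image)
      finally show False using k_pos by simp
    qed
    have ta: "t a < length Bs" using tl a by auto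
    have finB: "finite (Bs ! t a)" using Bn[OF ta] finite_subset by blast
    \<comment> \<open>One \<open>\<beta>\<close> may be missing from the ball and another is lost to
      its bad members.\<close>
    have cB: "m - 2 * \<beta> \<le> card (Bs ! t a - bad Y)"
      using diff_card_le_card_Diff[of "bad Y" "Bs ! t a"] big by (simp add: \<beta>_def)
    then obtain w where w: "w \<in> Bs ! t a - bad Y"
      using False by (metis card.empty ex_in_conv less_irrefl not_le zero_less_diff order.strict_trans2)
    have wk: "\<sigma> w < k" using w Bn[OF ta] label by auto
    have "?C - cluster (\<sigma> w) \<subseteq> ?C - (Bs ! t a - bad Y)"
      using one[OF ta _ w] Bn[OF ta] by (auto simp: cluster_def)
    then have "card (?C - cluster (\<sigma> w)) \<le> card (?C - (Bs ! t a - bad Y))"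
      by (intro card_mono) auto
    also have "\<dots> = card ?C - card (Bs ! t a - bad Y)"
      using sub[OF a] Bn[OF ta] finB by (intro card_Diff_subset) auto
    also have "\<dots> \<le> 2 * \<beta>" using cB cC by simp
    finally show ?thesis using wk by blast
  qed
  then obtain b where b: "b < k" "card (?C - cluster b) \<le> 2 * \<beta>" by blast
  then have "real (card (?C - cluster b)) \<le> 2 * real \<beta>"
    by linarith
  also have "\<dots> \<le> 16 * sdp_err Y / m"
    using card_bad_le[of Y] by (simp add: \<beta>_def)
  finally show ?thesis using b by blast
qed

text \<open>Replacing the estimated cluster by the true one changes the noise sum by two sets of
  equal size, since both clusters have \<open>m\<close> elements; hence the factor 2. Noise over the
  whole true cluster stays aggregated in \<open>N\<close>, and only the misplaced points are charged
  with individual norms \<open>G\<close>.\<close>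

lemma center_est_error:
  fixes \<mu> g :: "nat \<Rightarrow> nat \<Rightarrow> real"
  defines "h \<equiv> (\<lambda>i l. \<mu> (\<sigma> i) l + g i l)"
  assumes "b < k" and cC: "card {i. i < n \<and> \<sigma>h i = a} = m"
    and \<rho>: "real (card ({i. i < n \<and> \<sigma>h i = a} - cluster b)) \<le> \<rho>"
    and diam: "\<And>a b. a < k \<Longrightarrow> b < k \<Longrightarrow> Delta_ab d \<mu> a b \<le> D"
    and gn: "\<And>i. i < n \<Longrightarrow> vnorm d (g i) \<le> G"
    and S: "vnorm d (\<lambda>l. \<Sum>i\<in>cluster b. g i l) \<le> N"
  shows "vnorm d (vdiff (center_est n k h \<sigma>h a) (\<mu> b)) \<le> (\<rho> * D + N + 2 * \<rho> * G) / m"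
proof -
  let ?C = "{i. i < n \<and> \<sigma>h i = a}"
  let ?B = "cluster b"
  have km: "real k / real n = 1 / m"
    using n_eq k_pos by simp
  have cB: "card ?B = m" using card_cluster[OF \<open>b < k\<close>] by (simp add: cluster_def)
  have card_eq: "card (?B - ?C) = card (?C - ?B)"
  proof -
    have "card (?B \<inter> ?C) + card (?B - ?C) = m"
      using cB card_Int_Diff[of ?B ?C] by simp
    moreover have "card (?B \<inter> ?C) + card (?C - ?B) = m"
      using cC card_Int_Diff[of ?C ?B] by (simp add: Int_commute)
    ultimately show ?thesis by simp
  qed
  have D0: "0 \<le> D" by (rule order.trans[OF _ diam[OF \<open>b < k\<close> \<open>b < k\<close>]]) (simp add: Delta_ab_def)
  have G0: "0 \<le> G"
    by (rule order.trans[OF _ gn[of 0]]) (use m_pos k_pos n_eq in auto)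
  define x where "x = (\<lambda>l. \<Sum>i\<in>?C - ?B. \<mu> (\<sigma> i) l - \<mu> b l)"
  define y where "y = (\<lambda>l. \<Sum>i\<in>?B. g i l)"
  define z where "z = (\<lambda>l. \<Sum>i\<in>?C - ?B. g i l)"
  define w where "w = (\<lambda>l. \<Sum>i\<in>?B - ?C. g i l)"
  have "vdiff (center_est n k h \<sigma>h a) (\<mu> b) l = 1 / m * (((x l + y l) + z l) - w l)" for l
  proof -
    have "(\<Sum>i\<in>?C. \<mu> (\<sigma> i) l - \<mu> b l) = x l"
      unfolding x_def by (intro sum.mono_neutral_right) (auto simp: cluster_def)
    then have "(\<Sum>i\<in>?C. \<mu> (\<sigma> i) l) = x l + m * \<mu> b l"
      using cC by (simp add: sum_subtractf algebra_simps)
    moreover have "(\<Sum>i\<in>?C. g i l) = (\<Sum>i\<in>?C \<inter> ?B. g i l) + z l"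
      unfolding z_def by (subst sum.Int_Diff[of ?C _ ?B]) auto
    moreover have "y l = (\<Sum>i\<in>?C \<inter> ?B. g i l) + w l"
      unfolding y_def w_def by (subst sum.Int_Diff[of ?B _ ?C]) (auto simp: Int_commute)
    ultimately have "(\<Sum>i\<in>?C. h i l) = (x l + y l + z l - w l) + m * \<mu> b l"
      by (simp add: h_def sum.distrib)
    then show ?thesis
      using m_pos by (simp add: vdiff_def center_est_def km field_simps)
  qed
  then have "vdiff (center_est n k h \<sigma>h a) (\<mu> b) = (\<lambda>l. 1 / m * (((x l + y l) + z l) - w l))"
    by (rule ext)
  then have norm_eq: "vnorm d (vdiff (center_est n k h \<sigma>h a) (\<mu> b)) = 1 / m * vnorm d (\<lambda>l. ((x l + y l) + z l) - w l)"
    by (simp only: vnorm_scale) simp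
  have "vnorm d (\<lambda>l. ((x l + y l) + z l) - w l) \<le> vnorm d x + vnorm d y + vnorm d z + vnorm d w"
    using vnorm_diff_le[of d "\<lambda>l. (x l + y l) + z l" w] vnorm_add_le[of d "\<lambda>l. x l + y l" z]
      vnorm_add_le[of d x y] by linarith
  moreover have "vnorm d x \<le> \<rho> * D"
  proof -
    have "vnorm d x \<le> (\<Sum>i\<in>?C - ?B. vnorm d (\<lambda>l. \<mu> (\<sigma> i) l - \<mu> b l))"
      unfolding x_def by (rule vnorm_sum_le)
    also have "\<dots> \<le> (\<Sum>i\<in>?C - ?B. D)"
      using diam[OF label \<open>b < k\<close>] by (intro sum_mono) (simp add: Delta_ab_def vdiff_def)
    also have "\<dots> = card (?C - ?B) * D" by simp
    also have "\<dots> \<le> \<rho> * D" using \<rho> D0 by (rule mult_right_mono)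
    finally show ?thesis .
  qed
  moreover have "vnorm d z \<le> \<rho> * G"
  proof -
    have "vnorm d z \<le> (\<Sum>i\<in>?C - ?B. vnorm d (g i))"
      unfolding z_def by (rule vnorm_sum_le)
    also have "\<dots> \<le> (\<Sum>i\<in>?C - ?B. G)"
      using gn by (intro sum_mono) simp
    also have "\<dots> = card (?C - ?B) * G" by simp
    also have "\<dots> \<le> \<rho> * G" using \<rho> G0 by (rule mult_right_mono)
    finally show ?thesis .
  qed
  moreover have "vnorm d w \<le> \<rho> * G"
  proof -
    have "vnorm d w \<le> (\<Sum>i\<in>?B - ?C. vnorm d (g i))"
      unfolding w_def by (rule vnorm_sum_le)
    also have "\<dots> \<le> (\<Sum>i\<in>?B - ?C. G)"
      using gn by (intro sum_mono) (simp add: cluster_def)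
    also have "\<dots> = card (?B - ?C) * G" by simp
    also have "\<dots> \<le> \<rho> * G" using \<rho> G0 unfolding card_eq by (rule mult_right_mono)
    finally show ?thesis .
  qed
  ultimately have "vnorm d (\<lambda>l. ((x l + y l) + z l) - w l) \<le> \<rho> * D + N + 2 * \<rho> * G"
    using S unfolding y_def[symmetric] by linarith
  then show ?thesis
    unfolding norm_eq using m_pos by (simp add: divide_right_mono)
qed

end

section \<open>Concentration inequalities\<close>

lemma exp_le_quadratic:
  fixes x :: real
  assumes "x \<le> 1"
  shows "exp x \<le> 1 + x + x\<^sup>2"
proof (cases "0 \<le> x")
  case False
  define y where "y = - x"
  have y: "0 \<le> y" using False by (simp add: y_def)
  \<comment> \<open>The product of \<open>1 - y + y\<^sup>2\<close> with the quadratic Taylor bound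
    for \<open>exp y\<close> is at least 1, which is the claim after division by
    \<open>exp y\<close>.\<close>
  have "1 \<le> 1 + (y\<^sup>2 / 2 + y ^ 3 / 2 + y ^ 4 / 2)"
    using y by simp
  also have "\<dots> = (1 - y + y\<^sup>2) * (1 + y + y\<^sup>2 / 2)"
    by (simp add: field_simps power2_eq_square power3_eq_cube power4_eq_xxxx)
  also have "\<dots> \<le> (1 - y + y\<^sup>2) * exp y"
  proof (rule mult_left_mono[OF exp_lower_Taylor_quadratic[OF y]])
    have "0 \<le> (y - 1/2)\<^sup>2 + 3/4" by simp
    then show "0 \<le> 1 - y + y\<^sup>2" by (simp add: power2_eq_square algebra_simps)
  qed
  finally have "exp (- y) \<le> 1 - y + y\<^sup>2"
    by (simp add: exp_minus field_simps)
  then show ?thesis by (simp add: y_def)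
qed (use assms exp_bound in auto)

text \<open>Made for centered variables: the linear term disappears in expectation and only a moment
  of the square is left.\<close>

lemma exp_le_add_exp_square: "exp x \<le> x + exp (x\<^sup>2)" for x :: real
proof (cases "x \<le> 1")
  case True
  then show ?thesis
    using exp_le_quadratic[OF True] exp_ge_add_one_self[of "x\<^sup>2"] by linarith
next
  case False
  then have "exp x \<le> exp (x\<^sup>2)" by (simp add: power2_eq_square)
  then show ?thesis using False by linarith
qed

text \<open>Convexity between 0 and \<open>y\<close>; it trades a small factor in the exponent for a
  small factor in front.\<close>

lemma exp_mult_le_affine:
  fixes \<theta> y :: real
  assumes "0 \<le> \<theta>" "\<theta> \<le> 1"
  shows "exp (\<theta> * y) \<le> 1 - \<theta> + \<theta> * exp y"
  using convex_onD[OF exp_convex, of \<theta> 0 y] assms by simp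

text \<open>For \<open>0 \<le> c \<le> x\<close> one has
  \<open>(x - c)\<^sup>2 \<le> x\<^sup>2 - c\<^sup>2\<close>, and \<open>u \<le> exp u\<close>. The
  excess over a threshold thus has exponentially small second moment once
  \<open>exp (x\<^sup>2 / L\<^sup>2)\<close> has bounded expectation.\<close>

lemma square_positive_part_le_exp:
  fixes x c L :: real
  assumes "0 \<le> c" "0 < L"
  shows "(max 0 (x - c))\<^sup>2 \<le> L\<^sup>2 * exp (- c\<^sup>2 / L\<^sup>2) * exp (x\<^sup>2 / L\<^sup>2)"
proof (cases "c \<le> x")
  case True
  have "0 \<le> 2 * c * (x - c)" using True assms by simp
  then have "(x - c)\<^sup>2 \<le> x\<^sup>2 - c\<^sup>2"
    by (simp add: power2_eq_square algebra_simps)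
  then have "(x - c)\<^sup>2 / L\<^sup>2 \<le> (x\<^sup>2 - c\<^sup>2) / L\<^sup>2"
    by (rule divide_right_mono) simp
  also have "\<dots> \<le> exp ((x\<^sup>2 - c\<^sup>2) / L\<^sup>2)"
    using exp_ge_add_one_self[of "(x\<^sup>2 - c\<^sup>2) / L\<^sup>2"] by linarith
  finally have "(x - c)\<^sup>2 \<le> L\<^sup>2 * exp ((x\<^sup>2 - c\<^sup>2) / L\<^sup>2)"
    using assms by (simp add: field_simps)
  also have "exp ((x\<^sup>2 - c\<^sup>2) / L\<^sup>2) = exp (- c\<^sup>2 / L\<^sup>2) * exp (x\<^sup>2 / L\<^sup>2)"
    by (simp add: exp_add[symmetric] diff_divide_distrib)
  finally show ?thesis using True by (simp add: max_def mult.assoc)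
qed (simp add: max_def)

section \<open>Tail bounds for sums of independent variables\<close>

context prob_space
begin

lemma prob_le_nn_integral_exp:
  assumes [measurable]: "X \<in> borel_measurable M"
    and le: "(\<integral>\<^sup>+\<omega>. ennreal (exp (X \<omega>)) \<partial>M) \<le> ennreal B" and "0 \<le> B"
  shows "prob {\<omega>\<in>space M. t \<le> X \<omega>} \<le> B * exp (- t)"
proof -
  have "{\<omega>\<in>space M. t \<le> X \<omega>} = {\<omega>\<in>space M. 1 \<le> ennreal (exp (- t)) * ennreal (exp (X \<omega>))}"
    by (auto simp: ennreal_mult[symmetric] exp_add[symmetric] simp del: ennreal_1 simp flip: ennreal_1)
  then have "emeasure M {\<omega>\<in>space M. t \<le> X \<omega>} \<le> ennreal (exp (- t)) * (\<integral>\<^sup>+\<omega>. ennreal (exp (X \<omega>)) * indicator (space M) \<omega> \<partial>M)"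
    using nn_integral_Markov_inequality[of "\<lambda>\<omega>. ennreal (exp (X \<omega>))" "space M" M "ennreal (exp (- t))"] by simp
  also have "(\<integral>\<^sup>+\<omega>. ennreal (exp (X \<omega>)) * indicator (space M) \<omega> \<partial>M) = (\<integral>\<^sup>+\<omega>. ennreal (exp (X \<omega>)) \<partial>M)"
    by (intro nn_integral_cong) simp
  also have "ennreal (exp (- t)) * \<dots> \<le> ennreal (exp (- t)) * ennreal B"
    by (intro mult_left_mono le) simp
  finally show ?thesis
    using \<open>0 \<le> B\<close> by (simp add: emeasure_eq_measure ennreal_mult[symmetric] mult.commute)
qed

lemma sum_square_indep:
  fixes X :: "'i \<Rightarrow> 'a \<Rightarrow> real"
  assumes "finite I" "indep_vars (\<lambda>_. borel) X I"
    and "\<And>i. i \<in> I \<Longrightarrow> integrable M (\<lambda>\<omega>. (X i \<omega>)\<^sup>2)" "\<And>i. i \<in> I \<Longrightarrow> expectation (X i) = 0"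
  shows "integrable M (\<lambda>\<omega>. (\<Sum>i\<in>I. X i \<omega>)\<^sup>2) \<and>
    expectation (\<lambda>\<omega>. (\<Sum>i\<in>I. X i \<omega>)\<^sup>2) = (\<Sum>i\<in>I. expectation (\<lambda>\<omega>. (X i \<omega>)\<^sup>2))"
  using assms
proof (induction I rule: finite_induct)
  case (insert i I)
  let ?S = "\<lambda>\<omega>. \<Sum>j\<in>I. X j \<omega>"
  have rv: "random_variable borel (X j)" if "j \<in> insert i I" for j
    using insert.prems(1) that by (auto simp: indep_vars_def)
  have int: "integrable M (X j)" if "j \<in> insert i I" for j
    using square_integrable_imp_integrable[OF rv[OF that]] insert.prems(2) that by auto
  have IH: "integrable M (\<lambda>\<omega>. (?S \<omega>)\<^sup>2)" "expectation (\<lambda>\<omega>. (?S \<omega>)\<^sup>2) = (\<Sum>j\<in>I. expectation (\<lambda>\<omega>. (X j \<omega>)\<^sup>2))"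
    using insert.IH insert.prems indep_vars_subset[OF insert.prems(1), of I] by auto
  have ind: "indep_var borel (X i) borel ?S"
    using insert.hyps insert.prems(1) by (intro indep_vars_sum) auto
  have intS: "integrable M ?S" using int by auto
  have prod: "integrable M (\<lambda>\<omega>. X i \<omega> * ?S \<omega>)" "expectation (\<lambda>\<omega>. X i \<omega> * ?S \<omega>) = 0"
    using indep_var_integrable[OF ind int intS] indep_var_lebesgue_integral[OF ind int intS] insert.prems(3)
    by auto
  have eq: "(\<lambda>\<omega>. (\<Sum>j\<in>insert i I. X j \<omega>)\<^sup>2) = (\<lambda>\<omega>. (X i \<omega>)\<^sup>2 + (2 * (X i \<omega> * ?S \<omega>) + (?S \<omega>)\<^sup>2))"
    using insert.hyps by (simp add: power2_eq_square algebra_simps)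
  show ?case
    unfolding eq using insert.hyps IH prod insert.prems(2)[of i] by simp
qed simp

text \<open>Each mean is at most \<open>sqrt v\<close> and each variance at most \<open>v\<close>.
  Of the threshold, \<open>n * sqrt v\<close> covers the means and the other
  \<open>2 * n * sqrt v\<close> is the deviation in Chebyshev's inequality.\<close>

lemma prob_sum_indep_large:
  fixes Z :: "nat \<Rightarrow> 'a \<Rightarrow> real"
  assumes ind: "indep_vars (\<lambda>_. borel) Z {..<n}"
    and int: "\<And>i. i < n \<Longrightarrow> integrable M (\<lambda>\<omega>. (Z i \<omega>)\<^sup>2)"
    and v: "\<And>i. i < n \<Longrightarrow> expectation (\<lambda>\<omega>. (Z i \<omega>)\<^sup>2) \<le> v" and "0 < v" "0 < n"
  shows "prob {\<omega>\<in>space M. 3 * real n * sqrt v \<le> (\<Sum>i<n. Z i \<omega>)} \<le> 1 / (4 * real n)"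
proof -
  have rv[measurable]: "random_variable borel (Z i)" if "i < n" for i
    using ind that by (auto simp: indep_vars_def)
  have iZ: "integrable M (Z i)" if "i < n" for i
    using square_integrable_imp_integrable[OF rv[OF that] int[OF that]] .
  have var: "variance (Z i) = expectation (\<lambda>\<omega>. (Z i \<omega>)\<^sup>2) - (expectation (Z i))\<^sup>2" if "i < n" for i
    using iZ int that by (intro variance_eq) auto
  define X where "X = (\<lambda>i \<omega>. Z i \<omega> - expectation (Z i))"
  have indX: "indep_vars (\<lambda>_. borel) X {..<n}"
    unfolding X_def by (rule indep_vars_compose2[OF ind]) simp
  have "integrable M (\<lambda>\<omega>. (\<Sum>i<n. X i \<omega>)\<^sup>2) \<and>
    expectation (\<lambda>\<omega>. (\<Sum>i<n. X i \<omega>)\<^sup>2) = (\<Sum>i<n. expectation (\<lambda>\<omega>. (X i \<omega>)\<^sup>2))"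
  proof (rule sum_square_indep[OF _ indX])
    show "integrable M (\<lambda>\<omega>. (X i \<omega>)\<^sup>2)" if "i \<in> {..<n}" for i
      using that iZ int unfolding X_def power2_diff by auto
    show "expectation (X i) = 0" if "i \<in> {..<n}" for i
      using that iZ by (simp add: X_def prob_space)
  qed simp
  then have iS: "integrable M (\<lambda>\<omega>. (\<Sum>i<n. X i \<omega>)\<^sup>2)"
    and eS: "expectation (\<lambda>\<omega>. (\<Sum>i<n. X i \<omega>)\<^sup>2) = (\<Sum>i<n. variance (Z i))"
    by (auto simp: X_def)
  have "(\<Sum>i<n. variance (Z i)) \<le> (\<Sum>i<n. v)"
  proof (rule sum_mono)
    fix i assume "i \<in> {..<n}"
    then have "variance (Z i) = expectation (\<lambda>\<omega>. (Z i \<omega>)\<^sup>2) - (expectation (Z i))\<^sup>2"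
        "expectation (\<lambda>\<omega>. (Z i \<omega>)\<^sup>2) \<le> v"
      using var[of i] v[of i] by auto
    then show "variance (Z i) \<le> v"
      using zero_le_power2[of "expectation (Z i)"] by linarith
  qed
  with eS have eS': "expectation (\<lambda>\<omega>. (\<Sum>i<n. X i \<omega>)\<^sup>2) \<le> real n * v" by simp
  have mean: "expectation (Z i) \<le> sqrt v" if "i < n" for i
  proof (rule real_le_rsqrt)
    show "(expectation (Z i))\<^sup>2 \<le> v"
      using var[OF that] v[OF that] variance_positive[of "Z i"] by linarith
  qed
  have X_meas: "X i \<in> borel_measurable M" if "i < n" for i
    using rv[OF that] unfolding X_def by simp
  have m1: "(\<lambda>\<omega>. \<Sum>i<n. X i \<omega>) \<in> borel_measurable M"
    using X_meas by (intro borel_measurable_sum) auto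
  have sub: "{\<omega>\<in>space M. 3 * real n * sqrt v \<le> (\<Sum>i<n. Z i \<omega>)} \<subseteq> {\<omega>\<in>space M. 2 * real n * sqrt v \<le> \<bar>\<Sum>i<n. X i \<omega>\<bar>}"
  proof clarify
    fix \<omega> assume *: "3 * real n * sqrt v \<le> (\<Sum>i<n. Z i \<omega>)"
    have "(\<Sum>i<n. expectation (Z i)) \<le> (\<Sum>i<n. sqrt v)"
      using mean by (intro sum_mono) auto
    then have "2 * real n * sqrt v \<le> (\<Sum>i<n. X i \<omega>)"
      using * by (simp add: X_def sum_subtractf)
    then show "2 * real n * sqrt v \<le> \<bar>\<Sum>i<n. X i \<omega>\<bar>" by linarith
  qed
  have "prob {\<omega>\<in>space M. 3 * real n * sqrt v \<le> (\<Sum>i<n. Z i \<omega>)}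
      \<le> prob {\<omega>\<in>space M. 2 * real n * sqrt v \<le> \<bar>\<Sum>i<n. X i \<omega>\<bar>}"
    using measurable_sets[OF borel_measurable_abs[OF m1], of "{2 * real n * sqrt v..}"]
    by (intro finite_measure_mono sub) (simp_all add: vimage_def Int_def conj_commute)
  also have "\<dots> \<le> expectation (\<lambda>\<omega>. (\<Sum>i<n. X i \<omega>)\<^sup>2) / (2 * real n * sqrt v)\<^sup>2"
    using \<open>0 < v\<close> \<open>0 < n\<close> by (intro second_moment_method m1 iS) simp
  also have "\<dots> \<le> real n * v / (2 * real n * sqrt v)\<^sup>2"
    by (intro divide_right_mono eS') simp
  also have "(2 * real n * sqrt v)\<^sup>2 = 4 * real n * real n * v"
    using \<open>0 < v\<close> by (simp add: power_mult_distrib) (simp add: power2_eq_square)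
  also have "real n * v / (4 * real n * real n * v) = 1 / (4 * real n)"
    using \<open>0 < v\<close> \<open>0 < n\<close> by simp
  finally show ?thesis .
qed

end

section \<open>A net of the unit ball\<close>

text \<open>Points of the scaled lattice \<open>\<int>\<^sup>d / (2 \<surd>d)\<close> in the unit ball; rounding coordinates towards
  zero stays in the ball.\<close>

definition net_index :: "nat \<Rightarrow> (nat \<Rightarrow> int) set" where
  "net_index d = {z \<in> PiE {..<d} (\<lambda>_. {- (2 * int d)..2 * int d}). (\<Sum>l<d. (z l)\<^sup>2) \<le> 4 * int d}"

definition net :: "nat \<Rightarrow> (nat \<Rightarrow> real) set" where
  "net d = (\<lambda>z l. real_of_int (z l) / (2 * sqrt d)) ` net_index d"

lemma finite_net_index: "finite (net_index d)"
  unfolding net_index_def by (rule finite_subset[of _ "PiE {..<d} (\<lambda>_. {- (2 * int d)..2 * int d})"]) (auto intro: finite_PiE)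

lemma finite_net [simp]: "finite (net d)"
  by (simp add: net_def finite_net_index)

text \<open>The aim is the uniform bound 3. The geometric correction makes the induction close:
  passing to \<open>Suc N\<close> adds two terms, each at most \<open>(1/2) ^ Suc N\<close>.\<close>

lemma sum_exp_neg_square_le: "(\<Sum>z\<in>{- int N..int N}. exp (- (real_of_int z)\<^sup>2)) \<le> 3 - 2 * (1/2) ^ N"
proof (induction N)
  case (Suc N)
  have eq: "{- int (Suc N)..int (Suc N)} = insert (int (Suc N)) (insert (- int (Suc N)) {- int N..int N})"
    by auto
  have "exp (- (real (Suc N))\<^sup>2) \<le> exp (- (real (Suc N)))"
    using self_le_power[of "real (Suc N)" 2] by simp
  also have "\<dots> = exp (- 1) ^ Suc N"
    by (subst exp_of_nat_mult[symmetric]) simp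
  also have "\<dots> \<le> (1/2) ^ Suc N"
  proof (rule power_mono)
    show "exp (- 1) \<le> (1/2 :: real)"
      using exp_ge_add_one_self[of "1::real"] by (simp add: exp_minus field_simps)
  qed simp
  finally show ?case
    using Suc.IH power2_minus[of "1 + real N"] unfolding eq by (simp add: of_nat_Suc)
qed simp

text \<open>Gaussian counting: a lattice point \<open>z\<close> of squared length at most
  \<open>4 * d\<close> has weight at least 1 under \<open>exp (4 * d - |z|\<^sup>2)\<close>, and
  over the whole box this weight factorizes into one-dimensional sums of at most
  \<open>exp 2\<close>. The size of the box alone would give only
  \<open>(4 * d + 1) ^ d\<close>.\<close>

lemma card_net_le: "real (card (net d)) \<le> exp (6 * real d)"
proof -
  let ?P = "PiE {..<d} (\<lambda>_. {- (2 * int d)..2 * int d})"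
  have "real (card (net_index d)) = (\<Sum>z\<in>net_index d. 1)" by simp
  also have "\<dots> \<le> (\<Sum>z\<in>net_index d. exp (4 * real d) * (\<Prod>l<d. exp (- (real_of_int (z l))\<^sup>2)))"
  proof (rule sum_mono)
    fix z assume "z \<in> net_index d"
    then have "(\<Sum>l<d. (z l)\<^sup>2) \<le> 4 * int d" by (simp add: net_index_def)
    then have "real_of_int (\<Sum>l<d. (z l)\<^sup>2) \<le> real_of_int (4 * int d)"
      by (simp only: of_int_le_iff)
    then have "1 \<le> exp (4 * real d - (\<Sum>l<d. (real_of_int (z l))\<^sup>2))" by simp
    also have "\<dots> = exp (4 * real d) * (\<Prod>l<d. exp (- (real_of_int (z l))\<^sup>2))"
      by (simp add: exp_sum[symmetric] exp_add[symmetric] sum_negf)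
    finally show "1 \<le> exp (4 * real d) * (\<Prod>l<d. exp (- (real_of_int (z l))\<^sup>2))" .
  qed
  also have "\<dots> \<le> (\<Sum>z\<in>?P. exp (4 * real d) * (\<Prod>l<d. exp (- (real_of_int (z l))\<^sup>2)))"
  proof (rule sum_mono2)
    show "finite ?P" by (rule finite_PiE) auto
    show "net_index d \<subseteq> ?P" by (auto simp: net_index_def)
  qed (simp add: prod_nonneg)
  also have "\<dots> = exp (4 * real d) * (\<Prod>l<d. \<Sum>z\<in>{- (2 * int d)..2 * int d}. exp (- (real_of_int z)\<^sup>2))"
    by (subst prod_sum_PiE) (simp_all add: sum_distrib_left)
  also have "\<dots> = exp (4 * real d) * (\<Sum>z\<in>{- int (2 * d)..int (2 * d)}. exp (- (real_of_int z)\<^sup>2)) ^ d"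
    by simp
  also have "\<dots> \<le> exp (4 * real d) * (exp 2) ^ d"
  proof (intro mult_left_mono power_mono)
    have "(\<Sum>z\<in>{- int (2 * d)..int (2 * d)}. exp (- (real_of_int z)\<^sup>2)) \<le> 3"
      using sum_exp_neg_square_le[of "2 * d"] by (smt (verit) zero_le_power zero_le_divide_1_iff)
    also have "\<dots> \<le> exp 2"
      using exp_ge_add_one_self[of "2::real"] by simp
    finally show "(\<Sum>z\<in>{- int (2 * d)..int (2 * d)}. exp (- (real_of_int z)\<^sup>2)) \<le> exp 2" .
  qed (auto intro: sum_nonneg)
  also have "\<dots> = exp (6 * real d)"
    by (simp add: exp_of_nat_mult[symmetric] exp_add[symmetric])
  finally have "real (card (net_index d)) \<le> exp (6 * real d)" .
  moreover have "card (net d) \<le> card (net_index d)"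
    unfolding net_def by (rule card_image_le[OF finite_net_index])
  ultimately show ?thesis by linarith
qed

lemma dot_net_le_1:
  assumes "u \<in> net d"
  shows "dot d u u \<le> 1"
proof (cases "d = 0")
  case False
  obtain z where z: "(\<Sum>l<d. (z l)\<^sup>2) \<le> 4 * int d" "u = (\<lambda>l. real_of_int (z l) / (2 * sqrt d))"
    using assms by (auto simp: net_def net_index_def)
  have "real_of_int (\<Sum>l<d. (z l)\<^sup>2) \<le> real_of_int (4 * int d)"
    using z(1) by (simp only: of_int_le_iff)
  then have "(\<Sum>l<d. (real_of_int (z l))\<^sup>2) \<le> 4 * real d" by simp
  moreover have "dot d u u = (\<Sum>l<d. (real_of_int (z l))\<^sup>2) / (4 * real d)"
    by (simp add: dot_def z(2) sum_divide_distrib power2_eq_square)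
  ultimately show ?thesis using False by (simp add: pos_divide_le_eq)
qed (simp add: dot_def)

text \<open>Each coordinate moves by at most \<open>1 / (2 * sqrt d)\<close>, and \<open>d\<close>
  such squares sum to at most 1/4.\<close>

lemma net_approx:
  assumes "dot d v v \<le> 1"
  shows "\<exists>u\<in>net d. dot d (\<lambda>l. v l - u l) (\<lambda>l. v l - u l) \<le> 1/4"
proof -
  define c where "c = 2 * sqrt d"
  define tr :: "real \<Rightarrow> int" where "tr = (\<lambda>x. if 0 \<le> x then \<lfloor>x\<rfloor> else \<lceil>x\<rceil>)"
  have tr1: "\<bar>real_of_int (tr x)\<bar> \<le> \<bar>x\<bar>" for x
  proof (cases "0 \<le> x")
    case True
    then have "0 \<le> real_of_int \<lfloor>x\<rfloor>" by simp
    then show ?thesis using of_int_floor_le[of x] True by (simp add: tr_def)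
  next
    case False
    then have "real_of_int \<lceil>x\<rceil> \<le> 0" by simp
    then show ?thesis using le_of_int_ceiling[of x] False by (simp add: tr_def)
  qed
  have tr2: "\<bar>x - tr x\<bar> \<le> 1" for x
  proof (cases "0 \<le> x")
    case True
    then show ?thesis using floor_correct[of x] by (simp add: tr_def abs_le_iff) linarith
  next
    case False
    then show ?thesis using ceiling_correct[of x] by (simp add: tr_def abs_le_iff)
  qed
  define z where "z = (\<lambda>l\<in>{..<d}. tr (c * v l))"
  have zle: "(real_of_int (z l))\<^sup>2 \<le> 4 * real d * (v l)\<^sup>2" if "l < d" for l
  proof -
    have "(real_of_int (z l))\<^sup>2 \<le> (c * v l)\<^sup>2"
      using tr1[of "c * v l"] that by (simp add: z_def abs_le_square_iff[symmetric])
    then show ?thesis by (simp add: c_def power_mult_distrib)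
  qed
  have sumz: "(\<Sum>l<d. (z l)\<^sup>2) \<le> 4 * int d"
  proof -
    have "(\<Sum>l<d. (real_of_int (z l))\<^sup>2) \<le> (\<Sum>l<d. 4 * real d * (v l)\<^sup>2)"
      using zle by (intro sum_mono) auto
    also have "\<dots> = 4 * real d * dot d v v"
      by (simp add: dot_def sum_distrib_left power2_eq_square)
    also have "\<dots> \<le> 4 * real d" using assms mult_left_mono[of "dot d v v" 1 "4 * real d"] by simp
    finally have "real_of_int (\<Sum>l<d. (z l)\<^sup>2) \<le> real_of_int (4 * int d)" by simp
    then show ?thesis by (simp only: of_int_le_iff)
  qed
  have "z \<in> net_index d"
    unfolding net_index_def
  proof (intro CollectI conjI sumz)
    have "- (2 * int d) \<le> z l \<and> z l \<le> 2 * int d" if "l < d" for l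
    proof -
      have "(z l)\<^sup>2 \<le> (\<Sum>l<d. (z l)\<^sup>2)"
        using that by (intro member_le_sum) auto
      also have "\<dots> \<le> (2 * int d)\<^sup>2"
        using sumz that by (simp add: power2_eq_square) (smt (verit) mult_le_cancel_left1 of_nat_less_0_iff)
      finally have "\<bar>z l\<bar> \<le> \<bar>2 * int d\<bar>" by (simp only: abs_le_square_iff)
      then show ?thesis by linarith
    qed
    then show "z \<in> PiE {..<d} (\<lambda>_. {- (2 * int d)..2 * int d})"
      by (auto simp: z_def)
  qed
  moreover define u where "u = (\<lambda>l. real_of_int (z l) / (2 * sqrt d))"
  ultimately have "u \<in> net d" by (auto simp: net_def)
  moreover have "dot d (\<lambda>l. v l - u l) (\<lambda>l. v l - u l) \<le> 1/4"
  proof (cases "d = 0")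
    case False
    have "(v l - u l)\<^sup>2 \<le> 1 / (4 * real d)" if "l < d" for l
    proof -
      have c0: "0 < c" using False by (simp add: c_def)
      have "v l - u l = (c * v l - tr (c * v l)) / c"
        using that c0 unfolding u_def z_def c_def by (simp add: field_simps)
      then have "(v l - u l)\<^sup>2 = (c * v l - tr (c * v l))\<^sup>2 / c\<^sup>2"
        by (simp add: power_divide)
      also have "\<dots> \<le> 1 / c\<^sup>2"
        using tr2[of "c * v l"] by (intro divide_right_mono) (auto simp: abs_square_le_1)
      finally show ?thesis by (simp add: c_def power_mult_distrib)
    qed
    then have "(\<Sum>l<d. (v l - u l)\<^sup>2) \<le> (\<Sum>l<d. 1 / (4 * real d))"
      by (intro sum_mono) auto
    then show ?thesis using False by (simp add: dot_def power2_eq_square)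
  qed (simp add: dot_def)
  ultimately show ?thesis by blast
qed

text \<open>With \<open>v\<close> the direction of \<open>x\<close> and \<open>u\<close> its net
  point, \<open>vnorm d x\<close> is at most \<open>dot d x u\<close> plus half of
  \<open>vnorm d x\<close>; the half is absorbed on the left.\<close>

lemma vnorm_le_net:
  assumes "\<And>u. u \<in> net d \<Longrightarrow> dot d x u \<le> t" "0 \<le> t"
  shows "vnorm d x \<le> 2 * t"
proof (cases "vnorm d x = 0")
  case False
  then have pos: "0 < vnorm d x" using vnorm_nonneg[of d x] by linarith
  define v where "v = (\<lambda>l. (1 / vnorm d x) * x l)"
  have "dot d v v = (1 / vnorm d x) * ((1 / vnorm d x) * dot d x x)"
    unfolding v_def dot_scale_left dot_scale_right ..
  then have "dot d v v = 1"
    using False by (simp add: vnorm_power2[symmetric] power2_eq_square)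
  then obtain u where u: "u \<in> net d" "dot d (\<lambda>l. v l - u l) (\<lambda>l. v l - u l) \<le> 1/4"
    using net_approx[of d v] by auto
  have "vnorm d (\<lambda>l. v l - u l) \<le> 1/2"
    using real_sqrt_le_mono[OF u(2)] by (simp add: vnorm_eq_sqrt_dot real_sqrt_divide)
  then have "dot d x (\<lambda>l. v l - u l) \<le> vnorm d x * (1/2)"
    using abs_dot_le[of d x "\<lambda>l. v l - u l"] mult_left_mono[of _ "1/2" "vnorm d x"] pos
    by (smt (verit) vnorm_nonneg)
  moreover have "dot d x v = vnorm d x"
    unfolding v_def dot_scale_right using False by (simp add: vnorm_power2[symmetric] power2_eq_square)
  ultimately show ?thesis
    using assms(1)[OF u(1)] by (simp add: dot_diff_right)
qed (use assms in simp)

text \<open>The same absorption for the operator norm \<open>s\<close>: the remainder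
  \<open>x - u\<close>, doubled, lies in the unit ball again, so
  \<open>s \<le> sqrt T + s / 2\<close>. The supremum must be known to be finite beforehand, which
  the crude estimate \<open>bdd\<close> provides.\<close>

lemma operator_norm_le_net:
  assumes "\<And>u. u \<in> net d \<Longrightarrow> (\<Sum>i<n. (dot d (g i) u)\<^sup>2) \<le> T" "0 \<le> T"
  shows "(\<Sum>i<n. (dot d (g i) v)\<^sup>2) \<le> 4 * T * dot d v v"
proof -
  define q where "q = (\<lambda>v. L2_set (\<lambda>i. dot d (g i) v) {..<n})"
  have q_add: "q (\<lambda>l. x l + y l) \<le> q x + q y" for x y
    unfolding q_def dot_add_right by (rule L2_set_triangle_ineq)
  have q_scale: "q (\<lambda>l. c * x l) = \<bar>c\<bar> * q x" for c x
    unfolding q_def dot_scale_right by (simp add: L2_set_def power_mult_distrib sum_distrib_left[symmetric] real_sqrt_mult)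
  define U where "U = {v. dot d v v \<le> 1}"
  have bdd: "bdd_above (q ` U)"
  proof (rule bdd_aboveI2)
    fix x assume "x \<in> U"
    then have x: "vnorm d x \<le> 1"
      using real_sqrt_le_mono[of "dot d x x" 1] by (simp add: U_def vnorm_eq_sqrt_dot)
    have "q x \<le> (\<Sum>i<n. \<bar>dot d (g i) x\<bar>)"
      unfolding q_def by (rule L2_set_le_sum_abs)
    also have "\<dots> \<le> (\<Sum>i<n. vnorm d (g i))"
    proof (rule sum_mono)
      fix i
      show "\<bar>dot d (g i) x\<bar> \<le> vnorm d (g i)"
        using abs_dot_le[of d "g i" x] mult_left_mono[OF x, of "vnorm d (g i)"] by simp
    qed
    finally show "q x \<le> (\<Sum>i<n. vnorm d (g i))" .
  qed
  define s where "s = Sup (q ` U)"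
  have q_le: "q x \<le> s" if "x \<in> U" for x
    unfolding s_def using that bdd by (rule cSUP_upper)
  have "s \<le> sqrt T + s / 2"
    unfolding s_def
  proof (rule cSUP_least)
    show "U \<noteq> {}" by (auto simp: U_def dot_def intro!: exI[of _ "\<lambda>_. 0"])
    fix x assume "x \<in> U"
    then obtain u where u: "u \<in> net d" "dot d (\<lambda>l. x l - u l) (\<lambda>l. x l - u l) \<le> 1/4"
      using net_approx[of d x] by (auto simp: U_def)
    have "(\<lambda>l. 2 * (x l - u l)) \<in> U"
      using u(2) unfolding U_def mem_Collect_eq dot_scale_left dot_scale_right by simp
    from q_le[OF this] have "2 * q (\<lambda>l. x l - u l) \<le> s"
      unfolding q_scale by simp
    moreover have "q u \<le> sqrt T"
      unfolding q_def L2_set_def by (intro real_sqrt_le_mono assms u)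
    moreover have "q x \<le> q u + q (\<lambda>l. x l - u l)"
      using q_add[of u "\<lambda>l. x l - u l"] by simp
    ultimately show "q x \<le> sqrt T + Sup (q ` U) / 2"
      unfolding s_def by linarith
  qed
  then have s_le: "s \<le> 2 * sqrt T" by simp
  have "q v \<le> 2 * sqrt T * vnorm d v"
  proof (cases "vnorm d v = 0")
    case True
    then have "dot d (g i) v = 0" for i
      using abs_dot_le[of d "g i" v] by simp
    then show ?thesis using True by (simp add: q_def L2_set_def)
  next
    case False
    then have pos: "0 < vnorm d v" using vnorm_nonneg[of d v] by linarith
    have "(\<lambda>l. 1 / vnorm d v * v l) \<in> U"
      unfolding U_def mem_Collect_eq dot_scale_left dot_scale_right
      unfolding vnorm_power2[symmetric] using False by (simp add: power2_eq_square)
    from q_le[OF this] have "q v / vnorm d v \<le> s"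
      using pos unfolding q_scale by simp
    then show ?thesis
      using s_le pos by (simp add: divide_le_eq) (smt (verit) mult_right_mono)
  qed
  then have "(q v)\<^sup>2 \<le> (2 * sqrt T * vnorm d v)\<^sup>2"
    by (rule power_mono) (simp add: q_def)
  then show ?thesis
    using assms(2) by (simp add: q_def L2_set_def power_mult_distrib vnorm_power2 sum_nonneg)
qed

section \<open>Sub-Gaussian noise\<close>

text \<open>Attainment of the infimum is not at issue: strict inequality yields an admissible
  \<open>t < K\<close>, and the moment decreases as the scale grows.\<close>

lemma psi2_less_imp_exp_square_le:
  assumes "psi2 M X < ereal K"
  shows "(\<integral>\<^sup>+\<omega>. ennreal (exp ((X \<omega>)\<^sup>2 / K\<^sup>2)) \<partial>M) \<le> 2"
proof -
  obtain t where t: "0 < t" "t < K" "(\<integral>\<^sup>+\<omega>. ennreal (exp ((X \<omega>)\<^sup>2 / t\<^sup>2)) \<partial>M) \<le> 2"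
    using assms unfolding psi2_def Inf_less_iff by auto
  have "(\<integral>\<^sup>+\<omega>. ennreal (exp ((X \<omega>)\<^sup>2 / K\<^sup>2)) \<partial>M) \<le> (\<integral>\<^sup>+\<omega>. ennreal (exp ((X \<omega>)\<^sup>2 / t\<^sup>2)) \<partial>M)"
  proof (intro nn_integral_mono ennreal_leI)
    fix \<omega>
    have "t\<^sup>2 \<le> K\<^sup>2" using t by (intro power_mono) auto
    then show "exp ((X \<omega>)\<^sup>2 / K\<^sup>2) \<le> exp ((X \<omega>)\<^sup>2 / t\<^sup>2)"
      using t by (simp add: frac_le)
  qed
  with t show ?thesis by simp
qed

locale subgaussian_noise = prob_space M for M :: "'a measure" +
  fixes n d :: nat and g :: "nat \<Rightarrow> 'a \<Rightarrow> nat \<Rightarrow> real" and K :: real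
  assumes K_pos: "0 < K"
    and indep: "indep_vars (\<lambda>_. PiM {..<d} (\<lambda>_. borel)) (\<lambda>i \<omega>. restrict (g i \<omega>) {..<d}) {..<n}"
    and coord_integrable: "\<And>i l. i < n \<Longrightarrow> l < d \<Longrightarrow> integrable M (\<lambda>\<omega>. g i \<omega> l)"
    and coord_mean: "\<And>i l. i < n \<Longrightarrow> l < d \<Longrightarrow> (\<integral>\<omega>. g i \<omega> l \<partial>M) = 0"
    and subgaussian: "\<And>i u. i < n \<Longrightarrow> dot d u u = 1 \<Longrightarrow>
      (\<integral>\<^sup>+\<omega>. ennreal (exp ((dot d (g i \<omega>) u)\<^sup>2 / K\<^sup>2)) \<partial>M) \<le> 2"
begin

definition noise_sum :: "nat set \<Rightarrow> 'a \<Rightarrow> nat \<Rightarrow> real" where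
  "noise_sum R \<omega> = (\<lambda>l. \<Sum>i\<in>R. g i \<omega> l)"

lemma dot_noise_sum: "dot d (noise_sum R \<omega>) v = (\<Sum>i\<in>R. dot d (g i \<omega>) v)"
  by (simp add: noise_sum_def dot_sum_left)

lemma coord_measurable: "i < n \<Longrightarrow> l < d \<Longrightarrow> (\<lambda>\<omega>. g i \<omega> l) \<in> borel_measurable M"
  using coord_integrable by blast

lemma dot_measurable: "i < n \<Longrightarrow> (\<lambda>\<omega>. dot d (g i \<omega>) v) \<in> borel_measurable M"
  unfolding dot_def by (intro borel_measurable_sum borel_measurable_times coord_measurable) auto

lemma noise_sum_measurable: "R \<subseteq> {..<n} \<Longrightarrow> l < d \<Longrightarrow> (\<lambda>\<omega>. noise_sum R \<omega> l) \<in> borel_measurable M"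
  unfolding noise_sum_def by (intro borel_measurable_sum coord_measurable) auto

lemma vnorm_noise_sum_measurable: "R \<subseteq> {..<n} \<Longrightarrow> (\<lambda>\<omega>. vnorm d (noise_sum R \<omega>)) \<in> borel_measurable M"
  unfolding vnorm_def
  by (intro borel_measurable_sqrt[THEN measurable_compose[rotated]] borel_measurable_sum borel_measurable_power noise_sum_measurable) auto

lemma dot_noise_sum_measurable:
  "R \<subseteq> {..<n} \<Longrightarrow> j < n \<Longrightarrow> (\<lambda>\<omega>. dot d (g j \<omega>) (noise_sum R \<omega>)) \<in> borel_measurable M"
  unfolding dot_def by (intro borel_measurable_sum borel_measurable_times noise_sum_measurable coord_measurable) auto

lemma dot_measurable_PiM: "(\<lambda>x. dot d x v) \<in> borel_measurable (PiM {..<d} (\<lambda>_. borel))"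
  unfolding dot_def by (intro borel_measurable_sum borel_measurable_times measurable_component_singleton) auto

lemma dot_restrict: "dot d (restrict x {..<d}) v = dot d x v"
  by (rule dot_cong) auto

lemma mean_dot:
  assumes "i < n"
  shows "integrable M (\<lambda>\<omega>. dot d (g i \<omega>) v)" "expectation (\<lambda>\<omega>. dot d (g i \<omega>) v) = 0"
  unfolding dot_def using assms coord_integrable coord_mean by auto

text \<open>Homogeneity reduces to a unit vector. Allowing any positive \<open>\<theta>\<close> from
  \<open>K\<^sup>2 * dot d v v\<close> upwards covers the zero vector and lets vectors of different
  lengths share one scale.\<close>

lemma exp_square_le_2:
  assumes "i < n" "K\<^sup>2 * dot d v v \<le> \<theta>" "0 < \<theta>"
  shows "(\<integral>\<^sup>+\<omega>. ennreal (exp ((dot d (g i \<omega>) v)\<^sup>2 / \<theta>)) \<partial>M) \<le> 2"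
proof (cases "dot d v v = 0")
  case True
  then have "(dot d (g i \<omega>) v)\<^sup>2 = 0" for \<omega>
    using dot_power2_le[of d "g i \<omega>" v] by (metis mult_zero_right order_antisym zero_le_power2)
  then have "(\<integral>\<^sup>+\<omega>. ennreal (exp ((dot d (g i \<omega>) v)\<^sup>2 / \<theta>)) \<partial>M) = 1"
    by (simp add: emeasure_space_1)
  then show ?thesis by simp
next
  case False
  define r where "r = vnorm d v"
  have r2: "r\<^sup>2 = dot d v v" by (simp add: r_def vnorm_power2)
  have r: "0 < r" using False r2 by (metis r_def vnorm_nonneg order_le_less zero_power2)
  define u where "u = (\<lambda>l. 1 / r * v l)"
  have "dot d u u = 1"
    unfolding u_def dot_scale_left dot_scale_right r2[symmetric] using r by (simp add: power2_eq_square)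
  from subgaussian[OF assms(1) this]
  have "(\<integral>\<^sup>+\<omega>. ennreal (exp ((dot d (g i \<omega>) u)\<^sup>2 / K\<^sup>2)) \<partial>M) \<le> 2" .
  moreover have "(\<integral>\<^sup>+\<omega>. ennreal (exp ((dot d (g i \<omega>) v)\<^sup>2 / \<theta>)) \<partial>M)
      \<le> (\<integral>\<^sup>+\<omega>. ennreal (exp ((dot d (g i \<omega>) u)\<^sup>2 / K\<^sup>2)) \<partial>M)"
  proof (intro nn_integral_mono ennreal_leI)
    fix \<omega>
    have "(dot d (g i \<omega>) u)\<^sup>2 / K\<^sup>2 = (dot d (g i \<omega>) v)\<^sup>2 / (K\<^sup>2 * r\<^sup>2)"
      unfolding u_def dot_scale_right by (simp add: power_divide)
    moreover have "(dot d (g i \<omega>) v)\<^sup>2 / \<theta> \<le> (dot d (g i \<omega>) v)\<^sup>2 / (K\<^sup>2 * r\<^sup>2)"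
      using assms(2,3) r K_pos unfolding r2[symmetric] by (intro divide_left_mono) auto
    ultimately show "exp ((dot d (g i \<omega>) v)\<^sup>2 / \<theta>) \<le> exp ((dot d (g i \<omega>) u)\<^sup>2 / K\<^sup>2)"
      by simp
  qed
  ultimately show ?thesis by simp
qed

lemma expectation_exp_square:
  assumes "i < n" "K\<^sup>2 * dot d v v \<le> \<theta>" "0 < \<theta>"
  shows "integrable M (\<lambda>\<omega>. exp ((dot d (g i \<omega>) v)\<^sup>2 / \<theta>))"
    and "expectation (\<lambda>\<omega>. exp ((dot d (g i \<omega>) v)\<^sup>2 / \<theta>)) \<le> 2"
proof -
  let ?f = "\<lambda>\<omega>. exp ((dot d (g i \<omega>) v)\<^sup>2 / \<theta>)"
  have [measurable]: "(\<lambda>\<omega>. dot d (g i \<omega>) v) \<in> borel_measurable M" using assms(1) by (rule dot_measurable)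
  have le: "(\<integral>\<^sup>+\<omega>. ennreal (?f \<omega>) \<partial>M) \<le> 2" by (rule exp_square_le_2[OF assms])
  show int: "integrable M ?f"
  proof (rule integrableI_nonneg)
    show "(\<integral>\<^sup>+\<omega>. ennreal (?f \<omega>) \<partial>M) < \<infinity>"
      using le by (rule order.strict_trans1) simp
  qed auto
  have "ennreal (expectation ?f) = (\<integral>\<^sup>+\<omega>. ennreal (?f \<omega>) \<partial>M)"
    by (rule nn_integral_eq_integral[symmetric, OF int]) simp
  with le have "ennreal (expectation ?f) \<le> ennreal 2" by simp
  then show "expectation ?f \<le> 2" by (subst (asm) ennreal_le_iff) auto
qed

text \<open>For \<open>\<theta> \<le> 1\<close>, the mean-zero linear term of
  \<open>exp_le_add_exp_square\<close> drops out and convexity gives \<open>1 + \<theta>\<close>.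
  For larger \<open>\<theta>\<close>, completing the square gives
  \<open>X \<le> X\<^sup>2 / \<theta> + \<theta> / 4\<close>, and the factor 2 is at most
  \<open>exp (3 / 4 * \<theta>)\<close>. Both cases produce an integrable majorant whose expectation
  is computable.\<close>

lemma mgf_le:
  assumes "i < n" "K\<^sup>2 * dot d v v \<le> \<theta>" "0 < \<theta>"
  shows "(\<integral>\<^sup>+\<omega>. ennreal (exp (dot d (g i \<omega>) v)) \<partial>M) \<le> ennreal (exp \<theta>)"
proof -
  let ?X = "\<lambda>\<omega>. dot d (g i \<omega>) v"
  have m[measurable]: "?X \<in> borel_measurable M" using assms(1) by (rule dot_measurable)
  note E = expectation_exp_square[OF assms]
  have "\<exists>Y. integrable M Y \<and> (\<forall>\<omega>. exp (?X \<omega>) \<le> Y \<omega>) \<and> expectation Y \<le> exp \<theta>"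
  proof (cases "\<theta> \<le> 1")
    case True
    let ?Y = "\<lambda>\<omega>. ?X \<omega> + ((1 - \<theta>) + \<theta> * exp ((?X \<omega>)\<^sup>2 / \<theta>))"
    have "exp (?X \<omega>) \<le> ?Y \<omega>" for \<omega>
    proof -
      have "exp ((?X \<omega>)\<^sup>2) \<le> 1 - \<theta> + \<theta> * exp ((?X \<omega>)\<^sup>2 / \<theta>)"
        using exp_mult_le_affine[of \<theta> "(?X \<omega>)\<^sup>2 / \<theta>"] assms(3) True by simp
      then show ?thesis using exp_le_add_exp_square[of "?X \<omega>"] by linarith
    qed
    moreover have "integrable M ?Y" using E(1) mean_dot(1)[OF assms(1)] by auto
    moreover have "expectation ?Y \<le> exp \<theta>"
    proof -
      have "expectation ?Y = (1 - \<theta>) + \<theta> * expectation (\<lambda>\<omega>. exp ((?X \<omega>)\<^sup>2 / \<theta>))"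
        using E(1) mean_dot[OF assms(1)] by (simp add: prob_space)
      also have "\<dots> \<le> (1 - \<theta>) + \<theta> * 2"
        using E(2) assms(3) by (intro add_left_mono mult_left_mono) auto
      also have "\<dots> \<le> exp \<theta>" using exp_ge_add_one_self[of \<theta>] by linarith
      finally show ?thesis .
    qed
    ultimately show ?thesis by blast
  next
    case False
    let ?Y = "\<lambda>\<omega>. exp (\<theta> / 4) * exp ((?X \<omega>)\<^sup>2 / \<theta>)"
    have "exp (?X \<omega>) \<le> ?Y \<omega>" for \<omega>
    proof -
      have "0 \<le> (?X \<omega> - \<theta> / 2)\<^sup>2 / \<theta>" using assms(3) by simp
      also have "\<dots> = (?X \<omega>)\<^sup>2 / \<theta> - ?X \<omega> + \<theta> / 4"
        using assms(3) by (simp add: power2_eq_square field_simps)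
      finally show ?thesis by (simp add: exp_add[symmetric])
    qed
    moreover have "integrable M ?Y" using E(1) by auto
    moreover have "expectation ?Y \<le> exp \<theta>"
    proof -
      have "expectation ?Y = exp (\<theta> / 4) * expectation (\<lambda>\<omega>. exp ((?X \<omega>)\<^sup>2 / \<theta>))" by simp
      also have "\<dots> \<le> exp (\<theta> / 4) * 2" using E(2) by (intro mult_left_mono) auto
      also have "\<dots> \<le> exp (\<theta> / 4) * exp (3 / 4 * \<theta>)"
      proof (rule mult_left_mono)
        have "2 \<le> exp (3 / 4 :: real)"
          using exp_lower_Taylor_quadratic[of "3/4"] by (simp add: power2_eq_square)
        also have "\<dots> \<le> exp (3 / 4 * \<theta>)" using False by simp
        finally show "2 \<le> exp (3 / 4 * \<theta>)" .
      qed simp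
      also have "\<dots> = exp \<theta>" by (simp add: exp_add[symmetric])
      finally show ?thesis .
    qed
    ultimately show ?thesis by blast
  qed
  then obtain Y where Y: "integrable M Y" "\<And>\<omega>. exp (?X \<omega>) \<le> Y \<omega>" "expectation Y \<le> exp \<theta>" by blast
  have "(\<integral>\<^sup>+\<omega>. ennreal (exp (?X \<omega>)) \<partial>M) \<le> (\<integral>\<^sup>+\<omega>. ennreal (Y \<omega>) \<partial>M)"
    by (intro nn_integral_mono ennreal_leI Y)
  also have "\<dots> = ennreal (expectation Y)"
  proof (rule nn_integral_eq_integral[OF Y(1)])
    show "AE \<omega> in M. 0 \<le> Y \<omega>"
      using Y(2) by (intro AE_I2) (meson exp_ge_zero order.trans)
  qed
  also have "\<dots> \<le> ennreal (exp \<theta>)" using Y(3) by (rule ennreal_leI)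
  finally show ?thesis .
qed

text \<open>The real \<open>r\<close> is only an upper bound for the cardinality, so that a cluster
  with or without one deleted point has the same estimate.\<close>

lemma mgf_sum_le:
  assumes R: "R \<subseteq> {..<n}" "real (card R) \<le> r" and v: "K\<^sup>2 * dot d v v \<le> \<theta>" "0 < \<theta>"
  shows "(\<integral>\<^sup>+\<omega>. ennreal (exp (dot d (noise_sum R \<omega>) v)) \<partial>M) \<le> ennreal (exp (r * \<theta>))"
proof -
  have fin: "finite R" using R(1) finite_subset by blast
  have "indep_vars (\<lambda>_. borel) (\<lambda>i \<omega>. ennreal (exp (dot d (restrict (g i \<omega>) {..<d}) v))) {..<n}"
    by (rule indep_vars_compose2[OF indep]) (use dot_measurable_PiM[of v] in measurable)
  then have ind: "indep_vars (\<lambda>_. borel) (\<lambda>i \<omega>. ennreal (exp (dot d (g i \<omega>) v))) R"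
    unfolding dot_restrict using R(1) indep_vars_subset by blast
  have "(\<integral>\<^sup>+\<omega>. ennreal (exp (dot d (noise_sum R \<omega>) v)) \<partial>M)
      = (\<integral>\<^sup>+\<omega>. (\<Prod>i\<in>R. ennreal (exp (dot d (g i \<omega>) v))) \<partial>M)"
    using fin by (simp add: dot_noise_sum exp_sum prod_ennreal)
  also have "\<dots> = (\<Prod>i\<in>R. \<integral>\<^sup>+\<omega>. ennreal (exp (dot d (g i \<omega>) v)) \<partial>M)"
    by (rule indep_vars_nn_integral[OF fin ind]) simp
  also have "\<dots> \<le> (\<Prod>i\<in>R. ennreal (exp \<theta>))"
    using R(1) v by (intro prod_mono_ennreal) (auto intro!: mgf_le)
  also have "\<dots> = ennreal (exp (card R * \<theta>))"
    by (simp add: ennreal_power exp_of_nat_mult)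
  also have "\<dots> \<le> ennreal (exp (r * \<theta>))"
    using R(2) v(2) by (intro ennreal_leI) (simp add: mult_right_mono)
  finally show ?thesis .
qed

text \<open>A Chernoff bound in each net direction; the summand \<open>6 * d\<close> pays for the
  cardinality of the net. Of the factor 4, one 2 comes from Chernoff and one from
  \<open>vnorm_le_net\<close>.\<close>

lemma prob_vnorm_noise_sum_large:
  assumes R: "R \<subseteq> {..<n}" "real (card R) \<le> r" and r: "0 < r" and q: "0 < q"
  shows "prob {\<omega>\<in>space M. 4 * K * sqrt (r * (6 * real d + q)) < vnorm d (noise_sum R \<omega>)} \<le> exp (- q)"
proof -
  define t where "t = 2 * K * sqrt (r * (6 * real d + q))"
  have t: "0 < t" using K_pos r q by (simp add: t_def)
  have dm: "(\<lambda>\<omega>. dot d (noise_sum R \<omega>) u) \<in> borel_measurable M" for u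
    unfolding dot_noise_sum using R(1) by (intro borel_measurable_sum dot_measurable) auto
  define B where "B = (\<lambda>u. {\<omega>\<in>space M. t \<le> dot d (noise_sum R \<omega>) u})"
  have Bm: "B u \<in> events" for u
    unfolding B_def using dm[of u] by measurable
  have one: "prob (B u) \<le> exp (- (6 * real d + q))" if u: "u \<in> net d" for u
  proof -
    \<comment> \<open>Minimizes \<open>r * K\<^sup>2 * s\<^sup>2 - s * t\<close>, with minimum
      \<open>- t\<^sup>2 / (4 * r * K\<^sup>2)\<close>.\<close>
    define s where "s = t / (2 * r * K\<^sup>2)"
    have s: "0 < s" using t r K_pos by (simp add: s_def)
    have "K\<^sup>2 * s\<^sup>2 * dot d u u \<le> K\<^sup>2 * s\<^sup>2 * 1"
      by (rule mult_left_mono[OF dot_net_le_1[OF u]]) simp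
    then have "K\<^sup>2 * dot d (\<lambda>l. s * u l) (\<lambda>l. s * u l) \<le> K\<^sup>2 * s\<^sup>2"
      unfolding dot_scale_left dot_scale_right by (simp add: power2_eq_square mult_ac)
    then have mgf: "(\<integral>\<^sup>+\<omega>. ennreal (exp (s * dot d (noise_sum R \<omega>) u)) \<partial>M) \<le> ennreal (exp (r * (K\<^sup>2 * s\<^sup>2)))"
      using mgf_sum_le[OF R, of "\<lambda>l. s * u l" "K\<^sup>2 * s\<^sup>2"] s K_pos by (simp add: dot_scale_right)
    have "B u = {\<omega>\<in>space M. s * t \<le> s * dot d (noise_sum R \<omega>) u}"
      using s by (simp add: B_def)
    then have "prob (B u) \<le> exp (r * (K\<^sup>2 * s\<^sup>2)) * exp (- (s * t))"
      using prob_le_nn_integral_exp[OF _ mgf, of "s * t"] dm[of u] by simp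
    also have "\<dots> = exp (- (t\<^sup>2 / (4 * r * K\<^sup>2)))"
      unfolding exp_add[symmetric] using r K_pos
      by (simp add: s_def power2_eq_square field_simps)
    also have "t\<^sup>2 / (4 * r * K\<^sup>2) = 6 * real d + q"
      using r q K_pos by (simp add: t_def power_mult_distrib)
    finally show ?thesis .
  qed
  have "{\<omega>\<in>space M. 4 * K * sqrt (r * (6 * real d + q)) < vnorm d (noise_sum R \<omega>)} \<subseteq> (\<Union>u\<in>net d. B u)"
  proof (rule subsetI)
    fix \<omega> assume "\<omega> \<in> {\<omega>\<in>space M. 4 * K * sqrt (r * (6 * real d + q)) < vnorm d (noise_sum R \<omega>)}"
    then have \<omega>: "\<omega> \<in> space M" "\<not> vnorm d (noise_sum R \<omega>) \<le> 2 * t" by (auto simp: t_def)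
    then obtain u where "u \<in> net d" "\<not> dot d (noise_sum R \<omega>) u \<le> t"
      using vnorm_le_net[of d "noise_sum R \<omega>" t] t by auto
    then have "\<omega> \<in> B u" "u \<in> net d" using \<omega>(1) by (simp_all add: B_def)
    then show "\<omega> \<in> (\<Union>u\<in>net d. B u)" by blast
  qed
  then have "prob {\<omega>\<in>space M. 4 * K * sqrt (r * (6 * real d + q)) < vnorm d (noise_sum R \<omega>)} \<le> prob (\<Union>u\<in>net d. B u)"
    using Bm by (intro finite_measure_mono sets.finite_UN) auto
  also have "\<dots> \<le> (\<Sum>u\<in>net d. prob (B u))"
    using Bm by (intro finite_measure_subadditive_finite) auto
  also have "\<dots> \<le> (\<Sum>u\<in>net d. exp (- (6 * real d + q)))"
    by (intro sum_mono one)
  also have "\<dots> = card (net d) * exp (- (6 * real d + q))" by simp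
  also have "\<dots> \<le> exp (6 * real d) * exp (- (6 * real d + q))"
    by (intro mult_right_mono card_net_le) simp
  also have "\<dots> = exp (- q)" by (simp add: exp_add[symmetric])
  finally show ?thesis .
qed

text \<open>Independence multiplies \<open>n\<close> moments of at most 2, and
  \<open>2 ^ n \<le> exp n\<close>. From the exponent \<open>6 * d + 3 * n\<close>, the net takes
  \<open>6 * d\<close> and this product takes \<open>n\<close>.\<close>

lemma prob_operator_norm_large:
  "prob {\<omega>\<in>space M. \<exists>u\<in>net d. K\<^sup>2 * (6 * real d + 3 * real n) \<le> (\<Sum>i<n. (dot d (g i \<omega>) u)\<^sup>2)} \<le> exp (- (2 * real n))"
proof -
  define B where "B = (\<lambda>u. {\<omega>\<in>space M. 6 * real d + 3 * real n \<le> (\<Sum>i<n. (dot d (g i \<omega>) u)\<^sup>2 / K\<^sup>2)})"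
  have dm: "(\<lambda>\<omega>. \<Sum>i<n. (dot d (g i \<omega>) u)\<^sup>2 / K\<^sup>2) \<in> borel_measurable M" for u
    by (intro borel_measurable_sum borel_measurable_divide borel_measurable_power dot_measurable) auto
  have Bm: "B u \<in> events" for u
    unfolding B_def using dm[of u] by measurable
  have one: "prob (B u) \<le> exp (- (6 * real d + 2 * real n))" if u: "u \<in> net d" for u
  proof -
    have "indep_vars (\<lambda>_. borel) (\<lambda>i \<omega>. ennreal (exp ((dot d (restrict (g i \<omega>) {..<d}) u)\<^sup>2 / K\<^sup>2))) {..<n}"
      by (rule indep_vars_compose2[OF indep]) (use dot_measurable_PiM[of u] in measurable)
    then have ind: "indep_vars (\<lambda>_. borel) (\<lambda>i \<omega>. ennreal (exp ((dot d (g i \<omega>) u)\<^sup>2 / K\<^sup>2))) {..<n}"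
      unfolding dot_restrict .
    have "(\<integral>\<^sup>+\<omega>. ennreal (exp (\<Sum>i<n. (dot d (g i \<omega>) u)\<^sup>2 / K\<^sup>2)) \<partial>M)
        = (\<integral>\<^sup>+\<omega>. (\<Prod>i<n. ennreal (exp ((dot d (g i \<omega>) u)\<^sup>2 / K\<^sup>2))) \<partial>M)"
      by (simp add: exp_sum prod_ennreal)
    also have "\<dots> = (\<Prod>i<n. \<integral>\<^sup>+\<omega>. ennreal (exp ((dot d (g i \<omega>) u)\<^sup>2 / K\<^sup>2)) \<partial>M)"
      by (rule indep_vars_nn_integral[OF _ ind]) simp_all
    also have "\<dots> \<le> (\<Prod>i<n. 2)"
      using dot_net_le_1[OF u] K_pos
      by (intro prod_mono_ennreal exp_square_le_2) (auto simp: mult_left_le)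
    also have "\<dots> = ennreal (2 ^ n)" by (simp add: ennreal_power[symmetric])
    finally have "prob (B u) \<le> 2 ^ n * exp (- (6 * real d + 3 * real n))"
      unfolding B_def by (intro prob_le_nn_integral_exp dm) auto
    also have "\<dots> \<le> exp (real n) * exp (- (6 * real d + 3 * real n))"
    proof (rule mult_right_mono)
      have "(2::real) ^ n \<le> exp 1 ^ n"
        using exp_ge_add_one_self[of "1::real"] by (intro power_mono) auto
      then show "2 ^ n \<le> exp (real n)" by (simp add: exp_of_nat_mult[symmetric])
    qed simp
    also have "\<dots> = exp (- (6 * real d + 2 * real n))" by (simp add: exp_add[symmetric])
    finally show ?thesis .
  qed
  have eq: "{\<omega>\<in>space M. \<exists>u\<in>net d. K\<^sup>2 * (6 * real d + 3 * real n) \<le> (\<Sum>i<n. (dot d (g i \<omega>) u)\<^sup>2)} = (\<Union>u\<in>net d. B u)"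
    using K_pos by (auto simp: B_def sum_divide_distrib[symmetric] pos_le_divide_eq mult.commute)
  have "prob (\<Union>u\<in>net d. B u) \<le> (\<Sum>u\<in>net d. prob (B u))"
    using Bm by (intro finite_measure_subadditive_finite) auto
  also have "\<dots> \<le> (\<Sum>u\<in>net d. exp (- (6 * real d + 2 * real n)))"
    by (intro sum_mono one)
  also have "\<dots> = card (net d) * exp (- (6 * real d + 2 * real n))" by simp
  also have "\<dots> \<le> exp (6 * real d) * exp (- (6 * real d + 2 * real n))"
    by (intro mult_right_mono card_net_le) simp
  also have "\<dots> = exp (- (2 * real n))" by (simp add: exp_add[symmetric])
  finally show ?thesis unfolding eq .
qed

text \<open>Conditionally on the independent vector \<open>noise_sum R\<close>, the inner product is sub-Gaussian with
  scale \<open>K * vnorm d (noise_sum R \<omega>)\<close>; the conditioning is Fubini on the product law.\<close>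

lemma prob_cross_large:
  assumes R: "R \<subseteq> {..<n}" and j: "j < n" "j \<notin> R" and \<rho>: "0 < \<rho>" and q: "0 \<le> q"
  shows "prob {\<omega>\<in>space M. vnorm d (noise_sum R \<omega>) \<le> \<rho> \<and>
    K * \<rho> * sqrt q < \<bar>dot d (g j \<omega>) (noise_sum R \<omega>)\<bar>} \<le> 2 * exp (- q)"
proof -
  let ?P = "PiM {..<d} (\<lambda>_. borel :: real measure)"
  let ?X = "\<lambda>\<omega>. restrict (g j \<omega>) {..<d}"
  let ?Y = "\<lambda>\<omega>. restrict (noise_sum R \<omega>) {..<d}"
  define \<theta> where "\<theta> = K\<^sup>2 * \<rho>\<^sup>2"
  have \<theta>: "0 < \<theta>" using K_pos \<rho> by (simp add: \<theta>_def)
  have "indep_var ?P ((\<lambda>f. f j) \<circ> (\<lambda>\<omega>. restrict (\<lambda>i. restrict (g i \<omega>) {..<d}) {j}))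
      ?P ((\<lambda>f. \<lambda>l\<in>{..<d}. \<Sum>i\<in>R. f i l) \<circ> (\<lambda>\<omega>. restrict (\<lambda>i. restrict (g i \<omega>) {..<d}) R))"
  proof (rule indep_var_compose[OF indep_var_restrict[OF indep]])
    show "(\<lambda>f. f j) \<in> measurable (PiM {j} (\<lambda>_. ?P)) ?P"
      by (rule measurable_component_singleton) simp
    have "(\<lambda>f. \<Sum>i\<in>R. f i l) \<in> borel_measurable (PiM R (\<lambda>_. ?P))" if "l < d" for l
    proof (rule borel_measurable_sum)
      fix i assume "i \<in> R"
      then show "(\<lambda>f. f i l) \<in> borel_measurable (PiM R (\<lambda>_. ?P))"
        using measurable_compose[OF measurable_component_singleton[of i R "\<lambda>_. ?P"]
            measurable_component_singleton[of l "{..<d}" "\<lambda>_. borel"]] that by simp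
    qed
    then show "(\<lambda>f. \<lambda>l\<in>{..<d}. \<Sum>i\<in>R. f i l) \<in> measurable (PiM R (\<lambda>_. ?P)) ?P"
      by (intro measurable_restrict) auto
  qed (use R j in auto)
  moreover have "((\<lambda>f. f j) \<circ> (\<lambda>\<omega>. restrict (\<lambda>i. restrict (g i \<omega>) {..<d}) {j})) = ?X"
    by (simp add: comp_def)
  moreover have "((\<lambda>f. \<lambda>l\<in>{..<d}. \<Sum>i\<in>R. f i l) \<circ> (\<lambda>\<omega>. restrict (\<lambda>i. restrict (g i \<omega>) {..<d}) R)) = ?Y"
    by (auto simp: comp_def noise_sum_def fun_eq_iff restrict_def)
  ultimately have "indep_var ?P ?X ?P ?Y" by simp
  then have rvX[measurable]: "?X \<in> measurable M ?P" and rvY[measurable]: "?Y \<in> measurable M ?P"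
    and distr: "distr M ?P ?X \<Otimes>\<^sub>M distr M ?P ?Y = distr M (?P \<Otimes>\<^sub>M ?P) (\<lambda>\<omega>. (?X \<omega>, ?Y \<omega>))"
    unfolding indep_var_distribution_eq by auto
  \<comment> \<open>The indicator cuts off large values of the second argument, so that the integral
    over the first is at most 2 for every fixed \<open>y\<close>.\<close>
  define F :: "(nat \<Rightarrow> real) \<times> (nat \<Rightarrow> real) \<Rightarrow> ennreal" where
    "F = (\<lambda>(x, y). ennreal (exp ((dot d x y)\<^sup>2 / \<theta>)) * indicator {y. dot d y y \<le> \<rho>\<^sup>2} y)"
  have dotm: "(\<lambda>p. dot d (fst p) (snd p)) \<in> borel_measurable (?P \<Otimes>\<^sub>M ?P)"
    unfolding dot_def
    by (intro borel_measurable_sum borel_measurable_times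
        measurable_compose[OF measurable_fst measurable_component_singleton]
        measurable_compose[OF measurable_snd measurable_component_singleton]) auto
  have dotm2: "(\<lambda>y. dot d y y) \<in> borel_measurable ?P"
    unfolding dot_def by (intro borel_measurable_sum borel_measurable_times measurable_component_singleton) auto
  have Fm: "F \<in> borel_measurable (?P \<Otimes>\<^sub>M ?P)"
  proof -
    have "(\<lambda>p. dot d (snd p) (snd p)) \<in> borel_measurable (?P \<Otimes>\<^sub>M ?P)"
      by (rule measurable_compose[OF measurable_snd dotm2])
    then have "(\<lambda>p. ennreal (exp ((dot d (fst p) (snd p))\<^sup>2 / \<theta>)) * indicator {p. dot d (snd p) (snd p) \<le> \<rho>\<^sup>2} p)
        \<in> borel_measurable (?P \<Otimes>\<^sub>M ?P)"
      using dotm by measurable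
    then show ?thesis by (simp add: F_def case_prod_beta' indicator_def)
  qed
  interpret Y: prob_space "distr M ?P ?Y" by (rule prob_space_distr[OF rvY])
  interpret X: prob_space "distr M ?P ?X" by (rule prob_space_distr[OF rvX])
  interpret XY: pair_sigma_finite "distr M ?P ?X" "distr M ?P ?Y" ..
  have Fm': "F \<in> borel_measurable (distr M ?P ?X \<Otimes>\<^sub>M distr M ?P ?Y)"
    by (subst measurable_cong_sets[OF sets_pair_measure_cong[OF sets_distr sets_distr] refl]) (rule Fm)
  have inner: "(\<integral>\<^sup>+x. F (x, y) \<partial>distr M ?P ?X) \<le> 2" for y
  proof (cases "dot d y y \<le> \<rho>\<^sup>2")
    case True
    have "(\<integral>\<^sup>+x. F (x, y) \<partial>distr M ?P ?X) = (\<integral>\<^sup>+x. ennreal (exp ((dot d x y)\<^sup>2 / \<theta>)) \<partial>distr M ?P ?X)"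
      using True by (simp add: F_def)
    also have "\<dots> = (\<integral>\<^sup>+\<omega>. ennreal (exp ((dot d (?X \<omega>) y)\<^sup>2 / \<theta>)) \<partial>M)"
      by (rule nn_integral_distr[OF rvX]) (use dot_measurable_PiM[of y] in measurable)
    also have "\<dots> \<le> 2"
      unfolding dot_restrict using True \<theta> j
      by (intro exp_square_le_2) (auto simp: \<theta>_def intro!: mult_left_mono)
    finally show ?thesis .
  qed (simp add: F_def)
  have "(\<integral>\<^sup>+\<omega>. F (?X \<omega>, ?Y \<omega>) \<partial>M) = (\<integral>\<^sup>+p. F p \<partial>(distr M ?P ?X \<Otimes>\<^sub>M distr M ?P ?Y))"
    unfolding distr by (rule nn_integral_distr[symmetric]) (use Fm in measurable)
  also have "\<dots> = (\<integral>\<^sup>+y. (\<integral>\<^sup>+x. F (x, y) \<partial>distr M ?P ?X) \<partial>distr M ?P ?Y)"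
    by (rule XY.nn_integral_snd[symmetric]) (rule Fm')
  also have "\<dots> \<le> (\<integral>\<^sup>+y. 2 \<partial>distr M ?P ?Y)"
    by (intro nn_integral_mono inner)
  also have "\<dots> = 2" using Y.emeasure_space_1 by simp
  finally have EF: "(\<integral>\<^sup>+\<omega>. F (?X \<omega>, ?Y \<omega>) \<partial>M) \<le> 2" .
  let ?A = "{\<omega>\<in>space M. vnorm d (noise_sum R \<omega>) \<le> \<rho> \<and> K * \<rho> * sqrt q < \<bar>dot d (g j \<omega>) (noise_sum R \<omega>)\<bar>}"
  have Am: "?A \<in> events"
    using vnorm_noise_sum_measurable[OF R] dot_noise_sum_measurable[OF R j(1)] by measurable
  \<comment> \<open>Markov's inequality in pointwise form: on the event the integrand is at least
    \<open>exp q\<close>.\<close>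
  have ind: "ennreal (exp q) * indicator ?A \<omega> \<le> F (?X \<omega>, ?Y \<omega>)" for \<omega>
  proof (cases "\<omega> \<in> ?A")
    case True
    have d1: "dot d (?X \<omega>) (?Y \<omega>) = dot d (g j \<omega>) (noise_sum R \<omega>)" by (rule dot_cong) auto
    have d2: "dot d (?Y \<omega>) (?Y \<omega>) = dot d (noise_sum R \<omega>) (noise_sum R \<omega>)" by (rule dot_cong) auto
    have "dot d (noise_sum R \<omega>) (noise_sum R \<omega>) \<le> \<rho>\<^sup>2"
      unfolding vnorm_power2[symmetric] using True by (intro power_mono) auto
    moreover have "(K * \<rho> * sqrt q)\<^sup>2 \<le> (dot d (g j \<omega>) (noise_sum R \<omega>))\<^sup>2"
      using True K_pos \<rho> q by (intro abs_le_square_iff[THEN iffD1]) auto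
    then have "q \<le> (dot d (g j \<omega>) (noise_sum R \<omega>))\<^sup>2 / \<theta>"
      using q \<theta> by (simp add: \<theta>_def power_mult_distrib pos_le_divide_eq mult_ac)
    ultimately show ?thesis
      using True by (simp add: F_def d1 d2 ennreal_leI)
  qed simp
  have "ennreal (exp q) * emeasure M ?A = (\<integral>\<^sup>+\<omega>. ennreal (exp q) * indicator ?A \<omega> \<partial>M)"
    using Am by (simp add: nn_integral_cmult_indicator)
  also have "\<dots> \<le> 2"
    by (rule order.trans[OF nn_integral_mono[OF ind] EF])
  finally have "ennreal (exp q * prob ?A) \<le> ennreal 2"
    by (simp add: emeasure_eq_measure ennreal_mult)
  then have "exp q * prob ?A \<le> 2"
    by (subst (asm) ennreal_le_iff) auto
  then show ?thesis by (simp add: exp_minus field_simps)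
qed

text \<open>The maximum over the centers is replaced by a sum, which keeps one variable per point;
  these are independent in \<open>i\<close>, while the \<open>k\<close> terms inside share a noise
  vector. Cauchy-Schwarz over \<open>a\<close> and the bound 2 on the exponential moment control the
  second moment.\<close>

lemma prob_excess_sum_large:
  fixes w :: "nat \<Rightarrow> nat \<Rightarrow> nat \<Rightarrow> real" and L c :: real
  assumes w: "\<And>i a. i < n \<Longrightarrow> a < k \<Longrightarrow> K\<^sup>2 * dot d (w i a) (w i a) \<le> L\<^sup>2"
    and "0 < L" "0 \<le> c" "0 < k" "0 < n"
  shows "prob {\<omega>\<in>space M. 3 * real n * sqrt (2 * (real k * L)\<^sup>2 * exp (- c\<^sup>2 / L\<^sup>2))
      \<le> (\<Sum>i<n. \<Sum>a<k. max 0 (dot d (g i \<omega>) (w i a) - c))} \<le> 1 / (4 * real n)"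
proof -
  define Z where "Z = (\<lambda>i \<omega>. \<Sum>a<k. max 0 (dot d (g i \<omega>) (w i a) - c))"
  define H where "H = (\<lambda>i \<omega>. real k * (\<Sum>a<k. L\<^sup>2 * exp (- c\<^sup>2 / L\<^sup>2) * exp ((dot d (g i \<omega>) (w i a))\<^sup>2 / L\<^sup>2)))"
  have ind: "indep_vars (\<lambda>_. borel) Z {..<n}"
  proof -
    have "indep_vars (\<lambda>_. borel) (\<lambda>i \<omega>. \<Sum>a<k. max 0 (dot d (restrict (g i \<omega>) {..<d}) (w i a) - c)) {..<n}"
      by (rule indep_vars_compose2[OF indep])
        (intro borel_measurable_sum borel_measurable_max borel_measurable_diff dot_measurable_PiM, auto)
    then show ?thesis unfolding dot_restrict Z_def .
  qed
  have Zm: "Z i \<in> borel_measurable M" if "i < n" for i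
    using ind that by (auto simp: indep_vars_def)
  have le: "(Z i \<omega>)\<^sup>2 \<le> H i \<omega>" for i \<omega>
  proof -
    have "(Z i \<omega>)\<^sup>2 \<le> k * (\<Sum>a<k. (max 0 (dot d (g i \<omega>) (w i a) - c))\<^sup>2)"
      using Cauchy_Schwarz_ineq_sum[of "\<lambda>_. 1" "\<lambda>a. max 0 (dot d (g i \<omega>) (w i a) - c)" "{..<k}"]
      by (simp add: Z_def)
    also have "\<dots> \<le> H i \<omega>"
      unfolding H_def using assms by (intro mult_left_mono sum_mono square_positive_part_le_exp) auto
    finally show ?thesis .
  qed
  have Hint: "integrable M (H i)" if "i < n" for i
    unfolding H_def using that w \<open>0 < L\<close>
    by (intro integrable_mult_right Bochner_Integration.integrable_sum expectation_exp_square(1)) auto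
  have HE: "expectation (H i) \<le> 2 * (real k * L)\<^sup>2 * exp (- c\<^sup>2 / L\<^sup>2)" if "i < n" for i
  proof -
    have "expectation (H i) = k * (\<Sum>a<k. L\<^sup>2 * exp (- c\<^sup>2 / L\<^sup>2) * expectation (\<lambda>\<omega>. exp ((dot d (g i \<omega>) (w i a))\<^sup>2 / L\<^sup>2)))"
      unfolding H_def using that w \<open>0 < L\<close>
      by (subst integral_mult_right_zero, subst Bochner_Integration.integral_sum)
        (auto intro!: integrable_mult_right expectation_exp_square(1))
    also have "\<dots> \<le> k * (\<Sum>a<k. L\<^sup>2 * exp (- c\<^sup>2 / L\<^sup>2) * 2)"
      using that w \<open>0 < L\<close> by (intro mult_left_mono sum_mono expectation_exp_square(2)) auto
    also have "\<dots> = 2 * (real k * L)\<^sup>2 * exp (- c\<^sup>2 / L\<^sup>2)"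
      by (simp add: power2_eq_square)
    finally show ?thesis .
  qed
  have Zint: "integrable M (\<lambda>\<omega>. (Z i \<omega>)\<^sup>2)" if "i < n" for i
  proof (rule Bochner_Integration.integrable_bound[OF Hint[OF that]])
    show "(\<lambda>\<omega>. (Z i \<omega>)\<^sup>2) \<in> borel_measurable M"
      using Zm[OF that] by measurable
    show "AE \<omega> in M. norm ((Z i \<omega>)\<^sup>2) \<le> norm (H i \<omega>)"
      using le[of i] by (intro AE_I2) (simp add: order.trans[OF _ abs_ge_self])
  qed
  have "prob {\<omega>\<in>space M. 3 * real n * sqrt (2 * (real k * L)\<^sup>2 * exp (- c\<^sup>2 / L\<^sup>2)) \<le> (\<Sum>i<n. Z i \<omega>)} \<le> 1 / (4 * real n)"
  proof (rule prob_sum_indep_large[OF ind Zint])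
    show "expectation (\<lambda>\<omega>. (Z i \<omega>)\<^sup>2) \<le> 2 * (real k * L)\<^sup>2 * exp (- c\<^sup>2 / L\<^sup>2)" if "i < n" for i
      by (rule order.trans[OF integral_mono[OF Zint[OF that] Hint[OF that] le] HE[OF that]])
  qed (use assms in auto)
  then show ?thesis by (simp add: Z_def)
qed

end

section \<open>The event on which all noise bounds hold\<close>

locale noisy_clustering =
  subgaussian_noise M n d g K + balanced_clustering n k m \<sigma>
  for M :: "'a measure" and n d g K k m \<sigma> +
  assumes n_ge_4: "4 \<le> n" and k_ge_2: "2 \<le> k"
begin

text \<open>The part \<open>6 * d\<close> pays for the net, and \<open>4 * ln n\<close> makes the
  failure probability of one noise sum \<open>1 / n ^ 4\<close>, small enough for a union over the
  \<open>k * n \<le> n\<^sup>2\<close> pairs of a cluster and a point.\<close>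

abbreviation dim_log :: real where
  "dim_log \<equiv> 6 * real d + 4 * ln (real n)"

definition good_noise :: "(nat \<Rightarrow> nat \<Rightarrow> nat \<Rightarrow> real) \<Rightarrow> real \<Rightarrow> real \<Rightarrow> 'a \<Rightarrow> bool" where
  "good_noise w L c \<omega> \<longleftrightarrow>
    (\<forall>u. (\<Sum>i<n. (dot d (g i \<omega>) u)\<^sup>2) \<le> 4 * (K\<^sup>2 * (6 * real d + 3 * real n)) * dot d u u) \<and>
    (\<forall>i<n. vnorm d (g i \<omega>) \<le> 4 * K * sqrt dim_log) \<and>
    (\<forall>b<k. vnorm d (noise_sum (cluster b) \<omega>) \<le> 4 * K * sqrt (real m * dim_log)) \<and>
    (\<forall>j<n. \<forall>a<k. \<bar>\<Sum>i\<in>cluster a - {j}. dot d (g i \<omega>) (g j \<omega>)\<bar>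
       \<le> 8 * K\<^sup>2 * sqrt (real m * dim_log * ln (real n))) \<and>
    (\<Sum>i<n. \<Sum>a<k. max 0 (dot d (g i \<omega>) (w i a) - c)) \<le> 3 * real n * sqrt (2 * (real k * L)\<^sup>2 * exp (- c\<^sup>2 / L\<^sup>2))"

text \<open>In units of \<open>1 / n\<close> the failures cost at most 1 for the operator norm, 1/4
  for single vectors, 1/4 for cluster sums, 1/2 for cross terms and 1/4 for the excess, in total
  less than 4.\<close>

lemma good_event:
  fixes w :: "nat \<Rightarrow> nat \<Rightarrow> nat \<Rightarrow> real" and L c :: real
  assumes w: "\<And>i a. i < n \<Longrightarrow> a < k \<Longrightarrow> K\<^sup>2 * dot d (w i a) (w i a) \<le> L\<^sup>2"
    and "0 < L" "0 \<le> c"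
  shows "\<exists>E\<in>events. prob E \<ge> 1 - 4 / real n \<and> (\<forall>\<omega>\<in>E. good_noise w L c \<omega>)"
proof -
  define q where "q = 4 * ln (real n)"
  define \<rho> where "\<rho> = 4 * K * sqrt (real m * (6 * real d + q))"
  have lnn: "0 < ln (real n)" using n_ge_4 by simp
  have q: "0 < q" using lnn by (simp add: q_def)
  have \<rho>: "0 < \<rho>" using K_pos m_pos q by (simp add: \<rho>_def)
  have exp_q: "exp (- q) = 1 / real n ^ 4"
  proof -
    have "exp q = exp (ln (real n)) ^ 4" unfolding q_def by (subst exp_of_nat_mult[symmetric]) simp
    then show ?thesis using n_ge_4 by (simp add: exp_minus field_simps)
  qed
  have k_le_n: "k \<le> n" using n_eq m_pos by simp
  have clu: "cluster a \<subseteq> {..<n}" for a by (auto simp: cluster_def)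
  have clu_card: "card (cluster a - {j}) \<le> m" if "a < k" for a j
    using card_cluster[OF that] card_mono[of "cluster a" "cluster a - {j}"] by (auto simp: cluster_def[symmetric])
  define B1 where "B1 = {\<omega>\<in>space M. \<exists>u\<in>net d. K\<^sup>2 * (6 * real d + 3 * real n) \<le> (\<Sum>i<n. (dot d (g i \<omega>) u)\<^sup>2)}"
  define b2 where "b2 = (\<lambda>i. {\<omega>\<in>space M. 4 * K * sqrt (1 * (6 * real d + q)) < vnorm d (noise_sum {i} \<omega>)})"
  define b3 where "b3 = (\<lambda>p. {\<omega>\<in>space M. \<rho> < vnorm d (noise_sum (cluster (fst p) - {snd p}) \<omega>)})"
  \<comment> \<open>The norm condition makes \<open>prob_cross_large\<close> applicable; its failure
    is already counted in \<open>b3\<close>.\<close>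
  define b4 where "b4 = (\<lambda>p. {\<omega>\<in>space M. vnorm d (noise_sum (cluster (fst p) - {snd p}) \<omega>) \<le> \<rho> \<and>
      K * \<rho> * sqrt q < \<bar>dot d (g (snd p) \<omega>) (noise_sum (cluster (fst p) - {snd p}) \<omega>)\<bar>})"
  define B5 where "B5 = {\<omega>\<in>space M. 3 * real n * sqrt (2 * (real k * L)\<^sup>2 * exp (- c\<^sup>2 / L\<^sup>2))
      \<le> (\<Sum>i<n. \<Sum>a<k. max 0 (dot d (g i \<omega>) (w i a) - c))}"
  let ?I = "{..<k} \<times> {..<n}"
  define B2 where "B2 = (\<Union>i<n. b2 i)"
  define B3 where "B3 = (\<Union>p\<in>?I. b3 p)"
  define B4 where "B4 = (\<Union>p\<in>?I. b4 p)"
  have m1: "B1 \<in> events"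
  proof -
    have "{\<omega>\<in>space M. K\<^sup>2 * (6 * real d + 3 * real n) \<le> (\<Sum>i<n. (dot d (g i \<omega>) u)\<^sup>2)} \<in> events" for u
    proof -
      have "(\<lambda>\<omega>. \<Sum>i<n. (dot d (g i \<omega>) u)\<^sup>2) \<in> borel_measurable M"
        by (intro borel_measurable_sum borel_measurable_power dot_measurable) auto
      then show ?thesis by measurable
    qed
    then have "(\<Union>u\<in>net d. {\<omega>\<in>space M. K\<^sup>2 * (6 * real d + 3 * real n) \<le> (\<Sum>i<n. (dot d (g i \<omega>) u)\<^sup>2)}) \<in> events"
      by (intro sets.finite_UN) auto
    also have "(\<Union>u\<in>net d. {\<omega>\<in>space M. K\<^sup>2 * (6 * real d + 3 * real n) \<le> (\<Sum>i<n. (dot d (g i \<omega>) u)\<^sup>2)}) = B1"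
      by (auto simp: B1_def)
    finally show ?thesis .
  qed
  have mb2: "b2 i \<in> events" if "i < n" for i
  proof -
    have "(\<lambda>\<omega>. vnorm d (noise_sum {i} \<omega>)) \<in> borel_measurable M"
      using that by (intro vnorm_noise_sum_measurable) simp
    then show ?thesis unfolding b2_def by measurable
  qed
  have vm: "(\<lambda>\<omega>. vnorm d (noise_sum (cluster a - {j}) \<omega>)) \<in> borel_measurable M" for a j
    using clu by (intro vnorm_noise_sum_measurable) auto
  have mb3: "b3 p \<in> events" for p
    unfolding b3_def using vm[of "fst p" "snd p"] by measurable
  have mb4: "b4 p \<in> events" if "p \<in> ?I" for p
  proof -
    have "(\<lambda>\<omega>. dot d (g (snd p) \<omega>) (noise_sum (cluster (fst p) - {snd p}) \<omega>)) \<in> borel_measurable M"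
      using clu that by (intro dot_noise_sum_measurable) auto
    then show ?thesis unfolding b4_def using vm[of "fst p" "snd p"] by measurable
  qed
  have m5: "B5 \<in> events"
  proof -
    have "(\<lambda>\<omega>. \<Sum>i<n. \<Sum>a<k. max 0 (dot d (g i \<omega>) (w i a) - c)) \<in> borel_measurable M"
      by (intro borel_measurable_sum borel_measurable_max borel_measurable_diff dot_measurable) auto
    then show ?thesis unfolding B5_def by measurable
  qed
  have m2: "B2 \<in> events" unfolding B2_def using mb2 by (intro sets.finite_UN) auto
  have m3: "B3 \<in> events" unfolding B3_def using mb3 by (intro sets.finite_UN) auto
  have m4: "B4 \<in> events" unfolding B4_def using mb4 by (intro sets.finite_UN) auto
  have p1: "prob B1 \<le> 1 / real n"
  proof -
    have "prob B1 \<le> exp (- (2 * real n))"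
      unfolding B1_def by (rule prob_operator_norm_large)
    also have "\<dots> \<le> 1 / real n"
    proof -
      have "real n \<le> exp (2 * real n)"
        using exp_ge_add_one_self[of "2 * real n"] by linarith
      then show ?thesis using n_ge_4 by (simp add: exp_minus field_simps)
    qed
    finally show ?thesis .
  qed
  have p2: "prob B2 \<le> real n * (1 / real n ^ 4)"
  proof -
    have "prob B2 \<le> (\<Sum>i<n. prob (b2 i))"
      unfolding B2_def using mb2 by (intro finite_measure_subadditive_finite) auto
    also have "\<dots> \<le> (\<Sum>i<n. exp (- q))"
      unfolding b2_def using q by (intro sum_mono prob_vnorm_noise_sum_large) auto
    finally show ?thesis by (simp add: exp_q)
  qed
  have p3: "prob B3 \<le> real k * real n * (1 / real n ^ 4)"
  proof -
    have "prob B3 \<le> (\<Sum>p\<in>?I. prob (b3 p))"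
      unfolding B3_def using mb3 by (intro finite_measure_subadditive_finite) auto
    also have "\<dots> \<le> (\<Sum>p\<in>?I. exp (- q))"
      unfolding b3_def \<rho>_def using q m_pos clu clu_card by (intro sum_mono prob_vnorm_noise_sum_large) auto
    finally show ?thesis by (simp add: exp_q)
  qed
  have p4: "prob B4 \<le> real k * real n * (2 * (1 / real n ^ 4))"
  proof -
    have "prob B4 \<le> (\<Sum>p\<in>?I. prob (b4 p))"
      unfolding B4_def using mb4 by (intro finite_measure_subadditive_finite) auto
    also have "\<dots> \<le> (\<Sum>p\<in>?I. 2 * exp (- q))"
      unfolding b4_def using q \<rho> clu by (intro sum_mono prob_cross_large) auto
    finally show ?thesis by (simp add: exp_q)
  qed
  have p5: "prob B5 \<le> 1 / (4 * real n)"
    unfolding B5_def using w \<open>0 < L\<close> \<open>0 \<le> c\<close> k_pos n_ge_4 by (intro prob_excess_sum_large) auto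
  define U where "U = B1 \<union> (B2 \<union> (B3 \<union> (B4 \<union> B5)))"
  have mU: "U \<in> events" unfolding U_def using m1 m2 m3 m4 m5 by blast
  have "prob U \<le> prob B1 + (prob B2 + (prob B3 + (prob B4 + prob B5)))"
    unfolding U_def
    by (intro order.trans[OF measure_Un_le add_left_mono] measure_Un_le sets.Un m1 m2 m3 m4 m5)
  also have "\<dots> \<le> 1 / real n + (real n * (1 / real n ^ 4) + (real k * real n * (1 / real n ^ 4)
      + (real k * real n * (2 * (1 / real n ^ 4)) + 1 / (4 * real n))))"
    by (intro add_mono p1 p2 p3 p4 p5)
  also have "\<dots> \<le> 4 / real n"
  proof -
    have a: "real n * (1 / real n ^ 4) \<le> (1/4) * (1 / real n)"
    proof -
      have "real n * (1 / real n ^ 4) = (1 / real n ^ 2) * (1 / real n)"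
        using n_ge_4 by (simp add: power_numeral_reduce)
      also have "\<dots> \<le> (1/4) * (1 / real n)"
      proof (rule mult_right_mono)
        have "real 4 \<le> real n ^ 2" using n_ge_4 self_le_power[of "real n" 2] by linarith
        then show "1 / real n ^ 2 \<le> 1/4" by (simp add: divide_le_eq)
      qed simp
      finally show ?thesis .
    qed
    have b: "real k * real n * (1 / real n ^ 4) \<le> (1/4) * (1 / real n)"
    proof -
      have "real k * real n * (1 / real n ^ 4) \<le> real n * real n * (1 / real n ^ 4)"
        using k_le_n by (intro mult_right_mono) auto
      also have "\<dots> = (1 / real n) * (1 / real n)" using n_ge_4 by (simp add: power_numeral_reduce)
      also have "\<dots> \<le> (1/4) * (1 / real n)" using n_ge_4 by (intro mult_right_mono) (auto simp: field_simps)
      finally show ?thesis .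
    qed
    have "0 \<le> 1 / real n" by simp
    moreover have "real k * real n * (2 * (1 / real n ^ 4)) = 2 * (real k * real n * (1 / real n ^ 4))"
      by simp
    moreover have "1 / (4 * real n) = (1/4) * (1 / real n)" "4 / real n = 4 * (1 / real n)"
      by simp_all
    ultimately show ?thesis using a b by linarith
  qed
  finally have pU: "prob U \<le> 4 / real n" .
  show ?thesis
  proof (intro bexI conjI ballI)
    show "space M - U \<in> events" using mU by blast
    show "1 - 4 / real n \<le> prob (space M - U)"
      using prob_compl[OF mU] pU by simp
    fix \<omega> assume \<omega>: "\<omega> \<in> space M - U"
    then have nb: "\<omega> \<in> space M" "\<omega> \<notin> B1" "\<omega> \<notin> B2" "\<omega> \<notin> B3" "\<omega> \<notin> B4" "\<omega> \<notin> B5" by (auto simp: U_def)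
    show "good_noise w L c \<omega>"
      unfolding good_noise_def
    proof (intro conjI)
      show "\<forall>u. (\<Sum>i<n. (dot d (g i \<omega>) u)\<^sup>2) \<le> 4 * (K\<^sup>2 * (6 * real d + 3 * real n)) * dot d u u"
      proof
        fix u
        show "(\<Sum>i<n. (dot d (g i \<omega>) u)\<^sup>2) \<le> 4 * (K\<^sup>2 * (6 * real d + 3 * real n)) * dot d u u"
        proof (rule operator_norm_le_net)
          fix u assume "u \<in> net d"
          then show "(\<Sum>i<n. (dot d (g i \<omega>) u)\<^sup>2) \<le> K\<^sup>2 * (6 * real d + 3 * real n)"
            using nb(1,2) unfolding B1_def by force
        qed simp
      qed
      show "\<forall>i<n. vnorm d (g i \<omega>) \<le> 4 * K * sqrt dim_log"
      proof (intro allI impI)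
        fix i assume "i < n"
        then have "vnorm d (noise_sum {i} \<omega>) \<le> 4 * K * sqrt (1 * (6 * real d + q))"
          using nb(1,3) unfolding B2_def b2_def by force
        then show "vnorm d (g i \<omega>) \<le> 4 * K * sqrt dim_log"
          by (simp add: noise_sum_def q_def)
      qed
      have n3: "vnorm d (noise_sum (cluster a - {j}) \<omega>) \<le> \<rho>" if "a < k" "j < n" for a j
        using nb(1,4) that unfolding B3_def b3_def by force
      show "\<forall>b<k. vnorm d (noise_sum (cluster b) \<omega>) \<le> 4 * K * sqrt (real m * dim_log)"
      proof (intro allI impI)
        fix b assume b: "b < k"
        \<comment> \<open>The bounds at hand are for cluster sums with one point deleted. A point
          \<open>j\<close> of another cluster, which exists as \<open>k \<ge> 2\<close>, makes the
          deletion void.\<close>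
        define b' where "b' = (if b = 0 then 1 else 0 :: nat)"
        have "b' < k" "b' \<noteq> b" using k_ge_2 by (auto simp: b'_def)
        then have "cluster b' \<noteq> {}"
          using card_cluster[of b'] m_pos unfolding cluster_def[symmetric] by force
        then obtain j where j: "j \<in> cluster b'" by blast
        then have "cluster b - {j} = cluster b" using \<open>b' \<noteq> b\<close> by (auto simp: cluster_def)
        then show "vnorm d (noise_sum (cluster b) \<omega>) \<le> 4 * K * sqrt (real m * dim_log)"
          using n3[OF b, of j] j by (simp add: \<rho>_def q_def cluster_def)
      qed
      show "\<forall>j<n. \<forall>a<k. \<bar>\<Sum>i\<in>cluster a - {j}. dot d (g i \<omega>) (g j \<omega>)\<bar>
         \<le> 8 * K\<^sup>2 * sqrt (real m * dim_log * ln (real n))"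
      proof (intro allI impI)
        fix j a assume ja: "j < n" "a < k"
        have "\<omega> \<notin> b4 (a, j)" using nb(5) ja by (auto simp: B4_def)
        then have "\<bar>dot d (g j \<omega>) (noise_sum (cluster a - {j}) \<omega>)\<bar> \<le> K * \<rho> * sqrt q"
          using nb(1) n3[OF ja(2,1)] by (auto simp: b4_def)
        also have "dot d (g j \<omega>) (noise_sum (cluster a - {j}) \<omega>) = (\<Sum>i\<in>cluster a - {j}. dot d (g i \<omega>) (g j \<omega>))"
          by (subst dot_commute) (rule dot_noise_sum)
        also have "K * \<rho> * sqrt q = 8 * K\<^sup>2 * sqrt (real m * dim_log * ln (real n))"
          by (simp add: \<rho>_def q_def real_sqrt_mult power2_eq_square)
        finally show "\<bar>\<Sum>i\<in>cluster a - {j}. dot d (g i \<omega>) (g j \<omega>)\<bar>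
            \<le> 8 * K\<^sup>2 * sqrt (real m * dim_log * ln (real n))" .
      qed
      show "(\<Sum>i<n. \<Sum>a<k. max 0 (dot d (g i \<omega>) (w i a) - c)) \<le> 3 * real n * sqrt (2 * (real k * L)\<^sup>2 * exp (- c\<^sup>2 / L\<^sup>2))"
        using nb(1,6) unfolding B5_def by force
    qed
  qed
qed

end

section \<open>Center estimates\<close>

text \<open>Apply \<open>u\<^sup>2 / 2 \<le> exp u\<close> at
  \<open>u = x / (2 * A)\<close>.\<close>

lemma square_mult_exp_le:
  fixes x A :: real
  assumes "0 \<le> x" "0 < A"
  shows "x\<^sup>2 * exp (- x / A) \<le> 8 * A\<^sup>2 * exp (- x / (2 * A))"
proof -
  have "(x / (2 * A))\<^sup>2 / 2 \<le> exp (x / (2 * A))"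
    using exp_lower_Taylor_quadratic[of "x / (2 * A)"] assms by (smt (verit) divide_nonneg_nonneg)
  then have "x\<^sup>2 \<le> 8 * A\<^sup>2 * exp (x / (2 * A))"
    using assms by (simp add: power_divide power_mult_distrib field_simps)
  then have "x\<^sup>2 * exp (- x / A) \<le> 8 * A\<^sup>2 * exp (x / (2 * A)) * exp (- x / A)"
    by (rule mult_right_mono) simp
  also have "\<dots> = 8 * A\<^sup>2 * exp (- x / (2 * A))"
    using assms by (simp add: mult.assoc exp_add[symmetric] field_simps)
  finally show ?thesis .
qed

text \<open>The exponent \<open>x / (8192 * Cq\<^sup>2)\<close> is half of \<open>c\<^sup>2 / L\<^sup>2\<close> for the threshold \<open>c = \<Delta>\<^sup>2 / 32\<close> and the
  sub-Gaussian scale \<open>L = 2 * \<tau> * Cq * \<Delta>\<close>; half of it is spent on absorbing the factor \<open>k\<^sup>2 \<le> x\<^sup>2\<close>.\<close>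

definition center_const :: "real \<Rightarrow> real" where
  "center_const Cq = 24 + 1872 * Cq * (Cq + 48) * (8 * (8192 * Cq\<^sup>2)\<^sup>2)"

context noisy_clustering
begin

text \<open>Lets a logarithm be absorbed into the summand \<open>k\<close> of the signal-to-noise
  condition: \<open>ln m \<le> 2 * sqrt m\<close> and \<open>ln k \<le> k - 1\<close>.\<close>

lemma ln_n_le: "ln (real n) \<le> 2 * real k * sqrt (real m)"
proof -
  have sm: "1 \<le> sqrt (real m)" using m_pos by simp
  have "ln (real m) \<le> 2 * sqrt (real m)"
    using ln_sqrt[of "real m"] ln_le_minus_one[of "sqrt (real m)"] m_pos by simp
  moreover have "ln (real k) \<le> (real k - 1) * sqrt (real m)"
    using ln_le_minus_one[of "real k"] k_pos mult_left_mono[OF sm, of "real k - 1"] by simp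
  moreover have "ln (real n) = ln (real m) + ln (real k)"
    using n_eq m_pos k_pos by (simp add: ln_mult)
  ultimately have "ln (real n) \<le> (real k + 1) * sqrt (real m)"
    by (simp add: algebra_simps)
  also have "\<dots> \<le> (2 * real k) * sqrt (real m)"
    using k_pos by (intro mult_right_mono) auto
  finally show ?thesis by simp
qed

text \<open>After division by \<open>m\<close>, the part with \<open>d\<close> is a multiple of the
  first term of the signal-to-noise condition, as \<open>d / m = k * d / n\<close>; the part with
  the squared logarithm becomes a multiple of \<open>k\<close> by \<open>ln_n_le\<close>.\<close>

lemma cross_bound_le:
  "sqrt (real m * dim_log * ln (real n)) \<le> real m * (3 * sqrt (real d / real m * ln (real n)) + 4 * real k)"
proof -
  define l where "l = ln (real n)"
  have l: "0 \<le> l" using n_ge_4 by (simp add: l_def)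
  have "sqrt (real m * dim_log * l) = sqrt (6 * (real m * real d * l) + 4 * real m * l\<^sup>2)"
    by (simp add: l_def algebra_simps power2_eq_square)
  also have "\<dots> \<le> sqrt (6 * (real m * real d * l)) + sqrt (4 * real m * l\<^sup>2)"
    using l by (intro sqrt_add_le_add_sqrt) auto
  also have "sqrt (6 * (real m * real d * l)) \<le> sqrt (9 * (real m * real d * l))"
    using l by (intro real_sqrt_le_mono mult_right_mono) auto
  also have "\<dots> = 3 * sqrt (real m * real d * l)"
    by (simp add: real_sqrt_mult real_sqrt_eq_iff)
  also have "real m * real d * l = (real m)\<^sup>2 * (real d / real m * l)"
    using m_pos by (simp add: power2_eq_square)
  also have "sqrt \<dots> = real m * sqrt (real d / real m * l)"
    by (subst real_sqrt_mult) simp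
  also have "sqrt (4 * real m * l\<^sup>2) = 2 * sqrt (real m) * l"
    using l by (simp add: real_sqrt_mult)
  also have "\<dots> \<le> 2 * sqrt (real m) * (2 * real k * sqrt (real m))"
    unfolding l_def by (intro mult_left_mono ln_n_le) simp
  also have "\<dots> = 4 * real k * real m" by simp
  finally show ?thesis by (simp add: l_def algebra_simps)
qed

text \<open>The diameter bound enters twice: in the sub-Gaussian scale \<open>L\<close> of the
  projections onto center differences, and in the shift of a center estimate caused by misplaced
  points.\<close>

lemma center_estimates:
  fixes \<mu> :: "nat \<Rightarrow> nat \<Rightarrow> real" and \<tau> Cq D :: real
  assumes K: "K = 2 * \<tau>" and Cq: "0 < Cq" and D: "0 < D"
    and sep: "\<And>a b. a < k \<Longrightarrow> b < k \<Longrightarrow> a \<noteq> b \<Longrightarrow> D \<le> Delta_ab d \<mu> a b"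
    and diam: "\<And>a b. a < k \<Longrightarrow> b < k \<Longrightarrow> Delta_ab d \<mu> a b \<le> Cq * D"
    and snr: "20000 * (sqrt (real d / real m * ln (real n)) + real d / real m + real k) \<le> (D / \<tau>)\<^sup>2"
  shows "\<exists>E\<in>events. prob E \<ge> 1 - 4 / real n \<and> (\<forall>\<omega>\<in>E. \<forall>Y \<sigma>h.
    sdp_minimizer n k (dist_matrix d (\<lambda>i l. \<mu> (\<sigma> i) l + g i \<omega> l)) Y \<longrightarrow> rounding_output n k Y \<sigma>h \<longrightarrow>
    (\<forall>a<k. \<exists>b<k. vnorm d (vdiff (center_est n k (\<lambda>i l. \<mu> (\<sigma> i) l + g i \<omega> l) \<sigma>h a) (\<mu> b))
      \<le> center_const Cq * \<tau> * (sqrt ((real d + ln (real n)) / real m)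
        + sqrt (real d + ln (real n)) * exp (- (D / \<tau>)\<^sup>2 / (16384 * Cq\<^sup>2)))))"
proof -
  have \<tau>: "0 < \<tau>" using K_pos K by simp
  define x where "x = (D / \<tau>)\<^sup>2"
  define A where "A = 8192 * Cq\<^sup>2"
  define \<epsilon> where "\<epsilon> = exp (- x / A)"
  define L where "L = 2 * \<tau> * Cq * D"
  define c where "c = D\<^sup>2 / 32"
  define \<Lambda> where "\<Lambda> = sqrt (real d + ln (real n))"
  have A: "0 < A" using Cq by (simp add: A_def)
  have L: "0 < L" using \<tau> Cq D by (simp add: L_def)
  have D2: "D\<^sup>2 = \<tau>\<^sup>2 * x" using \<tau> by (simp add: x_def power_divide)
  have lnn: "0 < ln (real n)" using n_ge_4 by simp
  define p where "p = sqrt (real d / real m * ln (real n))"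
  define r where "r = real d / real m"
  have nn: "0 \<le> p" "0 \<le> r" "1 \<le> real k"
    using lnn k_pos by (auto simp: p_def r_def intro!: mult_nonneg_nonneg)
  have snr': "20000 * (p + r + real k) \<le> x"
    using snr unfolding p_def r_def x_def .
  have kx: "real k \<le> x" and x1: "1 \<le> x"
    using snr' nn unfolding distrib_left by linarith+
  have DT: "\<tau> \<le> D"
  proof -
    have "1 \<le> D / \<tau>"
      using x1 \<tau> D unfolding x_def by (metis abs_of_pos divide_pos_pos one_power2 abs_le_square_iff abs_one)
    then show ?thesis using \<tau> by (simp add: field_simps)
  qed
  \<comment> \<open>Through this the shift caused by misplaced points, which carries no dimension,
    fits under the same factor \<open>\<Lambda>\<close> as the noise norms.\<close>
  have Lambda1: "1 \<le> \<Lambda>"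
  proof -
    have "exp 1 \<le> real n"
      using exp_bound[of "1::real"] n_ge_4 by simp
    then have "1 \<le> ln (real n)" using n_ge_4 by (subst ln_ge_iff) auto
    then show ?thesis by (simp add: \<Lambda>_def)
  qed
  have sqrt_dim_log: "sqrt dim_log \<le> 3 * \<Lambda>"
  proof -
    have "sqrt dim_log \<le> sqrt (9 * (real d + ln (real n)))"
      using lnn by (intro real_sqrt_le_mono) simp
    also have "\<dots> = 3 * \<Lambda>" by (simp only: real_sqrt_mult \<Lambda>_def) simp
    finally show ?thesis .
  qed
  have w: "K\<^sup>2 * dot d (vdiff (\<mu> a) (\<mu> (\<sigma> i))) (vdiff (\<mu> a) (\<mu> (\<sigma> i))) \<le> L\<^sup>2" if "i < n" "a < k" for i a
  proof -
    have "(Delta_ab d \<mu> a (\<sigma> i))\<^sup>2 \<le> (Cq * D)\<^sup>2"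
      using diam[OF that(2) label[OF that(1)]] by (intro power_mono) (auto simp: Delta_ab_def)
    then have "K\<^sup>2 * (Delta_ab d \<mu> a (\<sigma> i))\<^sup>2 \<le> K\<^sup>2 * (Cq * D)\<^sup>2"
      by (rule mult_left_mono) simp
    then show ?thesis
      by (simp add: Delta_ab_def vnorm_power2 L_def K power_mult_distrib mult.assoc)
  qed
  have c0: "0 \<le> c" by (simp add: c_def)
  obtain E where E: "E \<in> events" "prob E \<ge> 1 - 4 / real n"
    and good: "\<And>\<omega>. \<omega> \<in> E \<Longrightarrow> good_noise (\<lambda>i a. vdiff (\<mu> a) (\<mu> (\<sigma> i))) L c \<omega>"
    using good_event[of "\<lambda>i a. vdiff (\<mu> a) (\<mu> (\<sigma> i))" L c] w L c0 by blast
  have op: "(\<Sum>i<n. (dot d (g i \<omega>) u)\<^sup>2) \<le> 4 * (K\<^sup>2 * (6 * real d + 3 * real n)) * dot d u u" if "\<omega> \<in> E" for \<omega> u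
    using good[OF that] by (simp add: good_noise_def)
  have gn: "vnorm d (g i \<omega>) \<le> 4 * K * sqrt dim_log" if "\<omega> \<in> E" "i < n" for \<omega> i
    using good[OF that(1)] that(2) by (simp add: good_noise_def)
  have S: "vnorm d (noise_sum (cluster b) \<omega>) \<le> 4 * K * sqrt (real m * dim_log)" if "\<omega> \<in> E" "b < k" for \<omega> b
    using good[OF that(1)] that(2) by (simp add: good_noise_def)
  have cross: "\<bar>\<Sum>i\<in>cluster a - {j}. dot d (g i \<omega>) (g j \<omega>)\<bar> \<le> 8 * K\<^sup>2 * sqrt (real m * dim_log * ln (real n))"
    if "\<omega> \<in> E" "j < n" "a < k" for \<omega> j a
    using good[OF that(1)] that(2,3) by (simp add: good_noise_def)
  have Zs: "(\<Sum>i<n. \<Sum>a<k. max 0 (dot d (g i \<omega>) (vdiff (\<mu> a) (\<mu> (\<sigma> i))) - c))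
      \<le> 3 * real n * sqrt (2 * (real k * L)\<^sup>2 * exp (- c\<^sup>2 / L\<^sup>2))" if "\<omega> \<in> E" for \<omega>
    using good[OF that] unfolding good_noise_def by (elim conjE)
  define lam where "lam = 4 * (K\<^sup>2 * (6 * real d + 3 * real n))"
  define t where "t = 8 * K\<^sup>2 * sqrt (real m * dim_log * ln (real n))"
  have m0: "0 < real m" using m_pos by simp
  have lam_m: "lam / m \<le> D\<^sup>2 / 16"
  proof -
    have "lam / m = \<tau>\<^sup>2 * (96 * r + 48 * real k)"
      using m_pos n_eq by (simp add: lam_def K r_def field_simps power2_eq_square)
    also have "\<dots> \<le> \<tau>\<^sup>2 * (x / 16)"
      using snr' nn by (intro mult_left_mono) auto
    finally show ?thesis by (simp add: D2)
  qed
  \<comment> \<open>The cross terms set the requirement on 20000: the largest coefficient is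
    \<open>192 * 4 = 768\<close>, and 16 times it is 12288.\<close>
  have t_m: "6 * t / m \<le> D\<^sup>2 / 16"
  proof -
    have "6 * t \<le> 6 * (8 * K\<^sup>2 * (real m * (3 * p + 4 * real k)))"
      unfolding t_def p_def by (intro mult_left_mono cross_bound_le) auto
    also have "\<dots> = \<tau>\<^sup>2 * (192 * (3 * p + 4 * real k)) * real m"
      by (simp add: K power_mult_distrib algebra_simps)
    finally have "6 * t / m \<le> \<tau>\<^sup>2 * (192 * (3 * p + 4 * real k))"
      using m0 by (simp only: pos_divide_le_eq)
    also have "\<dots> \<le> \<tau>\<^sup>2 * (x / 16)"
      using snr' nn by (intro mult_left_mono) auto
    finally show ?thesis by (simp add: D2)
  qed
  have sqrt_eps: "sqrt (2 * (real k * L)\<^sup>2 * exp (- c\<^sup>2 / L\<^sup>2)) \<le> 3 * real k * \<tau> * Cq * D * \<epsilon>"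
  proof -
    have "c\<^sup>2 / L\<^sup>2 = 2 * (x / A)"
      using \<tau> Cq D by (simp add: c_def L_def x_def A_def power2_eq_square field_simps)
    then have e: "exp (- c\<^sup>2 / L\<^sup>2) = \<epsilon>\<^sup>2"
      by (simp add: \<epsilon>_def power2_eq_square exp_add[symmetric])
    have "2 * (real k * L)\<^sup>2 * \<epsilon>\<^sup>2 \<le> (3 * real k * \<tau> * Cq * D * \<epsilon>)\<^sup>2"
      by (simp add: L_def power_mult_distrib mult_right_mono)
    then have "sqrt (2 * (real k * L)\<^sup>2 * \<epsilon>\<^sup>2) \<le> \<bar>3 * real k * \<tau> * Cq * D * \<epsilon>\<bar>"
      by (metis real_sqrt_abs real_sqrt_le_mono)
    also have "\<dots> = 3 * real k * \<tau> * Cq * D * \<epsilon>"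
      using \<tau> Cq D by (intro abs_of_nonneg) (simp add: \<epsilon>_def)
    finally show ?thesis unfolding e .
  qed
  have final_eps: "(real k)\<^sup>2 * \<epsilon> \<le> 8 * A\<^sup>2 * exp (- x / (2 * A))"
  proof -
    have "(real k)\<^sup>2 * \<epsilon> \<le> x\<^sup>2 * \<epsilon>"
      using kx by (intro mult_right_mono power_mono) (auto simp: \<epsilon>_def)
    also have "\<dots> \<le> 8 * A\<^sup>2 * exp (- x / (2 * A))"
      unfolding \<epsilon>_def using x1 A by (intro square_mult_exp_le) auto
    finally show ?thesis .
  qed
  have main: "\<exists>b<k. vnorm d (vdiff (center_est n k (\<lambda>i l. \<mu> (\<sigma> i) l + g i \<omega> l) \<sigma>h a) (\<mu> b))
      \<le> center_const Cq * \<tau> * (sqrt ((real d + ln (real n)) / real m) + \<Lambda> * exp (- x / (2 * A)))"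
    if \<omega>: "\<omega> \<in> E" and Y: "sdp_minimizer n k (dist_matrix d (\<lambda>i l. \<mu> (\<sigma> i) l + g i \<omega> l)) Y"
      and rd: "rounding_output n k Y \<sigma>h" and a: "a < k" for \<omega> Y \<sigma>h a
  proof -
    define Z where "Z = (\<lambda>i. \<Sum>a<k. max 0 (dot d (g i \<omega>) (vdiff (\<mu> a) (\<mu> (\<sigma> i))) - c))"
    have Z0: "0 \<le> Z i" for i unfolding Z_def by (intro sum_nonneg) simp
    have Zi: "dot d (vdiff (\<mu> a) (\<mu> (\<sigma> i))) (g i \<omega>) \<le> c + Z i" if "a < k" for i a
    proof -
      have "max 0 (dot d (g i \<omega>) (vdiff (\<mu> a) (\<mu> (\<sigma> i))) - c) \<le> Z i"
        unfolding Z_def using that by (intro member_le_sum[of a "{..<k}" "\<lambda>a. max 0 (dot d (g i \<omega>) (vdiff (\<mu> a) (\<mu> (\<sigma> i))) - c)"]) auto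
      then show ?thesis by (simp add: dot_commute)
    qed
    define \<gamma> where "\<gamma> = sdp_err Y"
    have \<gamma>0: "0 \<le> \<gamma>" by (simp add: \<gamma>_def sdp_err_nonneg)
    have "D\<^sup>2 * \<gamma> / 2 \<le> 2 * c * \<gamma> + 4 * m * (\<Sum>i<n. Z i) + lam * \<gamma> / m + 6 * t * \<gamma> / m"
      unfolding \<gamma>_def
    proof (rule sdp_error_inequality[OF Y sep _ Zi Z0])
      show "(\<Sum>i<n. (dot d (g i \<omega>) u)\<^sup>2) \<le> lam * dot d u u" for u
        unfolding lam_def by (rule op[OF \<omega>])
      show "\<bar>\<Sum>i\<in>cluster a - {j}. dot d (g i \<omega>) (g j \<omega>)\<bar> \<le> t" if "j < n" "a < k" for j a
        unfolding t_def by (rule cross[OF \<omega> that])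
      show "0 \<le> lam" by (simp add: lam_def)
    qed (use D in auto)
    also have "lam * \<gamma> / m = lam / m * \<gamma>" by simp
    also have "\<dots> \<le> D\<^sup>2 / 16 * \<gamma>" by (rule mult_right_mono[OF lam_m \<gamma>0])
    also have "6 * t * \<gamma> / m = 6 * t / m * \<gamma>" by simp
    also have "\<dots> \<le> D\<^sup>2 / 16 * \<gamma>" by (rule mult_right_mono[OF t_m \<gamma>0])
    finally have h: "D\<^sup>2 * \<gamma> / 2 \<le> 2 * c * \<gamma> + 4 * real m * (\<Sum>i<n. Z i) + D\<^sup>2 / 16 * \<gamma> + D\<^sup>2 / 16 * \<gamma>"
      by simp
    \<comment> \<open>Three terms of \<open>D\<^sup>2 * \<gamma> / 16\<close> leave 5/16 of
      \<open>D\<^sup>2 * \<gamma>\<close> against 4 times the excess, and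
      \<open>64 / 5 \<le> 13\<close>.\<close>
    have "D\<^sup>2 * \<gamma> \<le> 13 * (real m * (\<Sum>i<n. Z i))"
    proof -
      have "0 \<le> real m * (\<Sum>i<n. Z i)" using Z0 by (intro mult_nonneg_nonneg sum_nonneg) auto
      moreover have "2 * c * \<gamma> = D\<^sup>2 * \<gamma> / 16" by (simp add: c_def)
      moreover have "4 * real m * (\<Sum>i<n. Z i) = 4 * (real m * (\<Sum>i<n. Z i))" by simp
      moreover have "D\<^sup>2 / 16 * \<gamma> = D\<^sup>2 * \<gamma> / 16" by simp
      ultimately show ?thesis using h by linarith
    qed
    also have "(\<Sum>i<n. Z i) \<le> 3 * real n * (3 * real k * \<tau> * Cq * D * \<epsilon>)"
      using Zs[OF \<omega>] mult_left_mono[OF sqrt_eps, of "3 * real n"] unfolding Z_def by linarith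
    finally have "D\<^sup>2 * \<gamma> \<le> 13 * (m * (3 * real n * (3 * real k * \<tau> * Cq * D * \<epsilon>)))"
      using m_pos by simp
    then have "D * (D * \<gamma>) \<le> D * (117 * real m * real n * real k * \<tau> * Cq * \<epsilon>)"
      by (simp add: power2_eq_square mult_ac)
    then have "D * \<gamma> \<le> 117 * real m * real n * real k * \<tau> * Cq * \<epsilon>"
      using D by (simp only: mult_le_cancel_left_pos)
    \<comment> \<open>One factor \<open>k\<close> stems from the sum over the centers in the excess,
      the other from \<open>n = m * k\<close>; 1872 is \<open>16 * 117\<close>.\<close>
    then have "16 * \<gamma> / m \<le> m * (1872 * (real k)\<^sup>2 * Cq * \<epsilon> * (\<tau> / D))"
      using D m_pos n_eq by (simp add: field_simps power2_eq_square)
    moreover define \<rho> where "\<rho> = 1872 * (real k)\<^sup>2 * Cq * \<epsilon> * (\<tau> / D)"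
    ultimately have \<gamma>_le: "16 * \<gamma> / m \<le> m * \<rho>" by simp
    obtain b where b: "b < k" "real (card ({i. i < n \<and> \<sigma>h i = a} - cluster b)) \<le> 16 * sdp_err Y / m"
      using rounding_error[OF rd a] by blast
    have cC: "card {i. i < n \<and> \<sigma>h i = a} = m"
      using rd a n_div_k unfolding rounding_output_def by auto
    have "vnorm d (vdiff (center_est n k (\<lambda>i l. \<mu> (\<sigma> i) l + g i \<omega> l) \<sigma>h a) (\<mu> b))
        \<le> (m * \<rho> * (Cq * D) + 4 * K * sqrt (real m * dim_log) + 2 * (m * \<rho>) * (4 * K * sqrt dim_log)) / m"
    proof (rule center_est_error[OF b(1) cC])
      show "real (card ({i. i < n \<and> \<sigma>h i = a} - cluster b)) \<le> m * \<rho>"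
        using b(2) \<gamma>_le unfolding \<gamma>_def by linarith
      show "vnorm d (\<lambda>l. \<Sum>i\<in>cluster b. g i \<omega> l) \<le> 4 * K * sqrt (real m * dim_log)"
        using S[OF \<omega> b(1)] by (simp add: noise_sum_def)
    qed (use diam gn[OF \<omega>] in auto)
    also have "\<dots> = \<rho> * (Cq * D) + 8 * \<tau> * (sqrt (real m * dim_log) / m) + 16 * \<tau> * \<rho> * sqrt dim_log"
      using m_pos by (simp add: K field_simps)
    also have "\<dots> \<le> 1872 * (real k)\<^sup>2 * \<epsilon> * Cq * Cq * \<tau> * \<Lambda>
        + 24 * \<tau> * sqrt ((real d + ln (real n)) / real m) + 1872 * (real k)\<^sup>2 * \<epsilon> * Cq * 48 * \<tau> * \<Lambda>"
    proof (intro add_mono)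
      \<comment> \<open>The separation cancels: the bound on the misplaced fraction carries
        \<open>\<tau> / D\<close>, and each misplaced point contributes a shift of at most
        \<open>Cq * D\<close>.\<close>
      have "\<rho> * (Cq * D) = 1872 * (real k)\<^sup>2 * \<epsilon> * Cq * Cq * \<tau> * 1"
        using D by (simp add: \<rho>_def)
      also have "\<dots> \<le> 1872 * (real k)\<^sup>2 * \<epsilon> * Cq * Cq * \<tau> * \<Lambda>"
        using Cq \<tau> by (intro mult_left_mono Lambda1) (simp add: \<epsilon>_def)
      finally show "\<rho> * (Cq * D) \<le> 1872 * (real k)\<^sup>2 * \<epsilon> * Cq * Cq * \<tau> * \<Lambda>" .
      have "sqrt (real m * dim_log) / m = sqrt dim_log / sqrt m"
        using m_pos by (simp add: real_sqrt_mult real_div_sqrt divide_simps)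
      also have "\<dots> \<le> 3 * \<Lambda> / sqrt m"
        by (intro divide_right_mono sqrt_dim_log) simp
      finally have "8 * \<tau> * (sqrt (real m * dim_log) / m) \<le> 8 * \<tau> * (3 * \<Lambda> / sqrt m)"
        using \<tau> by (intro mult_left_mono) auto
      also have "\<dots> = 24 * \<tau> * sqrt ((real d + ln (real n)) / real m)"
        by (simp add: \<Lambda>_def real_sqrt_divide)
      finally show "8 * \<tau> * (sqrt (real m * dim_log) / m) \<le> 24 * \<tau> * sqrt ((real d + ln (real n)) / real m)" .
      have \<rho>le: "\<rho> \<le> 1872 * (real k)\<^sup>2 * \<epsilon> * Cq"
      proof -
        have "\<tau> / D \<le> 1" using DT D by simp
        then have "(1872 * (real k)\<^sup>2 * Cq * \<epsilon>) * (\<tau> / D) \<le> (1872 * (real k)\<^sup>2 * Cq * \<epsilon>) * 1"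
          using Cq by (intro mult_left_mono) (auto simp: \<epsilon>_def)
        then show ?thesis by (simp add: \<rho>_def mult_ac)
      qed
      have "16 * \<tau> * \<rho> * sqrt dim_log \<le> 16 * \<tau> * (1872 * (real k)\<^sup>2 * \<epsilon> * Cq) * (3 * \<Lambda>)"
        using \<tau> Cq Lambda1 lnn by (intro mult_mono mult_left_mono \<rho>le sqrt_dim_log) (auto simp: \<epsilon>_def)
      then show "16 * \<tau> * \<rho> * sqrt dim_log \<le> 1872 * (real k)\<^sup>2 * \<epsilon> * Cq * 48 * \<tau> * \<Lambda>"
        by (simp add: mult_ac)
    qed
    also have "\<dots> = 24 * \<tau> * sqrt ((real d + ln (real n)) / real m)
        + 1872 * Cq * (Cq + 48) * \<tau> * \<Lambda> * ((real k)\<^sup>2 * \<epsilon>)"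
      by (simp add: algebra_simps)
    also have "\<dots> \<le> 24 * \<tau> * sqrt ((real d + ln (real n)) / real m)
        + 1872 * Cq * (Cq + 48) * \<tau> * \<Lambda> * (8 * A\<^sup>2 * exp (- x / (2 * A)))"
      using Cq \<tau> Lambda1 by (intro add_left_mono mult_left_mono final_eps) auto
    also have "\<dots> \<le> center_const Cq * \<tau> * (sqrt ((real d + ln (real n)) / real m) + \<Lambda> * exp (- x / (2 * A)))"
    proof -
      define P where "P = 1872 * Cq * (Cq + 48) * (8 * A\<^sup>2)"
      define u where "u = sqrt ((real d + ln (real n)) / real m)"
      define v where "v = \<Lambda> * exp (- x / (2 * A))"
      have "0 \<le> P" using Cq by (simp add: P_def)
      moreover have "0 \<le> u" "0 \<le> v" using lnn Lambda1 by (auto simp: u_def v_def)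
      ultimately have "0 \<le> \<tau> * (P * u)" "0 \<le> \<tau> * (24 * v)" using \<tau> by auto
      moreover have "center_const Cq = 24 + P" by (simp add: center_const_def P_def A_def)
      ultimately show ?thesis
        unfolding u_def[symmetric] by (simp add: algebra_simps P_def v_def)
    qed
    finally show ?thesis using b(1) by blast
  qed
  have "16384 * Cq\<^sup>2 = 2 * A" by (simp add: A_def)
  then show ?thesis
    using E main unfolding \<Lambda>_def x_def by (intro bexI[of _ E] conjI ballI allI impI) auto
qed

end

theorem theorem6:
  fixes Cq :: real
  assumes "Cq > 0"
  shows "\<exists>Cs Cm Ce :: real. Cs > 0 \<and> Cm > 0 \<and> Ce > 0 \<and>
   (\<forall>(M :: 'a measure) (n :: nat) (k :: nat) (d :: nat) (\<mu> :: nat \<Rightarrow> nat \<Rightarrow> real)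
      (\<sigma>star :: nat \<Rightarrow> nat) (g :: nat \<Rightarrow> 'a \<Rightarrow> nat \<Rightarrow> real) (\<tau> :: real)
      (\<sigma>hat :: 'a \<Rightarrow> nat \<Rightarrow> nat).
     let h = (\<lambda>\<omega> i. \<lambda>j. \<mu> (\<sigma>star i) j + g i \<omega> j);
         \<Delta> = Delta_min k d \<mu>;
         s = \<Delta> / \<tau>
     in
     prob_space M \<and> n \<ge> 4 \<and> k \<ge> 2 \<and> k dvd n \<and> \<tau> > 0 \<and>
     (\<forall>i<n. \<sigma>star i < k) \<and> (\<forall>a<k. card {i. i < n \<and> \<sigma>star i = a} = n div k) \<and>
     prob_space.indep_vars M (\<lambda>_. PiM {..<d} (\<lambda>_. borel)) (\<lambda>i \<omega>. restrict (g i \<omega>) {..<d}) {..<n} \<and>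
     (\<forall>i<n. \<forall>j<d. integrable M (\<lambda>\<omega>. g i \<omega> j) \<and> (\<integral>\<omega>. g i \<omega> j \<partial>M) = 0) \<and>
     (\<forall>i<n. psi2_vec M d (g i) \<le> ereal \<tau>) \<and>
     (\<forall>a<k. \<forall>b<k. Delta_ab d \<mu> a b \<le> Cq * \<Delta>) \<and>
     s\<^sup>2 \<ge> Cs * (sqrt (real k * real d / real n * ln (real n)) + real k * real d / real n + real k) \<and>
     (\<forall>\<omega>\<in>space M. \<exists>Y. sdp_minimizer n k (dist_matrix d (h \<omega>)) Y \<and> rounding_output n k Y (\<sigma>hat \<omega>))
     \<longrightarrow>
     (\<exists>E \<in> sets M. measure M E \<ge> 1 - 4 / real n \<and>
        (\<forall>\<omega>\<in>E. Max ((\<lambda>a. Min ((\<lambda>\<pi>. vnorm d (vdiff (center_est n k (h \<omega>) (\<sigma>hat \<omega>) a) (\<mu> (\<pi> a))))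
                                  ` {\<pi>. \<pi> permutes {..<k}})) ` {..<k})
              \<le> Cm * \<tau> * (sqrt (real k * (real d + ln (real n)) / real n)
                          + sqrt (real d + ln (real n)) * exp (- s\<^sup>2 / Ce)))))"
proof -
  define Cm where "Cm = center_const Cq"
  have Cm: "0 < Cm" using assms by (simp add: Cm_def center_const_def add_pos_nonneg)
  have Ce: "0 < 16384 * Cq\<^sup>2" using assms by simp
  show ?thesis
    unfolding Let_def
  proof (rule exI[of _ 20000], rule exI[of _ Cm], rule exI[of _ "16384 * Cq\<^sup>2"], intro conjI allI impI; (elim conjE)?)
    show "(0::real) < 20000" by simp
    show "0 < Cm" by (rule Cm)
    show "0 < 16384 * Cq\<^sup>2" by (rule Ce)
    fix M :: "'a measure" and n k d :: nat and \<mu> :: "nat \<Rightarrow> nat \<Rightarrow> real" and \<sigma>star :: "nat \<Rightarrow> nat"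
      and g :: "nat \<Rightarrow> 'a \<Rightarrow> nat \<Rightarrow> real" and \<tau> :: real and \<sigma>hat :: "'a \<Rightarrow> nat \<Rightarrow> nat"
    let ?h = "\<lambda>\<omega> i j. \<mu> (\<sigma>star i) j + g i \<omega> j"
    let ?D = "Delta_min k d \<mu>"
    assume PM: "prob_space M" and n4: "n \<ge> 4" and k2: "k \<ge> 2" and dv: "k dvd n" and \<tau>: "\<tau> > 0"
      and lab: "\<forall>i<n. \<sigma>star i < k" and crd: "\<forall>a<k. card {i. i < n \<and> \<sigma>star i = a} = n div k"
      and ind: "prob_space.indep_vars M (\<lambda>_. PiM {..<d} (\<lambda>_. borel)) (\<lambda>i \<omega>. restrict (g i \<omega>) {..<d}) {..<n}"
      and mean: "\<forall>i<n. \<forall>j<d. integrable M (\<lambda>\<omega>. g i \<omega> j) \<and> (\<integral>\<omega>. g i \<omega> j \<partial>M) = 0"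
      and psi: "\<forall>i<n. psi2_vec M d (g i) \<le> ereal \<tau>"
      and diam: "\<forall>a<k. \<forall>b<k. Delta_ab d \<mu> a b \<le> Cq * ?D"
      and snr: "20000 * (sqrt (real k * real d / real n * ln (real n)) + real k * real d / real n + real k) \<le> (?D / \<tau>)\<^sup>2"
      and alg: "\<forall>\<omega>\<in>space M. \<exists>Y. sdp_minimizer n k (dist_matrix d (?h \<omega>)) Y \<and> rounding_output n k Y (\<sigma>hat \<omega>)"
    define m where "m = n div k"
    have nm: "n = m * k" using dv by (simp add: m_def)
    have m0: "0 < m" using nm n4 by (cases m) auto
    have km: "real k * y / real n = y / real m" for y
      using nm k2 by simp
    \<comment> \<open>A norm of at most \<open>\<tau>\<close> is strictly below
      \<open>2 * \<tau>\<close>, which gives the moment bound at that scale.\<close>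
    interpret noisy_clustering M n d g "2 * \<tau>" k m \<sigma>star
    proof (intro noisy_clustering.intro subgaussian_noise.intro subgaussian_noise_axioms.intro
        balanced_clustering.intro noisy_clustering_axioms.intro)
      show "n = m * k" by (rule nm)
    next
      fix i u assume i: "i < n" and u: "dot d u u = 1"
      have "psi2 M (\<lambda>\<omega>. dot d (g i \<omega>) u) \<le> psi2_vec M d (g i)"
        unfolding psi2_vec_def dot_def using u by (intro Sup_upper) (auto simp: dot_def power2_eq_square)
      also have "\<dots> \<le> ereal \<tau>" using psi i by simp
      also have "\<dots> < ereal (2 * \<tau>)" using \<tau> by simp
      finally show "(\<integral>\<^sup>+\<omega>. ennreal (exp ((dot d (g i \<omega>) u)\<^sup>2 / (2 * \<tau>)\<^sup>2)) \<partial>M) \<le> 2"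
        by (rule psi2_less_imp_exp_square_le)
    qed (use PM n4 k2 \<tau> lab crd[folded m_def] ind mean m0 in auto)
    let ?S = "{Delta_ab d \<mu> a b | a b. a < k \<and> b < k \<and> a \<noteq> b}"
    have "?S \<subseteq> (\<lambda>(a, b). Delta_ab d \<mu> a b) ` ({..<k} \<times> {..<k})" by auto
    then have finS: "finite ?S" by (rule finite_subset) simp
    have "Delta_ab d \<mu> 0 1 \<in> ?S" using k2 by force
    then have "?D \<in> ?S" unfolding Delta_min_def using finS by (intro Min_in) auto
    then have D0: "0 \<le> ?D" by (auto simp: Delta_ab_def)
    have sep: "?D \<le> Delta_ab d \<mu> a b" if "a < k" "b < k" "a \<noteq> b" for a b
      unfolding Delta_min_def using finS that by (intro Min_le) auto
    \<comment> \<open>The signal-to-noise condition itself excludes coinciding centers, since the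
      required bound contains a positive multiple of \<open>k\<close>.\<close>
    have "0 < (?D / \<tau>)\<^sup>2"
    proof (rule less_le_trans[OF _ snr])
      have "0 \<le> sqrt (real k * real d / real n * ln (real n))" using n4 by (intro real_sqrt_ge_zero mult_nonneg_nonneg) auto
      moreover have "0 \<le> real k * real d / real n" "0 < real k" using k2 by simp_all
      ultimately show "0 < 20000 * (sqrt (real k * real d / real n * ln (real n)) + real k * real d / real n + real k)"
        unfolding distrib_left by linarith
    qed
    then have D: "0 < ?D" using D0 by (cases "?D = 0") auto
    have snr': "20000 * (sqrt (real d / real m * ln (real n)) + real d / real m + real k) \<le> (?D / \<tau>)\<^sup>2"
      using snr unfolding km .
    from center_estimates[OF refl assms D sep _ snr'] diam
    obtain E where E: "E \<in> sets M" "1 - 4 / real n \<le> measure M E"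
      and est: "\<forall>\<omega>\<in>E. \<forall>Y \<sigma>h. sdp_minimizer n k (dist_matrix d (?h \<omega>)) Y \<longrightarrow> rounding_output n k Y \<sigma>h \<longrightarrow>
        (\<forall>a<k. \<exists>b<k. vnorm d (vdiff (center_est n k (?h \<omega>) \<sigma>h a) (\<mu> b))
          \<le> Cm * \<tau> * (sqrt ((real d + ln (real n)) / real m)
            + sqrt (real d + ln (real n)) * exp (- (?D / \<tau>)\<^sup>2 / (16384 * Cq\<^sup>2))))"
      unfolding Cm_def by blast
    show "\<exists>E\<in>sets M. 1 - 4 / real n \<le> measure M E \<and>
        (\<forall>\<omega>\<in>E. Max ((\<lambda>a. Min ((\<lambda>\<pi>. vnorm d (vdiff (center_est n k (?h \<omega>) (\<sigma>hat \<omega>) a) (\<mu> (\<pi> a))))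
                                  ` {\<pi>. \<pi> permutes {..<k}})) ` {..<k})
              \<le> Cm * \<tau> * (sqrt (real k * (real d + ln (real n)) / real n)
                          + sqrt (real d + ln (real n)) * exp (- (?D / \<tau>)\<^sup>2 / (16384 * Cq\<^sup>2))))"
      unfolding km
    proof (intro bexI[OF _ E(1)] conjI E(2) ballI)
      fix \<omega> assume \<omega>: "\<omega> \<in> E"
      then have "\<omega> \<in> space M" using E(1) sets.sets_into_space by blast
      then obtain Y where Y: "sdp_minimizer n k (dist_matrix d (?h \<omega>)) Y" "rounding_output n k Y (\<sigma>hat \<omega>)"
        using alg by blast
      let ?B = "Cm * \<tau> * (sqrt ((real d + ln (real n)) / real m)
            + sqrt (real d + ln (real n)) * exp (- (?D / \<tau>)\<^sup>2 / (16384 * Cq\<^sup>2)))"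
      let ?v = "\<lambda>a \<pi>. vnorm d (vdiff (center_est n k (?h \<omega>) (\<sigma>hat \<omega>) a) (\<mu> (\<pi> a)))"
      have "Min (?v a ` {\<pi>. \<pi> permutes {..<k}}) \<le> ?B" if a: "a < k" for a
      proof -
        obtain b where b: "b < k" "vnorm d (vdiff (center_est n k (?h \<omega>) (\<sigma>hat \<omega>) a) (\<mu> b)) \<le> ?B"
          using est \<omega> Y a by blast
        \<comment> \<open>The minimum over permutations is taken for each \<open>a\<close>
          separately, so any permutation sending \<open>a\<close> to \<open>b\<close> will do, and
          different \<open>a\<close> may share the same \<open>b\<close>.\<close>
        have "Transposition.transpose a b permutes {..<k}" using a b by (intro permutes_swap_id) auto
        then have "Min (?v a ` {\<pi>. \<pi> permutes {..<k}}) \<le> ?v a (Transposition.transpose a b)"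
          by (intro Min_le finite_imageI finite_permutations imageI[of "Transposition.transpose a b" _ "?v a"]) auto
        with b(2) show ?thesis by simp
      qed
      then show "Max ((\<lambda>a. Min (?v a ` {\<pi>. \<pi> permutes {..<k}})) ` {..<k}) \<le> ?B"
        using k2 by (intro Max.boundedI) (auto simp: lessThan_empty_iff)
    qed
  qed
qed

end
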